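(* Let $s>0$, $1\le p<\infty$ and $R>0$, and assume that it is not the case that both $p=1$ and $s$ is an integer $\ge2$. There exists a finite constant $K=K_{s,p,R,N}$ such that $$\|f\|_{L^p(\mathbb{R}^N)}^{1-1/N}\,|f|_{W^{s,p}}^{1/N}\le K\,|f\circ T|_{W^{s,p}}$$ for each $T\in\mathrm{SL}_N$ and each $f\in W^{s,p}(\mathbb{R}^N)$ supported in $B(0,R)$.
   Context: $N\ge 2$ is an integer; $\mathrm{SL}_N$ is the group of real $N\times N$ matrices of determinant $1$, identified with linear maps of $\mathbb{R}^N$; $B(0,R)$ is the Euclidean ball of radius $R$ centered at $0$ in $\mathbb{R}^N$. For $f:\mathbb{R}^N\to\mathbb{R}$ measurable and $h\in\mathbb{R}^N$, $\Delta_h f(x)=f(x+h)-f(x)$ and $\Delta_h^{m+1}=\Delta_h\circ\Delta_h^m$. $\lfloor s\rfloor$ is the integer part of $s$. If $s$ is not an integer, $\dot W^{s,p}(\mathbb{R}^N)$ is the space of $f\in L^1_{\mathrm{loc}}(\mathbb{R}^N)$ with $|f|_{W^{s,p}}<\infty$, where $|f|_{W^{s,p}}^p=\int_{\mathbb{R}^N}\frac{\|\Delta_h^{\lfloor s\rfloor+1}f\|_{L^p}^p}{|h|^{sp+N}}\,dh$. If $s\ge1$ is an integer, $\dot W^{s,p}(\mathbb{R}^N)$ is the space of $f\in W^{s,1}_{\mathrm{loc}}(\mathbb{R}^N)$ with $|f|_{W^{s,p}}<\infty$, where $|f|_{W^{s,p}}^p=\int_{\mathbb{R}^N}\|D^s_xf\|^p\,dx$;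 here $D_x^sf$ is the $s$-linear form given by the $s$-th derivative of $f$ at $x$ and $\|\eta\|=\sup_{|x_1|\le1,\dots,|x_s|\le1}|\eta(x_1,\dots,x_s)|$. Finally $W^{s,p}(\mathbb{R}^N)=L^p(\mathbb{R}^N)\cap\dot W^{s,p}(\mathbb{R}^N)$. *)

theory Defs
  imports "HOL-Analysis.Analysis"
begin

text \<open>Functions are Lebesgue measurable; measures and integrals of possibly infinite quantities
  are taken in \<^typ>\<open>ennreal\<close>, so that an infinite (semi)norm is really \<^term>\<open>\<infinity>\<close>.\<close>

(* Intended for exponents a > 0 only; then infinity to the power a is infinity. *)
definition ennreal_powr :: "ennreal \<Rightarrow> real \<Rightarrow> ennreal" where
  "ennreal_powr x a = (if x = \<infinity> then \<infinity> else ennreal (enn2real x powr a))"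

definition Lp_norm_pow :: "real \<Rightarrow> (real^'n \<Rightarrow> real) \<Rightarrow> ennreal" where
  "Lp_norm_pow p f = (\<integral>\<^sup>+ x. ennreal (\<bar>f x\<bar> powr p) \<partial>lebesgue)"

definition Lp_norm :: "real \<Rightarrow> (real^'n \<Rightarrow> real) \<Rightarrow> ennreal" where
  "Lp_norm p f = ennreal_powr (Lp_norm_pow p f) (1 / p)"

definition Lp :: "real \<Rightarrow> (real^'n \<Rightarrow> real) set" where
  "Lp p = {f \<in> borel_measurable lebesgue. Lp_norm p f < \<infinity>}"

definition L1_loc :: "(real^'n \<Rightarrow> real) set" where
  "L1_loc = {f \<in> borel_measurable lebesgue. \<forall>C. compact C \<longrightarrow> f absolutely_integrable_on C}"

definition fdiff :: "real^'n \<Rightarrow> (real^'n \<Rightarrow> real) \<Rightarrow> real^'n \<Rightarrow> real" where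
  "fdiff h f = (\<lambda>x. f (x + h) - f x)"

definition partial_deriv :: "'n \<Rightarrow> (real^'n \<Rightarrow> real) \<Rightarrow> real^'n \<Rightarrow> real" where
  "partial_deriv i \<phi> = (\<lambda>x. frechet_derivative \<phi> (at x) (axis i 1))"

(* The list [i1, ..., ik] stands for the iterated derivative d_i1 ... d_ik. *)
fun partial_derivs :: "'n list \<Rightarrow> (real^'n \<Rightarrow> real) \<Rightarrow> real^'n \<Rightarrow> real" where
  "partial_derivs [] \<phi> = \<phi>"
| "partial_derivs (i # I) \<phi> = partial_deriv i (partial_derivs I \<phi>)"

(* Compactly supported smooth functions.  Differentiability of all iterated partial derivatives
   includes their continuity. *)
definition test_functions :: "(real^'n \<Rightarrow> real) set" where
  "test_functions = {\<phi>. (\<forall>I x. partial_derivs I \<phi> differentiable (at x)) \<and>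
     compact (closure {x. \<phi> x \<noteq> 0})}"

definition has_weak_deriv :: "'n list \<Rightarrow> (real^'n \<Rightarrow> real) \<Rightarrow> (real^'n \<Rightarrow> real) \<Rightarrow> bool" where
  "has_weak_deriv I f g \<longleftrightarrow> g \<in> L1_loc \<and>
     (\<forall>\<phi>\<in>test_functions.
        (LINT x|lebesgue. f x * partial_derivs I \<phi> x) =
        (-1) ^ length I * (LINT x|lebesgue. g x * \<phi> x))"

(* A representative; it is unique up to null sets. *)
definition weak_deriv :: "'n list \<Rightarrow> (real^'n \<Rightarrow> real) \<Rightarrow> real^'n \<Rightarrow> real" where
  "weak_deriv I f = (SOME g. has_weak_deriv I f g)"

definition W1_loc :: "nat \<Rightarrow> (real^'n \<Rightarrow> real) set" where
  "W1_loc k = {f \<in> L1_loc. \<forall>I. length I \<le> k \<longrightarrow> (\<exists>g. has_weak_deriv I f g)}"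

(* The k-linear form D^k f (x), evaluated at v 0, ..., v (k-1). *)
definition deriv_form :: "nat \<Rightarrow> (real^'n \<Rightarrow> real) \<Rightarrow> real^'n \<Rightarrow> (nat \<Rightarrow> real^'n) \<Rightarrow> real" where
  "deriv_form k f x v =
     (\<Sum>I | length I = k. weak_deriv I f x * (\<Prod>j<k. v j $ (I ! j)))"

definition form_norm :: "nat \<Rightarrow> ((nat \<Rightarrow> real^'n) \<Rightarrow> real) \<Rightarrow> real" where
  "form_norm k \<eta> = (SUP v \<in> {v. \<forall>j<k. norm (v j) \<le> 1}. \<bar>\<eta> v\<bar>)"

definition W_seminorm_pow :: "real \<Rightarrow> real \<Rightarrow> (real^'n \<Rightarrow> real) \<Rightarrow> ennreal" where
  "W_seminorm_pow s p f =
     (if s \<in> \<int>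
      then \<integral>\<^sup>+ x. ennreal (form_norm (nat \<lfloor>s\<rfloor>) (deriv_form (nat \<lfloor>s\<rfloor>) f x) powr p) \<partial>lebesgue
      else \<integral>\<^sup>+ h. Lp_norm_pow p ((fdiff h ^^ (nat \<lfloor>s\<rfloor> + 1)) f) /
                  ennreal (norm h powr (s * p + real CARD('n))) \<partial>lebesgue)"

definition W_seminorm :: "real \<Rightarrow> real \<Rightarrow> (real^'n \<Rightarrow> real) \<Rightarrow> ennreal" where
  "W_seminorm s p f = ennreal_powr (W_seminorm_pow s p f) (1 / p)"

definition W_dot :: "real \<Rightarrow> real \<Rightarrow> (real^'n \<Rightarrow> real) set" where
  "W_dot s p = {f \<in> (if s \<in> \<int> then W1_loc (nat \<lfloor>s\<rfloor>) else L1_loc). W_seminorm s p f < \<infinity>}"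

definition W :: "real \<Rightarrow> real \<Rightarrow> (real^'n \<Rightarrow> real) set" where
  "W s p = Lp p \<inter> W_dot s p"

definition SL :: "(real^'n^'n) set" where
  "SL = {T. det T = 1}"

(* Support in the sense of distributions; spheres being null sets, the open and the closed ball
   give the same notion. *)
definition supported_in_ball :: "real \<Rightarrow> (real^'n \<Rightarrow> real) \<Rightarrow> bool" where
  "supported_in_ball R f \<longleftrightarrow> (AE x in lebesgue. x \<notin> ball 0 R \<longrightarrow> f x = 0)"

end

theory Submission
  imports Defs
begin

text \<open>Write \<open>N\<close> for the dimension, \<open>\<alpha> = s p\<close>, and let \<open>X\<close>, \<open>Y\<close>, \<open>Z\<close> be the \<open>p\<close>-th powers of the
\<open>L\<^sup>p\<close> norm of \<open>f\<close>, of the seminorm of \<open>f\<close> and of the seminorm of \<open>f \<circ> T\<close>.  Let \<open>t\<close> be the largest length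
of a column \<open>T e\<^sub>j\<close>.  Along \<open>e\<^sub>j\<close> the function \<open>f \<circ> T\<close> runs through the support of \<open>f\<close> at speed \<open>t\<close>, so it
lives on a scale \<open>R / t\<close> there, and a Poincare inequality in this one direction gives
\<open>X \<le> C R\<^sup>\<alpha> t\<^sup>-\<^sup>\<alpha> Z\<close>.  On the other hand \<open>f = (f \<circ> T) \<circ> T\<^sup>-\<^sup>1\<close>, and if \<open>\<bar>x\<bar> \<le> a \<bar>T x\<bar>\<close> for all \<open>x\<close>, then
\<open>Y \<le> C a\<^sup>\<alpha> Z\<close>.  Since \<open>det T = 1\<close>, Cramer's rule bounds \<open>T\<^sup>-\<^sup>1\<close> by products of \<open>N - 1\<close> entries of \<open>T\<close>, so
that \<open>a\<close> can be a constant times \<open>t\<close> to the power \<open>N - 1\<close> (norm_preimage_SL_le).  In the product of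
\<open>X\<close> to the power \<open>1 - 1/N\<close> and \<open>Y\<close> to the power \<open>1/N\<close> the powers of \<open>t\<close> then cancel (combine_powers).

The Poincare inequality rests in all cases on one remark: the translates of \<open>f\<close> by \<open>h, 2 h, \<dots>\<close>
are disjoint from \<open>f\<close> as soon as \<open>\<bar>h\<bar> \<ge> 2 R\<close>, and therefore \<open>X \<le> D h\<close>, where \<open>D h\<close> is the \<open>p\<close>-th power of
the \<open>L\<^sup>p\<close> norm of the \<open>m\<close>-th difference of \<open>f\<close> with step \<open>h\<close> (Lp_norm_pow_le_fdiff).

For \<open>s\<close> not an integer put \<open>m = \<lfloor>s\<rfloor> + 1\<close>.  Composition with \<open>T\<close> replaces \<open>D\<close> by \<open>D \<circ> T\<close>, so both
bounds concern \<open>\<integral> D (T k) \<bar>k\<bar>\<^sup>-\<^sup>\<alpha>\<^sup>-\<^sup>N dk\<close>.  For the first one (fractional_lower), \<open>D (T k) \<ge> X\<close> for a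
fixed proportion of the \<open>k\<close> in a ball of radius comparable to \<open>R / t\<close>.  For the second one
(fractional_upper), substituting \<open>h = T k\<close> would give the power \<open>\<alpha> + N\<close> of \<open>a\<close>.  Instead, \<open>D\<close> is
almost subadditive: \<open>D h\<close> is bounded by the values of \<open>D\<close> at \<open>(i/m) k\<close> and \<open>h + (i/m) k\<close>, for any \<open>k\<close>.
Averaging this over the image under \<open>T\<close> of the ball of radius \<open>a \<bar>h\<bar>\<close> gains the volume of that
ball, hence the factor \<open>a\<^sup>-\<^sup>N\<close>, and Tonelli's theorem does the rest.

For \<open>s = k\<close> an integer, the second bound is the chain rule for weak derivatives: \<open>D\<^sup>k f (T x)\<close> is
\<open>D\<^sup>k (f \<circ> T) (x)\<close> with \<open>T\<^sup>-\<^sup>1\<close> substituted in each argument (nn_integral_form_norm_SL_le).  For the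
first one, the \<open>k\<close>-th difference of \<open>f \<circ> T\<close> with step \<open>r e\<^sub>j\<close>, \<open>r = 2 R / t\<close>, is bounded in \<open>L\<^sup>p\<close> by \<open>r\<^sup>k\<close>
times the \<open>k\<close>-th weak derivative along \<open>e\<^sub>j\<close> (Lp_norm_pow_fdiff_le_form_norm).  Weak derivatives are
chosen representatives, so both steps use that they are unique almost everywhere, which needs
enough test functions (AE_zero_if_orthogonal_to_test_functions).\<close>

section \<open>Linear maps of determinant one preserve Lebesgue measure\<close>

text \<open>A sheared box keeps its volume, by measure_shear_interval after a translation that makes the
edge of the box in direction \<open>n\<close> start at a nonnegative coordinate.  Boxes determine the measure.
The image of a box under the shear \<open>\<sigma>\<close> is its preimage under the inverse shear \<open>\<tau>\<close>, so this says
that \<open>\<tau>\<close> preserves the measure, and then so does \<open>\<sigma>\<close>.\<close>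
lemma lborel_distr_shear:
  fixes m n :: "'n::finite"
  assumes "m \<noteq> n"
  shows "distr lborel borel (\<lambda>x::real^'n. \<chi> i. if i = m then x$m + x$n else x$i) = lborel"
proof -
  let ?\<sigma> = "\<lambda>x::real^'n. \<chi> i. if i = m then x$m + x$n else x$i"
  let ?\<tau> = "\<lambda>x::real^'n. \<chi> i. if i = m then x$m - x$n else x$i"
  have lin: "linear ?\<sigma>" "linear ?\<tau>"
    by (auto intro!: linearI simp: vec_eq_iff algebra_simps)
  have [measurable]: "?\<sigma> \<in> borel_measurable borel" "?\<tau> \<in> borel_measurable borel"
    using lin by (auto intro!: borel_measurable_continuous_onI linear_continuous_on linear_conv_bounded_linear[THEN iffD1])
  have inv: "?\<sigma> (?\<tau> x) = x" "?\<tau> (?\<sigma> x) = x" for x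
    using assms by (auto simp: vec_eq_iff)
  have cb: "measure lebesgue (?\<sigma> ` cbox a b) = measure lebesgue (cbox a b)"
    if ne: "cbox a b \<noteq> {}" for a b
  proof -
    \<comment> \<open>translating by \<open>v\<close> makes the coordinate \<open>n\<close> of the lower corner nonnegative\<close>
    let ?v = "axis n (\<bar>a $ n\<bar>) :: real^'n"
    have *: "cbox (a + ?v) (b + ?v) = (+) ?v ` cbox a b"
      by (metis cbox_translation add.commute)
    have "?\<sigma> ` cbox (a + ?v) (b + ?v) = (+) (?\<sigma> ?v) ` (?\<sigma> ` cbox a b)"
      unfolding * image_image by (intro image_cong refl) (auto simp: vec_eq_iff)
    then have "measure lebesgue (?\<sigma> ` cbox a b) = measure lebesgue (?\<sigma> ` cbox (a + ?v) (b + ?v))"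
      by (simp add: measure_translation)
    also have "\<dots> = measure lebesgue (cbox (a + ?v) (b + ?v))"
      by (rule measure_shear_interval) (use assms ne in \<open>auto simp: * \<close>)
    also have "\<dots> = measure lebesgue (cbox a b)"
      unfolding * by (simp add: measure_translation)
    finally show ?thesis .
  qed
  have "lborel = distr lborel borel ?\<tau>"
  proof (rule lborel_eqI)
    fix l u :: "real^'n" assume le: "\<And>b. b \<in> Basis \<Longrightarrow> l \<bullet> b \<le> u \<bullet> b"
    then have ne: "cbox l u \<noteq> {}" by (simp add: box_ne_empty)
    have vim: "f -` S = g ` S" if "\<And>x. g (f x) = x" "\<And>x. f (g x) = x"
      for f :: "real^'n \<Rightarrow> real^'n" and g S
      using that by (auto simp: image_iff) metis
    have vim: "?\<tau> -` S = ?\<sigma> ` S" for S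
      by (rule vim) (rule inv)+
    have "negligible (?\<sigma> ` (cbox l u - box l u))"
      using negligible_frontier_interval lin(1)
      by (intro negligible_differentiable_image_negligible linear_imp_differentiable_on) auto
    then have "measure lebesgue (?\<sigma> ` box l u) = measure lebesgue (?\<sigma> ` cbox l u)"
      by (intro measure_negligible_symdiff)
        (use measurable_linear_image_interval[OF lin(1)] in \<open>auto elim!: negligible_subset intro: box_subset_cbox[THEN subsetD]\<close>)
    moreover have "measure lebesgue (?\<sigma> ` cbox l u) = (\<Prod>b\<in>Basis. (u - l) \<bullet> b)"
      using cb[OF ne] ne by (simp add: content_cbox_if inner_diff_left)
    moreover have "?\<sigma> ` box l u \<in> lmeasurable"
    proof (rule fmeasurableI2)
      show "?\<sigma> ` cbox l u \<in> lmeasurable" by (rule measurable_linear_image_interval[OF lin(1)])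
      show "?\<sigma> ` box l u \<subseteq> ?\<sigma> ` cbox l u" by (intro image_mono box_subset_cbox)
      show "?\<sigma> ` box l u \<in> sets lebesgue"
        unfolding vim[symmetric] using measurable_sets[of ?\<tau> borel borel "box l u"] by simp
    qed
    moreover have "?\<sigma> ` box l u \<in> sets borel"
      unfolding vim[symmetric] using measurable_sets[of ?\<tau> borel borel "box l u"] by simp
    moreover have "emeasure lborel (?\<sigma> ` box l u) = emeasure lebesgue (?\<sigma> ` box l u)"
      using \<open>?\<sigma> ` box l u \<in> sets borel\<close> by simp
    ultimately show "emeasure (distr lborel borel ?\<tau>) (box l u) = (\<Prod>b\<in>Basis. (u - l) \<bullet> b)"
      using emeasure_eq_measure2[of "?\<sigma> ` box l u" lebesgue]
      by (simp only: emeasure_distr[OF \<open>?\<tau> \<in> borel_measurable borel\<close>[folded measurable_lborel2]] vim space_borel) (simp add: emeasure_distr vim)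
  qed simp
  then have "distr lborel borel ?\<sigma> = distr (distr lborel borel ?\<tau>) borel ?\<sigma>" by simp
  also have "\<dots> = lborel"
    by (subst distr_distr) (simp_all add: o_def inv distr_id2)
  finally show ?thesis .
qed

lemma lborel_distr_permute_coordinates:
  fixes m n :: "'n::finite"
  shows "distr lborel borel (\<lambda>x::real^'n. \<chi> i. x $ Transposition.transpose m n i) = lborel"
proof -
  let ?\<pi> = "\<lambda>x::real^'n. \<chi> i. x $ Transposition.transpose m n i"
  have [measurable]: "?\<pi> \<in> borel_measurable borel"
    by (intro borel_measurable_continuous_onI continuous_intros)
  have "lborel = distr lborel borel ?\<pi>"
  proof (rule lborel_eqI)
    fix l u :: "real^'n" assume le: "\<And>b. b \<in> Basis \<Longrightarrow> l \<bullet> b \<le> u \<bullet> b"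
    have le': "l $ i \<le> u $ i" for i
      using le[of "axis i 1"] by (simp add: inner_axis)
    have "?\<pi> -` box l u = box (?\<pi> l) (?\<pi> u)"
      by (auto simp: mem_box_cart) (metis transpose_involutory)+
    then have "emeasure (distr lborel borel ?\<pi>) (box l u) = emeasure lborel (box (?\<pi> l) (?\<pi> u))"
      by (simp add: emeasure_distr)
    also have "\<dots> = ennreal (\<Prod>b\<in>Basis. (?\<pi> u - ?\<pi> l) \<bullet> b)"
      using le' by (subst emeasure_lborel_box) (auto simp: Basis_vec_def inner_axis inner_diff_left)
    also have "(\<Prod>b\<in>Basis. (?\<pi> u - ?\<pi> l) \<bullet> b) = (\<Prod>i\<in>UNIV. (?\<pi> u - ?\<pi> l) $ i)"
      by (simp add: Basis_vec_def prod.UNION_disjoint axis_eq_axis inner_axis prod.reindex inj_on_def UNION_singleton_eq_range)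
    also have "\<dots> = (\<Prod>i\<in>UNIV. (u - l) $ i)"
      by (rule prod.reindex_bij_witness[of _ "Transposition.transpose m n" "Transposition.transpose m n"]) auto
    also have "\<dots> = (\<Prod>b\<in>Basis. (u - l) \<bullet> b)"
      by (simp add: Basis_vec_def prod.UNION_disjoint axis_eq_axis inner_axis prod.reindex inj_on_def UNION_singleton_eq_range)
    finally show "emeasure (distr lborel borel ?\<pi>) (box l u) = (\<Prod>b\<in>Basis. (u - l) \<bullet> b)" .
  qed simp
  then show ?thesis by simp
qed

lemma measurable_matrix_vector_mult[measurable]:
  "(\<lambda>x. (A::real^'n^'m) *v x) \<in> borel_measurable borel"
  by (intro borel_measurable_continuous_onI linear_continuous_on matrix_vector_mul_bounded_linear)

text \<open>The claim is multiplicative in \<open>A\<close>, so it suffices to check the generators of the matrices: a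
zero row makes the determinant vanish, diagonal matrices scale the coordinates, and
transpositions and shears preserve the measure and have determinant \<open>\<plusminus>1\<close>.\<close>
lemma nn_integral_lborel_matrix:
  fixes A :: "real^'n^'n"
  assumes "f \<in> borel_measurable borel" and "det A \<noteq> 0"
  shows "(\<integral>\<^sup>+x. ennreal \<bar>det A\<bar> * f (A *v x) \<partial>lborel) = (\<integral>\<^sup>+x. f x \<partial>lborel)"
proof -
  have "det A \<noteq> 0 \<longrightarrow> (\<forall>f\<in>borel_measurable borel.
      (\<integral>\<^sup>+x. ennreal \<bar>det A\<bar> * f (A *v x) \<partial>lborel) = (\<integral>\<^sup>+x. f x \<partial>lborel))"
  proof (induction A rule: induct_matrix_elementary_alt)
    case (1 A B)
    show ?case
    proof (intro impI ballI)
      fix f :: "real^'n \<Rightarrow> ennreal" assume AB: "det (A ** B) \<noteq> 0" and f[measurable]: "f \<in> borel_measurable borel"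
      have d: "det A \<noteq> 0" "det B \<noteq> 0" using AB by (auto simp: det_mul)
      have "(\<integral>\<^sup>+x. ennreal \<bar>det (A ** B)\<bar> * f ((A ** B) *v x) \<partial>lborel)
         = (\<integral>\<^sup>+x. ennreal \<bar>det B\<bar> * (ennreal \<bar>det A\<bar> * f (A *v (B *v x))) \<partial>lborel)"
        by (simp add: det_mul abs_mult ennreal_mult matrix_vector_mul_assoc mult_ac)
      also have "\<dots> = (\<integral>\<^sup>+x. ennreal \<bar>det A\<bar> * f (A *v x) \<partial>lborel)"
        using 1(2) d(2) by (intro bspec[where x="\<lambda>y. ennreal \<bar>det A\<bar> * f (A *v y)"]) auto
      also have "\<dots> = (\<integral>\<^sup>+x. f x \<partial>lborel)"
        using 1(1) d(1) f by blast
      finally show "(\<integral>\<^sup>+x. ennreal \<bar>det (A ** B)\<bar> * f ((A ** B) *v x) \<partial>lborel) = (\<integral>\<^sup>+x. f x \<partial>lborel)" .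
    qed
  next
    case (2 A i)
    then show ?case by (simp add: det_zero_row)
  next
    case (3 A)
    let ?c = "\<lambda>b::real^'n. \<Sum>i\<in>UNIV. A $ i $ i * (b $ i)"
    show ?case
    proof (intro impI ballI)
      fix f :: "real^'n \<Rightarrow> ennreal" assume d: "det A \<noteq> 0" and f[measurable]: "f \<in> borel_measurable borel"
      have dA: "det A = (\<Prod>i\<in>UNIV. A $ i $ i)" by (rule det_diagonal) (use 3 in auto)
      with d have nz: "A $ i $ i \<noteq> 0" for i by auto
      have c: "?c (axis i 1) = A $ i $ i" for i
        by (simp add: axis_def if_distrib cong: if_cong)
      have T: "0 + (\<Sum>j\<in>Basis. (?c j * (x \<bullet> j)) *\<^sub>R j) = A *v x" for x
      proof -
        have "(\<Sum>j\<in>Basis. (?c j * (x \<bullet> j)) *\<^sub>R j) = (\<Sum>i\<in>UNIV. (A $ i $ i * x $ i) *\<^sub>R axis i 1)"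
          by (simp add: Basis_vec_def UNION_singleton_eq_range sum.reindex inj_on_def axis_eq_axis c inner_axis)
        also have "\<dots> = A *v x"
        proof -
          have "(A *v x) $ k = A $ k $ k * x $ k" for k
          proof -
            have "(A *v x) $ k = (\<Sum>j\<in>UNIV. if j = k then A $ k $ k * x $ k else 0)"
              unfolding matrix_vector_mult_def vec_lambda_beta by (rule sum.cong) (auto simp: 3)
            also have "\<dots> = A $ k $ k * x $ k" by simp
            finally show ?thesis .
          qed
          moreover have "(\<Sum>i\<in>UNIV. (A $ i $ i * x $ i) *\<^sub>R axis i 1) $ k = A $ k $ k * x $ k" for k
            by (simp add: sum_component axis_def if_distrib cong: if_cong)
          ultimately show ?thesis by (simp add: vec_eq_iff)
        qed
        finally show ?thesis by simp
      qed
      have "(\<Prod>j\<in>Basis. \<bar>?c j\<bar>) = \<bar>det A\<bar>"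
        by (simp add: Basis_vec_def UNION_singleton_eq_range prod.reindex inj_on_def axis_eq_axis c dA abs_prod)
      moreover have "lborel = density (distr lborel borel (\<lambda>x. 0 + (\<Sum>j\<in>Basis. (?c j * (x \<bullet> j)) *\<^sub>R j)))
          (\<lambda>_. (\<Prod>j\<in>Basis. \<bar>?c j\<bar>))"
        using nz by (intro lborel_affine_euclidean) (auto simp: Basis_vec_def c)
      ultimately have *: "lborel = density (distr lborel borel ((*v) A)) (\<lambda>_. \<bar>det A\<bar>)"
        by (simp only: T)
      show "(\<integral>\<^sup>+x. ennreal \<bar>det A\<bar> * f (A *v x) \<partial>lborel) = (\<integral>\<^sup>+x. f x \<partial>lborel)"
        by (subst (2) *) (simp add: nn_integral_density nn_integral_distr)
    qed
  next
    case (4 m n)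
    let ?P = "(\<chi> i j. mat 1 $ i $ Transposition.transpose m n j) :: real^'n^'n"
    have P: "?P *v x = (\<chi> i. x $ Transposition.transpose m n i)" for x :: "real^'n"
    proof -
      have "(?P *v x) $ i = x $ Transposition.transpose m n i" for i
      proof -
        have "(?P *v x) $ i = (\<Sum>j\<in>UNIV. if j = Transposition.transpose m n i then x $ j else 0)"
          unfolding matrix_vector_mult_def vec_lambda_beta by (rule sum.cong) (auto simp: mat_def)
        also have "\<dots> = x $ Transposition.transpose m n i" by simp
        finally show ?thesis .
      qed
      then show ?thesis by (simp add: vec_eq_iff)
    qed
    have m: "(\<lambda>x::real^'n. \<chi> i. x $ Transposition.transpose m n i) \<in> borel_measurable borel"
      by (intro borel_measurable_continuous_onI continuous_intros)
    have "\<bar>det ?P\<bar> = 1"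
      using det_permute_columns[OF permutes_swap_id[of m UNIV n], of "mat 1 :: real^'n^'n"]
      by (simp add: sign_def split: if_splits)
    moreover have "(\<integral>\<^sup>+x. f (\<chi> i. x $ Transposition.transpose m n i) \<partial>lborel) = (\<integral>\<^sup>+x. f x \<partial>lborel)"
      if "f \<in> borel_measurable borel" for f :: "real^'n \<Rightarrow> ennreal"
      using nn_integral_distr[of "\<lambda>x::real^'n. \<chi> i. x $ Transposition.transpose m n i" lborel borel f] m that
      by (simp add: lborel_distr_permute_coordinates)
    ultimately show ?case by (auto simp: P)
  next
    case (5 m n)
    let ?S = "(\<chi> i j. of_bool (i = m \<and> j = n \<or> i = j)) :: real^'n^'n"
    have S: "?S *v x = (\<chi> i. if i = m then x $ m + x $ n else x $ i)" for x :: "real^'n"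
    proof -
      have "(?S *v x) $ i = (\<Sum>j\<in>UNIV. (if j = i then x $ i else 0) + (if j = n then if i = m then x $ n else 0 else 0))" for i
        unfolding matrix_vector_mult_def vec_lambda_beta by (rule sum.cong) (use 5 in auto)
      also have "(\<Sum>j\<in>UNIV. (if j = i then x $ i else 0) + (if j = n then if i = m then x $ n else 0 else 0))
        = (if i = m then x $ m + x $ n else x $ i)" for i
        by (simp add: sum.distrib)
      finally show ?thesis by (simp add: vec_eq_iff)
    qed
    have m: "(\<lambda>x::real^'n. \<chi> i. if i = m then x $ m + x $ n else x $ i) \<in> borel_measurable borel"
      unfolding S[symmetric] by measurable
    have "?S = (\<chi> k. if k = m then row m (mat 1) + 1 *s row n (mat 1) else row k (mat 1))"
      using 5 by (auto simp: vec_eq_iff row_def mat_def)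
    then have "det ?S = 1"
      using det_row_operation[OF 5, of "mat 1::real^'n^'n" 1] by simp
    moreover have "(\<integral>\<^sup>+x. f (\<chi> i. if i = m then x $ m + x $ n else x $ i) \<partial>lborel) = (\<integral>\<^sup>+x. f x \<partial>lborel)"
      if "f \<in> borel_measurable borel" for f :: "real^'n \<Rightarrow> ennreal"
      using nn_integral_distr[of "\<lambda>x::real^'n. \<chi> i. if i = m then x $ m + x $ n else x $ i" lborel borel f] m that
      by (simp add: lborel_distr_shear[OF 5])
    ultimately show ?case unfolding S by simp
  qed
  with assms show ?thesis by blast
qed

text \<open>The translation \<open>b\<close> is included so that translations are the case \<open>A = mat 1\<close> of all the
transformation rules below.\<close>
lemma distr_lborel_unimodular:
  fixes A :: "real^'n^'n"
  assumes "\<bar>det A\<bar> = 1"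
  shows "distr lborel borel (\<lambda>x. A *v x + b) = lborel"
proof (rule measure_eqI)
  fix S assume "S \<in> sets (distr lborel borel (\<lambda>x. A *v x + b))"
  then have [measurable]: "S \<in> sets borel" by simp
  have "emeasure (distr lborel borel (\<lambda>x. A *v x + b)) S = (\<integral>\<^sup>+x. indicator S (A *v x + b) \<partial>lborel)"
    by (subst nn_integral_indicator[symmetric]) (simp_all add: nn_integral_distr del: nn_integral_indicator)
  also have "\<dots> = (\<integral>\<^sup>+x. indicator S (x + b) \<partial>lborel)"
    using nn_integral_lborel_matrix[of "\<lambda>x. indicator S (x + b)" A] assms by auto
  also have "\<dots> = (\<integral>\<^sup>+x. indicator S x \<partial>distr lborel borel ((+) b))"
    by (simp add: nn_integral_distr add.commute del: nn_integral_indicator)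
  finally show "emeasure (distr lborel borel (\<lambda>x. A *v x + b)) S = emeasure lborel S"
    by (simp add: lborel_distr_plus)
qed simp

lemma measurable_lebesgue_unimodular:
  fixes A :: "real^'n^'n"
  assumes "\<bar>det A\<bar> = 1"
  shows "(\<lambda>x. A *v x + b) \<in> lebesgue \<rightarrow>\<^sub>M lebesgue"
proof (rule completion.measurable_completion2)
  show "(\<lambda>x. A *v x + b) \<in> lebesgue \<rightarrow>\<^sub>M lborel"
    by (rule measurable_completion) measurable
  then show "null_sets lborel \<subseteq> null_sets (distr lebesgue lborel (\<lambda>x. A *v x + b))"
    using distr_lborel_unimodular[OF assms, of b] by (simp add: distr_completion cong: distr_cong)
qed

lemma distr_lebesgue_unimodular:
  fixes A :: "real^'n^'n"
  assumes "\<bar>det A\<bar> = 1"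
  shows "distr lebesgue lebesgue (\<lambda>x. A *v x + b) = lebesgue"
proof -
  have m: "(\<lambda>x. A *v x + b) \<in> lebesgue \<rightarrow>\<^sub>M lborel"
    by (rule measurable_completion) measurable
  have d: "distr lebesgue lborel (\<lambda>x. A *v x + b) = lborel"
    using distr_lborel_unimodular[OF assms, of b] m by (simp add: distr_completion cong: distr_cong)
  show ?thesis
    using completion.completion_distr_eq[OF m] unfolding d by simp
qed

text \<open>If a simple function \<open>g\<close> lies below \<open>\<psi>\<close>, then \<open>g \<circ> T\<close> lies below \<open>\<psi> \<circ> T\<close> and has the same integral.
The function \<open>\<psi>\<close> is arbitrary because this will be applied to the norm of a derivative form, an
uncountable supremum whose measurability is nowhere established.\<close>
lemma nn_integral_distr_le:
  assumes "T \<in> M \<rightarrow>\<^sub>M N" "distr M N T = N"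
  shows "(\<integral>\<^sup>+x. \<psi> x \<partial>N) \<le> (\<integral>\<^sup>+x. \<psi> (T x) \<partial>M)"
  unfolding nn_integral_def[of N \<psi>]
proof (rule SUP_least, clarsimp)
  fix g assume g: "simple_function N g" "g \<le> \<psi>"
  have "integral\<^sup>S N g = (\<integral>\<^sup>+x. g x \<partial>distr M N T)"
    unfolding assms(2) using g by (simp add: nn_integral_eq_simple_integral)
  also have "\<dots> = (\<integral>\<^sup>+x. g (T x) \<partial>M)"
    using borel_measurable_simple_function[OF g(1)] assms(1) by (subst nn_integral_distr) simp_all
  also have "\<dots> \<le> (\<integral>\<^sup>+x. \<psi> (T x) \<partial>M)"
    using g by (intro nn_integral_mono) (auto simp: le_fun_def)
  finally show "integral\<^sup>S N g \<le> (\<integral>\<^sup>+x. \<psi> (T x) \<partial>M)" .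
qed

lemma nn_integral_lebesgue_unimodular:
  fixes A :: "real^'n^'n"
  assumes "\<bar>det A\<bar> = 1"
  shows "(\<integral>\<^sup>+x. \<psi> (A *v x + b) \<partial>lebesgue) = (\<integral>\<^sup>+x. \<psi> x \<partial>lebesgue)"
proof (rule antisym)
  have "det A \<noteq> 0" using assms by auto
  then obtain B where B: "A ** B = mat 1" "B ** A = mat 1"
    unfolding invertible_det_nz[symmetric] invertible_def by blast
  then have "det A * det B = 1" by (metis det_I det_mul)
  then have dB: "\<bar>det B\<bar> = 1" using assms by (metis abs_mult abs_one mult_1)
  have "(\<integral>\<^sup>+x. \<psi> (A *v x + b) \<partial>lebesgue) \<le> (\<integral>\<^sup>+x. \<psi> (A *v (B *v x + - (B *v b)) + b) \<partial>lebesgue)"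
    by (rule nn_integral_distr_le[OF measurable_lebesgue_unimodular[OF dB] distr_lebesgue_unimodular[OF dB]])
  moreover have "A *v (B *v x + - (B *v b)) + b = x" for x
    using B by (simp add: matrix_vector_mult_diff_distrib matrix_vector_mul_assoc)
  ultimately show "(\<integral>\<^sup>+x. \<psi> (A *v x + b) \<partial>lebesgue) \<le> (\<integral>\<^sup>+x. \<psi> x \<partial>lebesgue)" by (simp only:)
qed (rule nn_integral_distr_le[OF measurable_lebesgue_unimodular[OF assms] distr_lebesgue_unimodular[OF assms]])

lemma AE_lebesgue_unimodular:
  fixes A :: "real^'n^'n"
  assumes "\<bar>det A\<bar> = 1" "AE x in lebesgue. P x"
  shows "AE x in lebesgue. P (A *v x + b)"
  using AE_distrD[OF measurable_lebesgue_unimodular[OF assms(1), of b], of P] assms(2)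
  unfolding distr_lebesgue_unimodular[OF assms(1)] by blast

lemma integral_lebesgue_unimodular:
  fixes A :: "real^'n^'n" and f :: "real^'n \<Rightarrow> real"
  assumes "\<bar>det A\<bar> = 1" "f \<in> borel_measurable lebesgue"
  shows "(LINT x|lebesgue. f (A *v x + b)) = (LINT x|lebesgue. f x)"
  using integral_distr[OF measurable_lebesgue_unimodular[OF assms(1)] assms(2), of b]
  unfolding distr_lebesgue_unimodular[OF assms(1)] by simp

text \<open>Again the integrand is arbitrary; the constant is moved to the simple functions below it.\<close>
lemma nn_integral_cmult_le:
  assumes "c > 0"
  shows "(\<integral>\<^sup>+x. ennreal c * \<psi> x \<partial>M) \<le> ennreal c * (\<integral>\<^sup>+x. \<psi> x \<partial>M)"
  unfolding nn_integral_def[of M "\<lambda>x. ennreal c * \<psi> x"]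
proof (rule SUP_least, clarsimp)
  fix g assume g: "simple_function M g" "g \<le> (\<lambda>x. ennreal c * \<psi> x)"
  have cc: "ennreal c * ennreal (1/c) = 1"
    using assms by (simp add: ennreal_mult[symmetric])
  have "g x = ennreal c * (ennreal (1/c) * g x)" for x
    using cc by (simp add: mult.assoc[symmetric])
  then have "integral\<^sup>S M g = (\<integral>\<^sup>+x. ennreal c * (ennreal (1/c) * g x) \<partial>M)"
    using g by (simp add: nn_integral_eq_simple_integral)
  also have "\<dots> = ennreal c * (\<integral>\<^sup>+x. ennreal (1/c) * g x \<partial>M)"
    using g by (intro nn_integral_cmult) (auto dest: borel_measurable_simple_function)
  also have "\<dots> \<le> ennreal c * (\<integral>\<^sup>+x. \<psi> x \<partial>M)"
  proof (intro mult_left_mono nn_integral_mono)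
    fix x
    have "ennreal (1/c) * g x \<le> ennreal (1/c) * (ennreal c * \<psi> x)"
      using g by (intro mult_left_mono) (auto simp: le_fun_def)
    then show "ennreal (1/c) * g x \<le> \<psi> x"
      using cc by (simp add: mult.assoc[symmetric] mult.commute)
  qed simp
  finally show "integral\<^sup>S M g \<le> ennreal c * (\<integral>\<^sup>+x. \<psi> x \<partial>M)" .
qed

section \<open>Smooth cutoffs and the fundamental lemma of the calculus of variations\<close>

definition smooth :: "(real^'n \<Rightarrow> real) \<Rightarrow> bool" where
  "smooth \<phi> \<longleftrightarrow> (\<forall>I x. partial_derivs I \<phi> differentiable (at x))"

lemma test_functions_iff: "\<phi> \<in> test_functions \<longleftrightarrow> smooth \<phi> \<and> bounded {x. \<phi> x \<noteq> 0}"
  by (simp add: test_functions_def smooth_def)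

text \<open>Smoothness is the greatest property that implies differentiability and is inherited by partial
derivatives, so it suffices to exhibit one class of functions with these two closure properties.\<close>
lemma smooth_coinduct:
  assumes "\<phi> \<in> S"
    and "\<And>\<psi> i. \<psi> \<in> S \<Longrightarrow> partial_deriv i \<psi> \<in> S"
    and "\<And>\<psi> x. \<psi> \<in> S \<Longrightarrow> \<psi> differentiable (at x)"
  shows "smooth \<phi>"
proof -
  have "partial_derivs I \<phi> \<in> S" for I
    by (induction I) (auto intro: assms)
  then show ?thesis
    unfolding smooth_def using assms(3) by blast
qed

lemma partial_deriv_eqI:
  "(\<psi> has_derivative D) (at x) \<Longrightarrow> partial_deriv i \<psi> x = D (axis i 1)"
  unfolding partial_deriv_def using frechet_derivative_at by metis

lemma frechet_derivative_partial:
  fixes \<psi> :: "real^'n \<Rightarrow> real"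
  assumes "\<psi> differentiable (at y)"
  shows "frechet_derivative \<psi> (at y) v = (\<Sum>l\<in>UNIV. v $ l * partial_deriv l \<psi> y)"
proof -
  have lin: "linear (frechet_derivative \<psi> (at y))"
    using assms frechet_derivative_works has_derivative_linear by blast
  have "v = (\<Sum>l\<in>UNIV. (v $ l) *\<^sub>R axis l 1)"
    using basis_expansion[of v] by (simp add: scalar_mult_eq_scaleR)
  then have "frechet_derivative \<psi> (at y) v = frechet_derivative \<psi> (at y) (\<Sum>l\<in>UNIV. (v $ l) *\<^sub>R axis l 1)"
    by simp
  also have "\<dots> = (\<Sum>l\<in>UNIV. v $ l * partial_deriv l \<psi> y)"
    by (simp add: linear_sum[OF lin] linear_scale[OF lin] partial_deriv_def)
  finally show ?thesis .
qed

text \<open>For \<open>P = 1\<close> this is the classical smooth function that vanishes to infinite order at \<open>0\<close>; the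
polynomial makes the family closed under differentiation.\<close>
definition flat :: "real poly \<Rightarrow> real \<Rightarrow> real" where
  "flat P u = (if u > 0 then poly P (1 / u) * exp (- (1 / u)) else 0)"

lemma tendsto_poly_times_exp_minus:
  "((\<lambda>y::real. poly P y * exp (- y)) \<longlongrightarrow> 0) at_top"
proof -
  have "((\<lambda>y::real. \<Sum>i\<le>degree P. coeff P i * (y ^ i / exp y)) \<longlongrightarrow> (\<Sum>i\<le>degree P. coeff P i * 0)) at_top"
    by (intro tendsto_sum tendsto_mult tendsto_const tendsto_power_div_exp_0)
  moreover have "(\<Sum>i\<le>degree P. coeff P i * (y ^ i / exp y)) = poly P y * exp (- y)" for y :: real
    by (simp add: poly_altdef sum_distrib_right exp_minus divide_inverse mult.assoc)
  ultimately show ?thesis by simp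
qed

text \<open>Away from \<open>0\<close> this is calculus.  At \<open>0\<close> the difference quotient from the right is
\<open>y P(y) exp (- y)\<close> with \<open>y = 1/u\<close> tending to infinity.\<close>
lemma DERIV_flat:
  "(flat P has_real_derivative flat ([:0, 0, 1:] * (P - pderiv P)) u) (at u)"
proof -
  consider "u > 0" | "u < 0" | "u = 0" by linarith
  then show ?thesis
  proof cases
    case 1
    have "((\<lambda>u. poly P (1 / u) * exp (- (1 / u))) has_real_derivative
        flat ([:0, 0, 1:] * (P - pderiv P)) u) (at u)"
      using 1 by (auto intro!: derivative_eq_intros poly_DERIV[THEN DERIV_chain2] simp: flat_def field_simps power2_eq_square)
    then show ?thesis
      by (rule has_field_derivative_transform_within_open[of _ _ _ "{0<..}"]) (use 1 in \<open>auto simp: flat_def\<close>)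
  next
    case 2
    have "((\<lambda>u. 0) has_real_derivative flat ([:0, 0, 1:] * (P - pderiv P)) u) (at u)"
      using 2 by (simp add: flat_def)
    then show ?thesis
      by (rule has_field_derivative_transform_within_open[of _ _ _ "{..<0}"]) (use 2 in \<open>auto simp: flat_def\<close>)
  next
    case 3
    have "((\<lambda>h. poly (pCons 0 P) (inverse h) * exp (- inverse h)) \<longlongrightarrow> 0) (at_right 0)"
      by (rule filterlim_compose[OF tendsto_poly_times_exp_minus filterlim_inverse_at_top_right])
    then have "((\<lambda>h. (flat P (0 + h) - flat P 0) / h) \<longlongrightarrow> 0) (at_right 0)"
      by (rule Lim_transform_eventually)
        (auto simp: eventually_at_right_field flat_def divide_inverse mult_ac intro!: exI[of _ 1])
    moreover have "((\<lambda>h. (flat P (0 + h) - flat P 0) / h) \<longlongrightarrow> 0) (at_left 0)"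
      by (rule Lim_transform_eventually[OF tendsto_const])
        (auto simp: eventually_at_left_field flat_def intro!: exI[of _ "-1"])
    ultimately have "((\<lambda>h. (flat P (0 + h) - flat P 0) / h) \<longlongrightarrow> 0) (at 0)"
      by (rule filterlim_split_at[rotated])
    then show ?thesis
      using 3 by (simp add: DERIV_def flat_def)
  qed
qed

text \<open>A class to which smooth_coinduct applies and which contains products over the coordinates of
one-dimensional cutoffs.\<close>
inductive_set bump_algebra :: "(real^'n \<Rightarrow> real) set" where
  const: "(\<lambda>_. c) \<in> bump_algebra"
| flat: "(\<lambda>x. flat P (c * x $ i + d)) \<in> bump_algebra"
| add: "f \<in> bump_algebra \<Longrightarrow> g \<in> bump_algebra \<Longrightarrow> (\<lambda>x. f x + g x) \<in> bump_algebra"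
| mult: "f \<in> bump_algebra \<Longrightarrow> g \<in> bump_algebra \<Longrightarrow> (\<lambda>x. f x * g x) \<in> bump_algebra"

lemma bump_algebra_prod:
  "finite A \<Longrightarrow> (\<And>i. i \<in> A \<Longrightarrow> f i \<in> bump_algebra) \<Longrightarrow> (\<lambda>x. \<Prod>i\<in>A. f i x) \<in> bump_algebra"
  by (induction A rule: finite_induct) (auto intro: bump_algebra.intros)

lemma has_derivative_flat_coordinate:
  "((\<lambda>x::real^'n. flat P (c * x $ i + d)) has_derivative
    (\<lambda>h. flat ([:0, 0, 1:] * (P - pderiv P)) (c * x $ i + d) * (c * h $ i))) (at x)"
proof -
  have "((\<lambda>x::real^'n. c * x $ i + d) has_derivative (\<lambda>h. c * h $ i)) (at x)"
    by (auto intro!: derivative_eq_intros bounded_linear.has_derivative[OF bounded_linear_vec_nth])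
  from diff_chain_at[OF this DERIV_flat[unfolded has_field_derivative_def]]
  show ?thesis by (simp add: o_def)
qed

lemma bump_algebra_differentiable:
  "f \<in> bump_algebra \<Longrightarrow> f differentiable (at x)"
proof (induction rule: bump_algebra.induct)
  case (flat P c i d)
  then show ?case using has_derivative_flat_coordinate unfolding differentiable_def by blast
qed (auto intro: derivative_intros)

lemma bump_algebra_partial_deriv:
  "f \<in> bump_algebra \<Longrightarrow> partial_deriv j f \<in> bump_algebra"
proof (induction rule: bump_algebra.induct)
  case (const c)
  have "partial_deriv j (\<lambda>_. c) = (\<lambda>_. 0)"
    by (rule ext, subst partial_deriv_eqI[OF has_derivative_const]) simp
  then show ?case using bump_algebra.const[of 0] by simp
next
  case (flat P c i d)
  have "partial_deriv j (\<lambda>x. flat P (c * x $ i + d)) =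
    (\<lambda>x. flat ([:0, 0, 1:] * (P - pderiv P)) (c * x $ i + d) * (if i = j then c else 0))"
    by (rule ext, subst partial_deriv_eqI[OF has_derivative_flat_coordinate]) (simp add: axis_def)
  then show ?case
    by (simp only:) (intro bump_algebra.intros)
next
  case (add f g)
  have "partial_deriv j (\<lambda>x. f x + g x) = (\<lambda>x. partial_deriv j f x + partial_deriv j g x)"
  proof
    fix x
    have "((\<lambda>x. f x + g x) has_derivative (\<lambda>h. frechet_derivative f (at x) h + frechet_derivative g (at x) h)) (at x)"
      using add.hyps by (intro has_derivative_add) (auto simp: frechet_derivative_works[symmetric] bump_algebra_differentiable)
    from partial_deriv_eqI[OF this, of j]
    show "partial_deriv j (\<lambda>x. f x + g x) x = partial_deriv j f x + partial_deriv j g x"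
      by (simp add: partial_deriv_def)
  qed
  then show ?case using add by (auto intro: bump_algebra.intros)
next
  case (mult f g)
  have "partial_deriv j (\<lambda>x. f x * g x) = (\<lambda>x. f x * partial_deriv j g x + partial_deriv j f x * g x)"
  proof
    fix x
    have "((\<lambda>x. f x * g x) has_derivative (\<lambda>h. f x * frechet_derivative g (at x) h + frechet_derivative f (at x) h * g x)) (at x)"
      using mult.hyps by (intro has_derivative_mult) (auto simp: frechet_derivative_works[symmetric] bump_algebra_differentiable)
    from partial_deriv_eqI[OF this, of j]
    show "partial_deriv j (\<lambda>x. f x * g x) x = f x * partial_deriv j g x + partial_deriv j f x * g x"
      by (simp add: partial_deriv_def)
  qed
  then show ?case using mult by (auto intro: bump_algebra.intros)
qed

lemma smooth_bump_algebra: "f \<in> bump_algebra \<Longrightarrow> smooth f"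
  by (rule smooth_coinduct[of f bump_algebra]) (auto intro: bump_algebra_partial_deriv bump_algebra_differentiable)

text \<open>Since \<open>exp (- 1 / (k t))\<close> tends to \<open>1\<close> for \<open>t > 0\<close> and vanishes by definition for \<open>t \<le> 0\<close>, these test
functions tend to the indicator of the open box, without any normalisation.\<close>
definition box_cutoff :: "real^'n \<Rightarrow> real^'n \<Rightarrow> nat \<Rightarrow> real^'n \<Rightarrow> real" where
  "box_cutoff a b k x = (\<Prod>i\<in>UNIV. flat 1 (real k * (x $ i - a $ i)) * flat 1 (real k * (b $ i - x $ i)))"

lemma box_cutoff_test: "box_cutoff (a::real^'n) b k \<in> test_functions"
proof -
  have "(\<lambda>x::real^'n. flat 1 (real k * (x $ i - a $ i)) * flat 1 (real k * (b $ i - x $ i))) \<in> bump_algebra" for i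
    using bump_algebra.mult[OF bump_algebra.flat[of 1 "real k" i "- (real k * a $ i)"]
        bump_algebra.flat[of 1 "- real k" i "real k * b $ i"]]
    by (simp add: algebra_simps)
  then have "box_cutoff a b k \<in> bump_algebra"
    unfolding box_cutoff_def[abs_def] by (intro bump_algebra_prod) auto
  moreover have "{x. box_cutoff a b k x \<noteq> 0} \<subseteq> box a b"
    by (auto simp: box_cutoff_def mem_box_cart flat_def zero_less_mult_iff split: if_splits)
  ultimately show ?thesis
    by (auto simp: test_functions_iff intro: smooth_bump_algebra bounded_subset[OF bounded_box])
qed

lemma box_cutoff_bounds:
  "0 \<le> box_cutoff a b k x" "box_cutoff a b k x \<le> indicator (cbox a b) x"
proof -
  have 1: "0 \<le> flat 1 u" "flat 1 u \<le> 1" "flat 1 u = 0 \<longleftrightarrow> u \<le> 0" for u by (auto simp: flat_def)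
  show "0 \<le> box_cutoff a b k x"
    unfolding box_cutoff_def by (intro prod_nonneg) (simp add: 1)
  show "box_cutoff a b k x \<le> indicator (cbox a b) x"
  proof (cases "x \<in> cbox a b")
    case True
    then show ?thesis
      unfolding box_cutoff_def by (auto intro!: prod_le_1 mult_nonneg_nonneg mult_le_one simp: 1)
  next
    case False
    then have "box_cutoff a b k x = 0"
      unfolding box_cutoff_def by (auto simp: mem_box_cart 1 mult_le_0_iff not_le intro: less_imp_le)
    then show ?thesis by simp
  qed
qed

lemma box_cutoff_tendsto:
  "(\<lambda>k. box_cutoff a b k x) \<longlonglongrightarrow> indicator (box a b) x"
proof -
  have f: "(\<lambda>k. flat 1 (real k * t)) \<longlonglongrightarrow> (if t > 0 then 1 else 0)" for t
  proof (cases "t > 0")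
    case True
    have "(\<lambda>k. exp (- (inverse (real k) * (1/t)))) \<longlonglongrightarrow> exp (- (0 * (1/t)))"
      by (intro tendsto_intros LIMSEQ_inverse_real_of_nat[THEN LIMSEQ_imp_Suc] lim_inverse_n)
    moreover have "\<forall>\<^sub>F k in sequentially. exp (- (inverse (real k) * (1/t))) = flat 1 (real k * t)"
      using eventually_gt_at_top[of 0] by eventually_elim (use True in \<open>auto simp: flat_def field_simps\<close>)
    ultimately show ?thesis using True by (auto dest: Lim_transform_eventually)
  next
    case False
    then have "flat 1 (real k * t) = 0" for k by (auto simp: flat_def zero_less_mult_iff)
    then show ?thesis using False by simp
  qed
  have "(\<lambda>k. box_cutoff a b k x) \<longlonglongrightarrow>
      (\<Prod>i\<in>UNIV. (if x $ i - a $ i > 0 then 1 else 0) * (if b $ i - x $ i > 0 then 1 else 0))"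
    unfolding box_cutoff_def by (intro tendsto_prod tendsto_mult f)
  also have "(\<Prod>i\<in>UNIV. (if x $ i - a $ i > 0 then 1 else 0) * (if b $ i - x $ i > 0 then 1 else 0)) = (indicator (box a b) x :: real)"
    by (auto simp: indicator_def mem_box_cart intro!: prod.neutral)
  finally show ?thesis .
qed

text \<open>By dominated convergence along the cutoffs, the integral of \<open>g\<close> over every box vanishes.  So the
positive and the negative part of \<open>g\<close> are densities of two measures that agree on boxes, hence
everywhere, and the two parts agree almost everywhere.\<close>
lemma AE_zero_if_orthogonal_to_test_functions:
  fixes g :: "real^'n \<Rightarrow> real"
  assumes [measurable]: "g \<in> borel_measurable borel"
    and int: "\<And>a b. integrable lborel (\<lambda>x. indicator (cbox a b) x * g x)"
    and orth: "\<And>\<phi>. \<phi> \<in> test_functions \<Longrightarrow> (LINT x|lborel. g x * \<phi> x) = 0"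
  shows "AE x in lborel. g x = 0"
proof -
  have [measurable]: "box_cutoff a b k \<in> borel_measurable borel" for a b :: "real^'n" and k
    using box_cutoff_test[of a b k] unfolding test_functions_iff smooth_def
    by (intro borel_measurable_continuous_onI differentiable_imp_continuous_on)
      (auto simp: differentiable_on_def dest!: spec[of _ "[]"] intro: differentiable_at_withinI)
  have int': "integrable lborel (\<lambda>x. indicator (box a b) x * g x)" for a b
    using int[of a b] by (rule Bochner_Integration.integrable_bound) (use box_subset_cbox in \<open>auto simp: indicator_def\<close>)
  have zero: "(LINT x|lborel. indicator (box a b) x * g x) = 0" for a b
  proof -
    have "(\<lambda>k. LINT x|lborel. box_cutoff a b k x * g x) \<longlonglongrightarrow> (LINT x|lborel. indicator (box a b) x * g x)"
    proof (rule integral_dominated_convergence[where w="\<lambda>x. norm (indicator (cbox a b) x * g x)"])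
      show "integrable lborel (\<lambda>x. norm (indicator (cbox a b) x * g x))"
        using int by (rule integrable_norm)
      show "AE x in lborel. (\<lambda>k. box_cutoff a b k x * g x) \<longlonglongrightarrow> indicator (box a b) x * g x"
        by (intro AE_I2 tendsto_mult box_cutoff_tendsto tendsto_const)
      show "AE x in lborel. norm (box_cutoff a b k x * g x) \<le> norm (indicator (cbox a b) x * g x)" for k
        using box_cutoff_bounds[of a b k] by (intro AE_I2) (auto simp: abs_mult intro!: mult_right_mono)
    qed measurable
    moreover have "(LINT x|lborel. box_cutoff a b k x * g x) = 0" for k
      using orth[OF box_cutoff_test[of a b k]] by (simp add: mult.commute)
    ultimately show ?thesis using LIMSEQ_unique[OF tendsto_const] by force
  qed
  have "density lborel (\<lambda>x. ennreal (g x)) = density lborel (\<lambda>x. ennreal (- g x))" (is "?M = ?N")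
  proof (rule measure_eqI_generator_eq)
    let ?E = "range (\<lambda>(a, b). box a b::(real^'n) set)"
    show "Int_stable ?E"
      by (auto simp: Int_stable_def box_Int_box)
    show "?E \<subseteq> Pow UNIV" "sets ?M = sigma_sets UNIV ?E" "sets ?N = sigma_sets UNIV ?E"
      by (simp_all add: borel_eq_box)
    let ?A = "\<lambda>n::nat. box (- (real n *\<^sub>R One)) (real n *\<^sub>R One) :: (real^'n) set"
    show "range ?A \<subseteq> ?E" "(\<Union>i. ?A i) = UNIV"
      unfolding UN_box_eq_UNIV by auto
    have em: "emeasure (density lborel (\<lambda>x. ennreal (f x))) (box a b) = (\<integral>\<^sup>+x. ennreal (indicator (box a b) x * f x) \<partial>lborel)"
      if "f \<in> borel_measurable borel" for f :: "real^'n \<Rightarrow> real" and a b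
      using that by (subst emeasure_density) (auto intro!: nn_integral_cong simp: indicator_def)
    show "emeasure ?M (?A i) \<noteq> \<infinity>" for i
      using int'[of "- (real i *\<^sub>R One)" "real i *\<^sub>R One"] by (simp add: em real_integrable_def)
    show "emeasure ?M X = emeasure ?N X" if "X \<in> ?E" for X
    proof -
      from that obtain a b where X: "X = box a b" by auto
      have "(LINT x|lborel. indicator (box a b) x * g x) = enn2real (emeasure ?M X) - enn2real (emeasure ?N X)"
        using real_lebesgue_integral_def[OF int'[of a b]] by (simp add: em X)
      then have "enn2real (emeasure ?M X) = enn2real (emeasure ?N X)" using zero by simp
      moreover have "emeasure ?M X \<noteq> \<infinity>" "emeasure ?N X \<noteq> \<infinity>"
        using int'[of a b] by (simp_all add: em X real_integrable_def)
      ultimately show ?thesis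
        by (metis ennreal_enn2real_if infinity_ennreal_def)
    qed
  qed
  then have "AE x in lborel. ennreal (g x) = ennreal (- g x)"
    by (rule sigma_finite_measure.density_unique[OF sigma_finite_lborel, rotated 2]) measurable
  then show ?thesis
  proof eventually_elim
    case (elim x)
    then show ?case by (cases "g x \<ge> 0") (auto simp: ennreal_neg ennreal_eq_0_iff dest: sym)
  qed
qed

section \<open>Test functions and locally integrable functions\<close>

lemma partial_derivs_append: "partial_derivs (I @ J) \<phi> = partial_derivs I (partial_derivs J \<phi>)"
  by (induction I) auto

lemma test_functions_partial_deriv:
  assumes "\<phi> \<in> test_functions"
  shows "partial_deriv i \<phi> \<in> test_functions"
proof -
  have "smooth (partial_deriv i \<phi>)"
    unfolding smooth_def
  proof (intro allI)
    fix I x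
    show "partial_derivs I (partial_deriv i \<phi>) differentiable (at x)"
      using assms partial_derivs_append[of I "[i]" \<phi>] unfolding test_functions_iff smooth_def
      by (metis partial_derivs.simps)
  qed
  moreover have "{x. partial_deriv i \<phi> x \<noteq> 0} \<subseteq> closure {x. \<phi> x \<noteq> 0}"
  proof (rule subsetI, rule ccontr)
    fix x assume x: "x \<in> {x. partial_deriv i \<phi> x \<noteq> 0}" "x \<notin> closure {x. \<phi> x \<noteq> 0}"
    have "(\<phi> has_derivative (\<lambda>_. 0)) (at x)"
      by (rule has_derivative_transform_within_open[of "\<lambda>_. 0" _ _ _ "- closure {x. \<phi> x \<noteq> 0}"])
        (use x(2) closure_subset[of "{x. \<phi> x \<noteq> 0}"] in auto)
    from partial_deriv_eqI[OF this] x(1) show False by simp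
  qed
  ultimately show ?thesis
    using assms unfolding test_functions_iff by (meson bounded_closure bounded_subset)
qed

lemma test_functions_partial_derivs:
  "\<phi> \<in> test_functions \<Longrightarrow> partial_derivs I \<phi> \<in> test_functions"
  by (induction I) (auto intro: test_functions_partial_deriv)

lemma test_function_differentiable: "\<phi> \<in> test_functions \<Longrightarrow> \<phi> differentiable (at x)"
  unfolding test_functions_iff smooth_def by (metis partial_derivs.simps(1))

lemma test_function_continuous: "\<phi> \<in> test_functions \<Longrightarrow> continuous_on S \<phi>"
  by (intro differentiable_imp_continuous_on differentiable_at_imp_differentiable_on test_function_differentiable)

lemma test_function_borel: "\<phi> \<in> test_functions \<Longrightarrow> \<phi> \<in> borel_measurable borel"
  by (intro borel_measurable_continuous_onI test_function_continuous)

lemma test_function_bounded: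
  assumes "\<phi> \<in> test_functions"
  obtains r M where "r > 0" "\<And>x. \<bar>\<phi> x\<bar> \<le> M * indicator (cball 0 r) x"
proof -
  obtain r where r: "r > 0" "{x. \<phi> x \<noteq> 0} \<subseteq> cball 0 r"
  proof -
    obtain a where a: "\<And>x. \<phi> x \<noteq> 0 \<Longrightarrow> norm x \<le> a"
      using assms unfolding test_functions_iff bounded_iff by blast
    have "{x. \<phi> x \<noteq> 0} \<subseteq> cball 0 (max 1 a)"
      using a by (auto simp: le_max_iff_disj)
    then show ?thesis by (intro that[of "max 1 a"]) auto
  qed
  have "compact (\<phi> ` cball 0 r)"
    using assms by (intro compact_continuous_image test_function_continuous) auto
  then obtain M where "\<And>y. y \<in> \<phi> ` cball 0 r \<Longrightarrow> norm y \<le> M"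
    using compact_imp_bounded bounded_iff by metis
  then have "\<bar>\<phi> x\<bar> \<le> M * indicator (cball 0 r) x" for x
    using r(2) by (cases "x \<in> cball 0 r") auto
  with r that show ?thesis by blast
qed

lemma L1_loc_measurable: "f \<in> L1_loc \<Longrightarrow> f \<in> borel_measurable lebesgue"
  by (simp add: L1_loc_def)

lemma L1_loc_integrable:
  "f \<in> L1_loc \<Longrightarrow> compact C \<Longrightarrow> integrable lebesgue (\<lambda>x. indicator C x * f x)"
  unfolding L1_loc_def by (auto simp: set_integrable_def)

lemma L1_locI:
  assumes "f \<in> borel_measurable lebesgue" "\<And>C. compact C \<Longrightarrow> integrable lebesgue (\<lambda>x. indicator C x * f x)"
  shows "f \<in> L1_loc"
  using assms unfolding L1_loc_def by (auto simp: set_integrable_def)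

text \<open>The product is dominated by a multiple of \<open>f\<close> on a ball that contains the support of \<open>\<phi>\<close>.\<close>
lemma integrable_L1_loc_test:
  assumes f: "f \<in> L1_loc" and \<phi>: "\<phi> \<in> test_functions"
  shows "integrable lebesgue (\<lambda>x. f x * \<phi> x)"
proof -
  obtain r M where M: "r > 0" "\<And>x. \<bar>\<phi> x\<bar> \<le> M * indicator (cball 0 r) x"
    using test_function_bounded[OF \<phi>] by blast
  have "integrable lebesgue (\<lambda>x. M * (indicator (cball 0 r) x * f x))"
    by (intro integrable_mult_right L1_loc_integrable[OF f] compact_cball)
  then show ?thesis
  proof (rule Bochner_Integration.integrable_bound)
    show "(\<lambda>x. f x * \<phi> x) \<in> borel_measurable lebesgue"
      by (intro borel_measurable_times L1_loc_measurable[OF f] measurable_completion)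
        (simp add: test_function_borel[OF \<phi>])
    have "\<bar>f x\<bar> * \<bar>\<phi> x\<bar> \<le> \<bar>M\<bar> * (indicator (cball 0 r) x * \<bar>f x\<bar>)" for x
    proof -
      have "\<bar>\<phi> x\<bar> \<le> \<bar>M\<bar> * indicator (cball 0 r) x"
        using M(2)[of x] by (rule order_trans) (simp add: mult_right_mono)
      from mult_left_mono[OF this, of "\<bar>f x\<bar>"] show ?thesis by (simp add: mult_ac)
    qed
    then show "AE x in lebesgue. norm (f x * \<phi> x) \<le> norm (M * (indicator (cball 0 r) x * f x))"
      by (simp add: abs_mult)
  qed
qed

lemma L1_loc_unimodular:
  fixes A :: "real^'n^'n"
  assumes f: "f \<in> L1_loc" and A: "\<bar>det A\<bar> = 1"
  shows "(\<lambda>x. f (A *v x + b)) \<in> L1_loc"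
proof (rule L1_locI)
  show "(\<lambda>x. f (A *v x + b)) \<in> borel_measurable lebesgue"
    using measurable_compose[OF measurable_lebesgue_unimodular[OF A, of b] L1_loc_measurable[OF f]] .
  fix C :: "(real^'n) set" assume C: "compact C"
  let ?C = "(\<lambda>x. A *v x + b) ` C"
  have inj: "inj (\<lambda>x. A *v x + b)"
  proof -
    have "det A \<noteq> 0" using A by auto
    then have "inj ((*v) A)" by (simp add: inj_matrix_vector_mult invertible_det_nz)
    then show ?thesis by (auto simp: inj_def)
  qed
  have "compact ?C"
    by (intro compact_continuous_image continuous_intros C linear_continuous_on matrix_vector_mul_bounded_linear)
  then have "integrable lebesgue (\<lambda>x. indicator ?C x * f x)" by (rule L1_loc_integrable[OF f])
  then have "integrable (distr lebesgue lebesgue (\<lambda>x. A *v x + b)) (\<lambda>x. indicator ?C x * f x)"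
    by (simp only: distr_lebesgue_unimodular[OF A])
  then have "integrable lebesgue (\<lambda>x. indicator ?C (A *v x + b) * f (A *v x + b))"
    by (rule integrable_distr[OF measurable_lebesgue_unimodular[OF A]])
  moreover have "indicator ?C (A *v x + b) = (indicator C x :: real)" for x
    using inj by (auto simp: indicator_def dest: injD)
  ultimately show "integrable lebesgue (\<lambda>x. indicator C x * f (A *v x + b))"
    by (simp only:)
qed

lemma L1_loc_cmult:
  assumes "(f::real^'n \<Rightarrow> real) \<in> L1_loc" shows "(\<lambda>x. c * f x) \<in> L1_loc"
proof (rule L1_locI)
  show "(\<lambda>x. c * f x) \<in> borel_measurable lebesgue"
    using L1_loc_measurable[OF assms] by simp
  fix C :: "(real^'n) set" assume "compact C"
  then have "integrable lebesgue (\<lambda>x. c * (indicator C x * f x))"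
    by (intro integrable_mult_right L1_loc_integrable[OF assms])
  then show "integrable lebesgue (\<lambda>x. indicator C x * (c * f x))"
    by (simp add: mult.left_commute)
qed

lemma L1_loc_sum:
  fixes f :: "'i \<Rightarrow> real^'n \<Rightarrow> real"
  assumes "finite S" "\<And>i. i \<in> S \<Longrightarrow> f i \<in> L1_loc"
  shows "(\<lambda>x. \<Sum>i\<in>S. f i x) \<in> L1_loc"
proof (rule L1_locI)
  show "(\<lambda>x. \<Sum>i\<in>S. f i x) \<in> borel_measurable lebesgue"
    using assms by (intro borel_measurable_sum L1_loc_measurable)
  fix C :: "(real^'n) set" assume "compact C"
  then have "integrable lebesgue (\<lambda>x. \<Sum>i\<in>S. indicator C x * f i x)"
    using assms by (intro Bochner_Integration.integrable_sum L1_loc_integrable)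
  then show "integrable lebesgue (\<lambda>x. indicator C x * (\<Sum>i\<in>S. f i x))"
    by (simp only: sum_distrib_left)
qed

lemma L1_loc_diff:
  assumes "f \<in> L1_loc" "g \<in> L1_loc" shows "(\<lambda>x. f x - g x) \<in> L1_loc"
  using assms[THEN L1_loc_integrable] assms[THEN L1_loc_measurable]
  by (intro L1_locI) (auto simp: right_diff_distrib)

text \<open>The Lebesgue measure on a product is not the product of the Lebesgue measures.  Fubini's theorem is
therefore applied to Borel functions, which replace the Lebesgue measurable ones here.\<close>
lemma L1_loc_borel_representative:
  fixes f :: "real^'n \<Rightarrow> real"
  assumes "f \<in> L1_loc"
  obtains f' where "f' \<in> borel_measurable borel" "AE x in lebesgue. f x = f' x"
    "f' \<in> L1_loc" "\<And>C. compact C \<Longrightarrow> integrable lborel (\<lambda>x. indicator C x * f' x)"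
proof -
  obtain f' where f': "f' \<in> borel_measurable lborel" "AE x in lborel. f x = f' x"
    using completion_ex_borel_measurable_real[OF L1_loc_measurable[OF assms]] by blast
  then have ae: "AE x in lebesgue. f x = f' x" by (intro AE_completion)
  have m: "f' \<in> borel_measurable lebesgue" using f' by (intro measurable_completion) simp
  have int: "integrable lebesgue (\<lambda>x. indicator C x * f' x)" if "compact C" for C
  proof (rule integrable_cong_AE[THEN iffD1, OF _ _ _ L1_loc_integrable[OF assms that]])
    show "AE x in lebesgue. indicator C x * f x = indicator C x * f' x" using ae by auto
    have "C \<in> sets lebesgue" using that by (simp add: compact_imp_closed)
    then show "(\<lambda>x. indicator C x * f x) \<in> borel_measurable lebesgue" "(\<lambda>x. indicator C x * f' x) \<in> borel_measurable lebesgue"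
      using L1_loc_measurable[OF assms] m by auto
  qed
  have "integrable lborel (\<lambda>x. indicator C x * f' x)" if "compact C" for C
    using int[OF that] f' that by (subst (asm) integrable_completion) (auto intro!: borel_measurable_times borel_measurable_indicator borel_compact)
  moreover have "f' \<in> L1_loc" using m int by (intro L1_locI)
  ultimately show ?thesis using f' ae by (intro that[of f']) auto
qed

lemma L1_loc_unique:
  fixes g1 g2 :: "real^'n \<Rightarrow> real"
  assumes g: "g1 \<in> L1_loc" "g2 \<in> L1_loc"
    and eq: "\<And>\<phi>. \<phi> \<in> test_functions \<Longrightarrow> (LINT x|lebesgue. g1 x * \<phi> x) = (LINT x|lebesgue. g2 x * \<phi> x)"
  shows "AE x in lebesgue. g1 x = g2 x"
proof -
  obtain h where h: "h \<in> borel_measurable borel" "AE x in lebesgue. g1 x - g2 x = h x"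
    "h \<in> L1_loc" "\<And>C. compact C \<Longrightarrow> integrable lborel (\<lambda>x. indicator C x * h x)"
    using L1_loc_borel_representative[OF L1_loc_diff[OF g]] by blast
  have "(LINT x|lborel. h x * \<phi> x) = 0" if \<phi>: "\<phi> \<in> test_functions" for \<phi>
  proof -
    have "(LINT x|lborel. h x * \<phi> x) = (LINT x|lebesgue. h x * \<phi> x)"
      using h(1) test_function_borel[OF \<phi>] by (intro integral_completion[symmetric]) auto
    also have "\<dots> = (LINT x|lebesgue. g1 x * \<phi> x - g2 x * \<phi> x)"
    proof (rule integral_cong_AE)
      show "(\<lambda>x. h x * \<phi> x) \<in> borel_measurable lebesgue"
        by (rule borel_measurable_integrable[OF integrable_L1_loc_test[OF h(3) \<phi>]])
      show "(\<lambda>x. g1 x * \<phi> x - g2 x * \<phi> x) \<in> borel_measurable lebesgue"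
        using borel_measurable_integrable[OF integrable_L1_loc_test[OF L1_loc_diff[OF g] \<phi>]]
        by (simp only: left_diff_distrib)
      show "AE x in lebesgue. h x * \<phi> x = g1 x * \<phi> x - g2 x * \<phi> x"
        using h(2)
      proof eventually_elim
        case (elim x)
        then show ?case by (metis left_diff_distrib)
      qed
    qed
    also have "\<dots> = 0"
      using integrable_L1_loc_test[OF g(1) \<phi>] integrable_L1_loc_test[OF g(2) \<phi>] eq[OF \<phi>]
      by (subst Bochner_Integration.integral_diff) simp_all
    finally show ?thesis .
  qed
  then have "AE x in lborel. h x = 0"
    by (intro AE_zero_if_orthogonal_to_test_functions h(1) h(4) compact_cbox)
  then have "AE x in lebesgue. h x = 0" by (rule AE_completion)
  with h(2) show ?thesis
  proof eventually_elim
    case (elim x)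
    then show ?case by linarith
  qed
qed

lemma weak_deriv_unique:
  fixes f :: "real^'a \<Rightarrow> real"
  assumes "has_weak_deriv I f g1" "has_weak_deriv I f g2"
  shows "AE x in lebesgue. g1 x = g2 x"
proof (rule L1_loc_unique)
  show "g1 \<in> L1_loc" "g2 \<in> L1_loc" using assms by (simp_all add: has_weak_deriv_def)
  fix \<phi> :: "real^'a \<Rightarrow> real" assume "\<phi> \<in> test_functions"
  then have "(LINT x|lebesgue. f x * partial_derivs I \<phi> x) = (-1) ^ length I * (LINT x|lebesgue. g x * \<phi> x)"
    if "has_weak_deriv I f g" for g
    using that unfolding has_weak_deriv_def by blast
  from this[OF assms(1)] this[OF assms(2)]
  have "(-1) ^ length I * (LINT x|lebesgue. g1 x * \<phi> x) = (-1) ^ length I * (LINT x|lebesgue. g2 x * \<phi> x)"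
    by (rule trans[OF sym])
  then show "(LINT x|lebesgue. g1 x * \<phi> x) = (LINT x|lebesgue. g2 x * \<phi> x)" by simp
qed

lemma has_weak_deriv_weak_deriv: "has_weak_deriv I f g \<Longrightarrow> has_weak_deriv I f (weak_deriv I f)"
  unfolding weak_deriv_def by (erule someI[where P="has_weak_deriv I f"])

section \<open>The chain rule for weak derivatives\<close>

lemma finite_lists_of_length[simp]: "finite {I :: 'n::finite list. length I = k}"
  using finite_lists_length_eq[of "UNIV :: 'n set" k] by simp

lemma sum_lists_Suc:
  fixes h :: "'n::finite list \<Rightarrow> 'b::comm_monoid_add"
  shows "(\<Sum>I | length I = Suc k. h I) = (\<Sum>i\<in>UNIV. \<Sum>I | length I = k. h (i # I))"
proof -
  have "(\<Sum>i\<in>UNIV. \<Sum>I | length I = k. h (i # I)) = (\<Sum>(i, I)\<in>UNIV \<times> {I. length I = k}. h (i # I))"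
    by (simp add: sum.cartesian_product)
  also have "\<dots> = (\<Sum>I | length I = Suc k. h I)"
    by (rule sum.reindex_bij_witness[of _ "\<lambda>I. (hd I, tl I)" "\<lambda>(i, I). i # I"]) (auto simp: length_Suc_conv)
  finally show ?thesis by simp
qed

text \<open>Expanding a product of sums; the lists enumerate the choices of one summand from each factor.\<close>
lemma sum_lists_prod:
  fixes c :: "nat \<Rightarrow> 'n::finite \<Rightarrow> 'b::comm_semiring_1"
  shows "(\<Sum>I | length I = k. \<Prod>j<k. c j (I ! j)) = (\<Prod>j<k. \<Sum>i\<in>UNIV. c j i)"
proof (induction k arbitrary: c)
  case (Suc k)
  show ?case
    using Suc.IH[of "\<lambda>j. c (Suc j)"]
    by (simp add: sum_lists_Suc prod.lessThan_Suc_shift sum_distrib_left[symmetric] sum_distrib_right[symmetric] del: prod.lessThan_Suc)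
qed simp

text \<open>The coefficient of \<open>\<partial>\<^sub>J \<phi> (A x)\<close> in the iterated derivative \<open>\<partial>\<^sub>I\<close> of \<open>x \<mapsto> \<phi> (A x)\<close>.\<close>
definition deriv_coeff :: "real^'n^'n \<Rightarrow> 'n list \<Rightarrow> 'n list \<Rightarrow> real" where
  "deriv_coeff A J I = (\<Prod>j<length I. A $ (J ! j) $ (I ! j))"

lemma partial_derivs_linear:
  fixes \<phi> :: "real^'n \<Rightarrow> real"
  assumes "smooth \<phi>"
  shows "partial_derivs I (\<lambda>x. \<phi> (A *v x)) =
    (\<lambda>x. \<Sum>J | length J = length I. deriv_coeff A J I * partial_derivs J \<phi> (A *v x))"
proof (induction I)
  case Nil
  then show ?case by (simp add: deriv_coeff_def)
next
  case (Cons i I)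
  show ?case
  proof
    fix x
    have d: "((\<lambda>x. partial_derivs J \<phi> (A *v x)) has_derivative
        (\<lambda>h. frechet_derivative (partial_derivs J \<phi>) (at (A *v x)) (A *v h))) (at x)" for J
      using assms diff_chain_at[OF bounded_linear.has_derivative[OF matrix_vector_mul_bounded_linear has_derivative_ident]]
      unfolding smooth_def frechet_derivative_works o_def by blast
    have "partial_derivs (i # I) (\<lambda>x. \<phi> (A *v x)) x =
        (\<Sum>J | length J = length I. deriv_coeff A J I * frechet_derivative (partial_derivs J \<phi>) (at (A *v x)) (A *v axis i 1))"
      unfolding partial_derivs.simps Cons.IH
      by (rule partial_deriv_eqI) (intro has_derivative_sum has_derivative_mult_right d)
    also have "\<dots> = (\<Sum>J | length J = length I. deriv_coeff A J I *
        (\<Sum>l\<in>UNIV. A $ l $ i * partial_derivs (l # J) \<phi> (A *v x)))"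
      using assms unfolding smooth_def
      by (simp add: frechet_derivative_partial matrix_vector_mul_component column_def matrix_vector_mult_basis)
    also have "\<dots> = (\<Sum>l\<in>UNIV. \<Sum>J | length J = length I. deriv_coeff A (l # J) (i # I) * partial_derivs (l # J) \<phi> (A *v x))"
      by (subst sum.swap) (simp add: sum_distrib_left deriv_coeff_def prod.lessThan_Suc_shift mult_ac del: partial_derivs.simps prod.lessThan_Suc)
    finally show "partial_derivs (i # I) (\<lambda>x. \<phi> (A *v x)) x =
      (\<Sum>J | length J = length (i # I). deriv_coeff A J (i # I) * partial_derivs J \<phi> (A *v x))"
      by (simp add: sum_lists_Suc del: partial_derivs.simps)
  qed
qed

lemma test_functions_linear:
  fixes \<phi> :: "real^'n \<Rightarrow> real" and A B :: "real^'n^'n"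
  assumes \<phi>: "\<phi> \<in> test_functions" and B: "B ** A = mat 1"
  shows "(\<lambda>x. \<phi> (A *v x)) \<in> test_functions"
proof -
  have s: "smooth \<phi>" "bounded {x. \<phi> x \<noteq> 0}" using \<phi> by (auto simp: test_functions_iff)
  have "(\<lambda>x. partial_derivs J \<phi> (A *v x)) differentiable (at x)" for J x
    using s(1) differentiable_chain_at[of "(*v) A" x "partial_derivs J \<phi>"]
      linear_imp_differentiable[OF matrix_vector_mul_linear[of A]]
    unfolding smooth_def o_def by blast
  then have "smooth (\<lambda>x. \<phi> (A *v x))"
    
    by (simp add: smooth_def partial_derivs_linear[OF s(1)] differentiable_sum differentiable_mult)
  moreover have "{x. \<phi> (A *v x) \<noteq> 0} \<subseteq> (*v) B ` {x. \<phi> x \<noteq> 0}"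
  proof
    fix x assume "x \<in> {x. \<phi> (A *v x) \<noteq> 0}"
    then show "x \<in> (*v) B ` {x. \<phi> x \<noteq> 0}"
      using B by (intro image_eqI[of _ _ "A *v x"]) (simp_all add: matrix_vector_mul_assoc)
  qed
  then have "bounded {x. \<phi> (A *v x) \<noteq> 0}"
    using bounded_linear_image[OF s(2) matrix_vector_mul_bounded_linear] bounded_subset by blast
  ultimately show ?thesis by (simp add: test_functions_iff)
qed

text \<open>A test function \<open>\<phi>\<close> is \<open>\<psi> \<circ> T\<close> with \<open>\<psi> = \<phi> \<circ> T\<^sup>-\<^sup>1\<close>.  Changing variables turns the pairing of \<open>f \<circ> T\<close>
with \<open>\<partial>\<^sub>I \<phi>\<close> into pairings of \<open>f\<close> with the derivatives of \<open>\<psi>\<close> of the same order, to which the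
definition of the weak derivatives of \<open>f\<close> applies.  The order of differentiation is never
exchanged, since all lists \<open>J\<close> occur on the right.\<close>
lemma has_weak_deriv_SL:
  fixes f :: "real^'n \<Rightarrow> real"
  assumes f: "f \<in> L1_loc" and T: "det T = 1"
    and g: "\<And>J. length J = length I \<Longrightarrow> has_weak_deriv J f (g J)"
  shows "has_weak_deriv I (\<lambda>x. f (T *v x)) (\<lambda>x. \<Sum>J | length J = length I. deriv_coeff T J I * g J (T *v x))"
  unfolding has_weak_deriv_def
proof (intro conjI ballI)
  have T': "\<bar>det T\<bar> = 1" using T by simp
  have gL: "g J \<in> L1_loc" if "length J = length I" for J
    using g[OF that] by (simp add: has_weak_deriv_def)
  let ?G = "\<lambda>y. \<Sum>J | length J = length I. deriv_coeff T J I * g J y"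
  have G: "?G \<in> L1_loc"
    by (intro L1_loc_sum L1_loc_cmult) (auto intro: gL)
  from L1_loc_unimodular[OF this T', of 0]
  show "(\<lambda>x. \<Sum>J | length J = length I. deriv_coeff T J I * g J (T *v x)) \<in> L1_loc" by simp
  fix \<phi> :: "real^'n \<Rightarrow> real" assume \<phi>: "\<phi> \<in> test_functions"
  have "det T \<noteq> 0" using T by simp
  then obtain B where B: "T ** B = mat 1" "B ** T = mat 1"
    unfolding invertible_det_nz[symmetric] invertible_def by blast
  define \<psi> where "\<psi> = (\<lambda>x. \<phi> (B *v x))"
  have \<psi>: "\<psi> \<in> test_functions"
    unfolding \<psi>_def by (rule test_functions_linear[OF \<phi> B(1)])
  then have s: "smooth \<psi>" by (simp add: test_functions_iff)
  have \<phi>\<psi>: "\<phi> = (\<lambda>x. \<psi> (T *v x))"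
    using B by (simp add: \<psi>_def matrix_vector_mul_assoc)
  have \<psi>J: "partial_derivs J \<psi> \<in> test_functions" for J by (rule test_functions_partial_derivs[OF \<psi>])
  let ?F = "\<lambda>y. f y * (\<Sum>J | length J = length I. deriv_coeff T J I * partial_derivs J \<psi> y)"
  have F: "?F = (\<lambda>y. \<Sum>J | length J = length I. deriv_coeff T J I * (f y * partial_derivs J \<psi> y))"
    by (simp add: sum_distrib_left mult_ac)
  have "(LINT x|lebesgue. f (T *v x) * partial_derivs I \<phi> x) = (LINT x|lebesgue. ?F (T *v x + 0))"
    unfolding \<phi>\<psi> partial_derivs_linear[OF s] by simp
  also have "\<dots> = (LINT y|lebesgue. ?F y)"
    by (rule integral_lebesgue_unimodular[OF T']) (unfold F, intro borel_measurable_sum borel_measurable_times borel_measurable_const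
        borel_measurable_integrable[OF integrable_L1_loc_test[OF f \<psi>J]])
  also have "\<dots> = (\<Sum>J | length J = length I. deriv_coeff T J I * (LINT y|lebesgue. f y * partial_derivs J \<psi> y))"
    unfolding F by (simp add: Bochner_Integration.integral_sum integrable_L1_loc_test[OF f \<psi>J])
  also have "\<dots> = (\<Sum>J | length J = length I. deriv_coeff T J I * ((-1) ^ length I * (LINT y|lebesgue. g J y * \<psi> y)))"
    by (intro sum.cong refl) (use g \<psi> in \<open>auto simp: has_weak_deriv_def\<close>)
  also have "\<dots> = (-1) ^ length I * (\<Sum>J | length J = length I. (LINT y|lebesgue. deriv_coeff T J I * (g J y * \<psi> y)))"
    unfolding integral_mult_right_zero sum_distrib_left
    by (simp only: mult.left_commute[of "(-1) ^ length I"])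
  also have "(\<Sum>J | length J = length I. (LINT y|lebesgue. deriv_coeff T J I * (g J y * \<psi> y))) = (LINT y|lebesgue. ?G y * \<psi> y)"
    using integrable_L1_loc_test[OF gL \<psi>]
    by (subst Bochner_Integration.integral_sum[symmetric]) (simp_all add: sum_distrib_right mult.assoc)
  also have "(LINT y|lebesgue. ?G y * \<psi> y) = (LINT x|lebesgue. ?G (T *v x + 0) * \<psi> (T *v x + 0))"
    by (rule integral_lebesgue_unimodular[OF T', symmetric]) (rule borel_measurable_integrable[OF integrable_L1_loc_test[OF G \<psi>]])
  finally show "(LINT x|lebesgue. f (T *v x) * partial_derivs I \<phi> x) =
      (-1) ^ length I * (LINT x|lebesgue. (\<Sum>J | length J = length I. deriv_coeff T J I * g J (T *v x)) * \<phi> x)"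
    by (simp add: \<phi>\<psi>)
qed

section \<open>The inverse of a matrix of determinant one\<close>

text \<open>By Cramer's rule the coordinate \<open>x\<^sub>k\<close> is the determinant of \<open>T\<close> with column \<open>k\<close> replaced by \<open>T x\<close>.
Each of the \<open>N!\<close> products in it has one factor from \<open>T x\<close> and \<open>N - 1\<close> factors bounded by \<open>t\<close>.\<close>
lemma norm_preimage_SL_le:
  fixes T :: "real^'n^'n"
  assumes T: "det T = 1" and t: "\<And>j. norm (T *v axis j 1) \<le> t"
  shows "norm x \<le> real CARD('n) * fact CARD('n) * t ^ (CARD('n) - 1) * norm (T *v x)"
proof -
  let ?b = "T *v x"
  have entry: "\<bar>T $ i $ j\<bar> \<le> t" for i j
    using component_le_norm_cart[of "T *v axis j 1" i] t[of j]
    by (simp add: matrix_vector_mult_basis column_def)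
  have t0: "0 \<le> t" using entry[of undefined undefined] by linarith
  have comp: "\<bar>x $ k\<bar> \<le> fact CARD('n) * (t ^ (CARD('n) - 1) * norm ?b)" for k
  proof -
    let ?M = "(\<chi> i j. if j = k then ?b $ i else T $ i $ j) :: real^'n^'n"
    have "\<bar>x $ k\<bar> = \<bar>det ?M\<bar>" using cramer_lemma[of k T x] T by simp
    also have "\<dots> \<le> (\<Sum>p | p permutes (UNIV::'n set). \<bar>of_int (sign p) * (\<Prod>i\<in>UNIV. ?M $ i $ p i)\<bar>)"
      unfolding det_def by (rule sum_abs)
    also have "\<dots> \<le> (\<Sum>p | p permutes (UNIV::'n set). t ^ (CARD('n) - 1) * norm ?b)"
    proof (rule sum_mono)
      fix p assume "p \<in> {p. p permutes (UNIV::'n set)}"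
      then have p: "p permutes UNIV" by simp
      define i0 where "i0 = inv p k"
      have pi: "p i = k \<longleftrightarrow> i = i0" for i
        unfolding i0_def using p by (metis permutes_inverses)
      have "\<bar>of_int (sign p) * (\<Prod>i\<in>UNIV. ?M $ i $ p i)\<bar> = (\<Prod>i\<in>UNIV. \<bar>?M $ i $ p i\<bar>)"
        by (simp add: abs_mult abs_prod sign_def)
      also have "\<dots> = \<bar>?b $ i0\<bar> * (\<Prod>i\<in>UNIV - {i0}. \<bar>T $ i $ p i\<bar>)"
        by (subst prod.remove[of _ i0]) (auto simp: pi intro!: arg_cong2[where f="(*)"] prod.cong)
      also have "\<dots> \<le> norm ?b * (\<Prod>i\<in>UNIV - {i0}. t)"
        using entry t0 by (intro mult_mono component_le_norm_cart prod_mono prod_nonneg) auto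
      also have "\<dots> = t ^ (CARD('n) - 1) * norm ?b"
        by (simp add: card_Diff_singleton)
      finally show "\<bar>of_int (sign p) * (\<Prod>i\<in>UNIV. ?M $ i $ p i)\<bar> \<le> t ^ (CARD('n) - 1) * norm ?b" .
    qed
    also have "\<dots> = fact CARD('n) * (t ^ (CARD('n) - 1) * norm ?b)"
      by (simp add: card_permutations[of "UNIV::'n set" "CARD('n)"])
    finally show ?thesis .
  qed
  have "norm x \<le> (\<Sum>k\<in>UNIV. \<bar>x $ k\<bar>)" by (rule norm_le_l1_cart)
  also have "\<dots> \<le> (\<Sum>k\<in>(UNIV::'n set). fact CARD('n) * (t ^ (CARD('n) - 1) * norm ?b))"
    by (intro sum_mono comp)
  finally show ?thesis by (simp add: mult_ac)
qed

section \<open>Norms of multilinear forms\<close>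

text \<open>The multilinear form with coefficients \<open>w\<close>, of which the derivative form is an instance; keeping
\<open>w\<close> abstract separates the algebra from the choice of weak derivatives.\<close>
definition multiform :: "nat \<Rightarrow> ('n::finite list \<Rightarrow> real) \<Rightarrow> (nat \<Rightarrow> real^'n) \<Rightarrow> real" where
  "multiform k w v = (\<Sum>I | length I = k. w I * (\<Prod>j<k. v j $ (I ! j)))"

lemma deriv_form_eq_multiform: "deriv_form k f x = multiform k (\<lambda>I. weak_deriv I f x)"
  by (simp add: fun_eq_iff deriv_form_def multiform_def)

text \<open>This makes the real supremum in the form norm a genuine least upper bound.\<close>
lemma bdd_above_multiform:
  fixes w :: "'n::finite list \<Rightarrow> real"
  shows "bdd_above ((\<lambda>v. \<bar>multiform k w v\<bar>) ` {v. \<forall>j<k. norm (v j) \<le> 1})"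
proof (rule bdd_aboveI2)
  fix v :: "nat \<Rightarrow> real^'n" assume "v \<in> {v. \<forall>j<k. norm (v j) \<le> 1}"
  then have v: "\<bar>v j $ i\<bar> \<le> 1" if "j < k" for j i
    using that component_le_norm_cart[of "v j" i] by force
  have "\<bar>multiform k w v\<bar> \<le> (\<Sum>I | length I = k. \<bar>w I * (\<Prod>j<k. v j $ (I ! j))\<bar>)"
    unfolding multiform_def by (rule sum_abs)
  also have "\<dots> \<le> (\<Sum>I | length I = k. \<bar>w I\<bar> * 1)"
    unfolding abs_mult abs_prod using v by (intro sum_mono mult_left_mono prod_le_1) auto
  finally show "\<bar>multiform k w v\<bar> \<le> (\<Sum>I | length I = k. \<bar>w I\<bar>)" by simp
qed

lemma multiform_le_form_norm:
  fixes w :: "'n::finite list \<Rightarrow> real"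
  assumes "\<And>j. j < k \<Longrightarrow> norm (v j) \<le> 1"
  shows "\<bar>multiform k w v\<bar> \<le> form_norm k (multiform k w)"
  unfolding form_norm_def by (rule cSUP_upper[OF _ bdd_above_multiform]) (use assms in auto)

lemma form_norm_nonneg: "0 \<le> form_norm k (multiform k w)"
  using multiform_le_form_norm[of k "\<lambda>_. 0" w] by (smt (verit) norm_zero abs_ge_zero)

lemma multiform_scale: "multiform k w (\<lambda>j. c *\<^sub>R v j) = c ^ k * multiform k w v"
  by (simp add: multiform_def prod.distrib sum_distrib_left mult_ac)

lemma multiform_axis:
  fixes w :: "'n::finite list \<Rightarrow> real"
  shows "multiform k w (\<lambda>_. axis i 1) = w (replicate k i)"
proof -
  have "(\<Prod>j<k. axis i 1 $ (I ! j) :: real) = (if I = replicate k i then 1 else 0)" if "length I = k" for I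
  proof -
    have "I = replicate k i \<longleftrightarrow> (\<forall>j<k. I ! j = i)"
      using that by (auto simp: list_eq_iff_nth_eq)
    then show ?thesis by (auto simp: axis_def)
  qed
  then have "multiform k w (\<lambda>_. axis i 1) = (\<Sum>I | length I = k. if I = replicate k i then w I else 0)"
    unfolding multiform_def by (intro sum.cong) auto
  also have "\<dots> = w (replicate k i)"
    using finite_lists_length_eq[of "UNIV :: 'n set" k] by simp
  finally show ?thesis .
qed

text \<open>Homogeneity: \<open>B (v j)\<close> is \<open>a\<close> times a vector of length at most \<open>1\<close>, in each of the \<open>k\<close> arguments.\<close>
lemma form_norm_le_of_substitution:
  assumes "a > 0" and B: "\<And>u. norm (B u) \<le> a * norm u"
    and eq: "\<And>v. multiform k w v = multiform k w' (\<lambda>j. B (v j))"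
  shows "form_norm k (multiform k w) \<le> a ^ k * form_norm k (multiform k w')"
  unfolding form_norm_def[of k "multiform k w"]
proof (rule cSUP_least)
  show "{v. \<forall>j<k. norm (v j :: real^'a) \<le> 1} \<noteq> {}" by (auto intro!: exI[of _ "\<lambda>_. 0"])
  fix v :: "nat \<Rightarrow> real^'a" assume v: "v \<in> {v. \<forall>j<k. norm (v j) \<le> 1}"
  have "multiform k w v = multiform k w' (\<lambda>j. a *\<^sub>R ((1 / a) *\<^sub>R B (v j)))"
    using \<open>a > 0\<close> by (simp add: eq)
  then have "\<bar>multiform k w v\<bar> = a ^ k * \<bar>multiform k w' (\<lambda>j. (1 / a) *\<^sub>R B (v j))\<bar>"
    using \<open>a > 0\<close> unfolding multiform_scale by (simp add: abs_mult power_abs)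
  also have "\<dots> \<le> a ^ k * form_norm k (multiform k w')"
  proof (intro mult_left_mono multiform_le_form_norm)
    fix j assume "j < k"
    then have "norm (B (v j)) \<le> a * 1"
      using v \<open>a > 0\<close> by (intro order_trans[OF B] mult_left_mono) auto
    then show "norm ((1 / a) *\<^sub>R B (v j)) \<le> 1" using \<open>a > 0\<close> by (simp add: field_simps)
  qed (use \<open>a > 0\<close> in auto)
  finally show "\<bar>multiform k w v\<bar> \<le> a ^ k * form_norm k (multiform k w')" .
qed

section \<open>Increments of a function as integrals of its weak derivative\<close>

lemma nn_integral_lborel_shift:
  fixes g :: "'a::euclidean_space \<Rightarrow> ennreal"
  assumes "g \<in> borel_measurable borel"
  shows "(\<integral>\<^sup>+x. g (x + c) \<partial>lborel) = (\<integral>\<^sup>+x. g x \<partial>lborel)"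
  using nn_integral_distr[of "(+) c" lborel borel g] assms
  by (simp add: lborel_distr_plus add.commute)

lemma integral_lborel_shift:
  fixes g :: "'a::euclidean_space \<Rightarrow> real"
  assumes "g \<in> borel_measurable borel"
  shows "(LINT x|lborel. g (x + c)) = (LINT x|lborel. g x)"
  using integral_distr[of "(+) c" lborel borel g] assms
  by (simp add: lborel_distr_plus add.commute)

lemma integrable_lborel_shift:
  fixes g :: "'a::euclidean_space \<Rightarrow> real"
  assumes "integrable lborel g"
  shows "integrable lborel (\<lambda>x. g (x + c))"
proof -
  have "integrable (distr lborel borel ((+) c)) g" using assms by (simp add: lborel_distr_plus)
  then show ?thesis by (subst (asm) integrable_distr_eq) (use assms in \<open>auto simp: add.commute\<close>)
qed

text \<open>The graph of \<open>y powr p\<close> lies above its tangent at \<open>c\<close>, rearranged so that all terms are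
nonnegative.\<close>
lemma Young_tangent:
  fixes p y c :: real
  assumes "p \<ge> 1" "y \<ge> 0" "c > 0"
  shows "p * c powr (p - 1) * y \<le> y powr p + (p - 1) * c powr p"
proof (cases "y = 0")
  case True
  then show ?thesis using assms by simp
next
  case False
  with assms have y: "y > 0" by simp
  have "(y powr p) powr (1 / p) * (c powr p) powr (1 - 1 / p) \<le> (1 / p) * y powr p + (1 - 1 / p) * c powr p"
    using assms y by (intro Youngs_inequality_0) auto
  then have "y * c powr (p - 1) \<le> (1 / p) * y powr p + (1 - 1 / p) * c powr p"
    using assms y by (simp add: powr_powr right_diff_distrib)
  from mult_left_mono[OF this, of p] show ?thesis
    using assms by (simp add: algebra_simps)
qed

text \<open>Jensen's inequality for the mean over \<open>[0, r]\<close>: integrate the tangent inequality at the mean value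
of \<open>\<bar>g\<bar>\<close>.\<close>
lemma powr_average_le:
  fixes g :: "real \<Rightarrow> real"
  assumes g[measurable]: "g \<in> borel_measurable borel" and r: "r > 0" and p: "p \<ge> 1"
  shows "ennreal (\<bar>LINT u|lborel. indicator {0..r} u * g u\<bar> powr p) \<le>
    ennreal (r powr (p - 1)) * (\<integral>\<^sup>+u. ennreal (indicator {0..r} u * \<bar>g u\<bar> powr p) \<partial>lborel)"
proof -
  define I where "I = (LINT u|lborel. indicator {0..r} u * \<bar>g u\<bar>)"
  let ?Q = "\<integral>\<^sup>+u. ennreal (indicator {0..r} u * \<bar>g u\<bar> powr p) \<partial>lborel"
  consider "\<not> integrable lborel (\<lambda>u. indicator {0..r} u * g u)" | "?Q = \<infinity>" | "I = 0"
    | "integrable lborel (\<lambda>u. indicator {0..r} u * g u)" "?Q \<noteq> \<infinity>" "I \<noteq> 0"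
    by blast
  moreover have le: "\<bar>LINT u|lborel. indicator {0..r} u * g u\<bar> \<le> I"
    unfolding I_def using integral_norm_bound[of lborel "\<lambda>u. indicator {0..r} u * g u"]
    by (simp add: abs_mult)
  ultimately show ?thesis
  proof cases
    case 1
    then show ?thesis using p by (simp add: not_integrable_integral_eq)
  next
    case 2
    then show ?thesis using r by (simp add: ennreal_mult_eq_top_iff)
  next
    case 3
    then show ?thesis using le p by simp
  next
    case 4
    have "I \<ge> 0" unfolding I_def by (rule Bochner_Integration.integral_nonneg) simp
    with 4(3) have I0: "I > 0" by simp
    \<comment> \<open>the mean value, at which the tangent is optimal\<close>
    define c where "c = I / r"
    have c: "c > 0" using I0 r by (simp add: c_def)
    have i1: "integrable lborel (\<lambda>u. indicator {0..r} u * \<bar>g u\<bar>)"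
      using integrable_norm[OF 4(1)] by (simp add: abs_mult)
    have i2: "integrable lborel (\<lambda>u. indicator {0..r} u * \<bar>g u\<bar> powr p)"
      using 4(2) by (intro integrableI_nonneg) (auto simp: less_top)
    have i3: "integrable lborel (indicator {0..r} :: real \<Rightarrow> real)"
      by (intro integrable_real_indicator) (auto simp: emeasure_lborel_Icc_eq)
    let ?q = "LINT u|lborel. indicator {0..r} u * \<bar>g u\<bar> powr p"
    have "(LINT u|lborel. (p * c powr (p - 1)) * (indicator {0..r} u * \<bar>g u\<bar>)) \<le>
      (LINT u|lborel. indicator {0..r} u * \<bar>g u\<bar> powr p + ((p - 1) * c powr p) * indicator {0..r} u)"
    proof (rule integral_mono)
      show "integrable lborel (\<lambda>u. (p * c powr (p - 1)) * (indicator {0..r} u * \<bar>g u\<bar>))"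
        using i1 by simp
      show "integrable lborel (\<lambda>u. indicator {0..r} u * \<bar>g u\<bar> powr p + ((p - 1) * c powr p) * indicator {0..r} u)"
        using i2 i3 by simp
      show "(p * c powr (p - 1)) * (indicator {0..r} u * \<bar>g u\<bar>) \<le> indicator {0..r} u * \<bar>g u\<bar> powr p + ((p - 1) * c powr p) * indicator {0..r} u" for u
        using Young_tangent[OF p _ c, of "\<bar>g u\<bar>"] by (cases "u \<in> {0..r}") auto
    qed
    then have "p * c powr (p - 1) * I \<le> ?q + (p - 1) * c powr p * r"
      using i2 i3 r by (simp add: I_def)
    moreover have "c powr (p - 1) * I = c powr p * r"
      using I0 r by (simp add: c_def powr_diff)
    ultimately have "p * (c powr p * r) \<le> ?q + (p - 1) * (c powr p * r)"
      by (simp only: mult.assoc)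
    then have "c powr p * r \<le> ?q" by (simp add: left_diff_distrib)
    then have "r powr (p - 1) * (c powr p * r) \<le> r powr (p - 1) * ?q" by (intro mult_left_mono) auto
    moreover have "r powr (p - 1) * (c powr p * r) = I powr p"
      using r I0 by (simp add: c_def powr_divide powr_diff)
    ultimately have "I powr p \<le> r powr (p - 1) * ?q" by simp
    moreover have "\<bar>LINT u|lborel. indicator {0..r} u * g u\<bar> powr p \<le> I powr p"
      using le p by (intro powr_mono2) auto
    ultimately have "ennreal (\<bar>LINT u|lborel. indicator {0..r} u * g u\<bar> powr p) \<le> ennreal (r powr (p - 1) * ?q)"
      by (intro ennreal_leI) linarith
    also have "\<dots> = ennreal (r powr (p - 1)) * ?Q"
      using i2 by (subst nn_integral_eq_integral) (auto simp: ennreal_mult')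
    finally show ?thesis .
  qed
qed

text \<open>For each \<open>u\<close> the slice \<open>K (u, \<cdot>)\<close> is dominated by a translate of one fixed integrable function, and
translation does not change its integral; so the iterated integral is finite.\<close>
lemma integrable_sliding_window:
  fixes G :: "real^'n \<Rightarrow> real" and K :: "real \<times> (real^'n) \<Rightarrow> real"
  assumes K[measurable]: "K \<in> borel_measurable (lborel \<Otimes>\<^sub>M lborel)"
    and G: "integrable lborel (\<lambda>x. indicator D x * G x)"
    and B: "B \<ge> 0"
    and le: "\<And>u x. \<bar>K (u, x)\<bar> \<le> indicator {0..r} u * (B * \<bar>indicator D (x + s u) * G (x + s u)\<bar>)"
  shows "integrable (lborel \<Otimes>\<^sub>M lborel) K"
proof (rule integrableI_bounded)
  have [measurable]: "(\<lambda>x. indicator D x * G x) \<in> borel_measurable borel"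
    using borel_measurable_integrable[OF G] by simp
  let ?C = "\<integral>\<^sup>+x. ennreal \<bar>indicator D x * G x\<bar> \<partial>lborel"
  have fin: "?C < \<infinity>" using G by (simp add: integrable_iff_bounded)
  have "(\<integral>\<^sup>+z. ennreal (norm (K z)) \<partial>(lborel \<Otimes>\<^sub>M lborel)) =
      (\<integral>\<^sup>+u. \<integral>\<^sup>+x. ennreal \<bar>K (u, x)\<bar> \<partial>lborel \<partial>lborel)"
    by (subst lborel.nn_integral_fst[symmetric]) simp_all
  also have "\<dots> \<le> (\<integral>\<^sup>+u. ennreal (indicator {0..r} u * B) * ?C \<partial>lborel)"
  proof (rule nn_integral_mono)
    fix u :: real
    have "(\<integral>\<^sup>+x. ennreal \<bar>K (u, x)\<bar> \<partial>lborel) \<le>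
      (\<integral>\<^sup>+x. ennreal (indicator {0..r} u * B) * ennreal \<bar>indicator D (x + s u) * G (x + s u)\<bar> \<partial>lborel)"
      using le[of u] B by (intro nn_integral_mono) (simp add: ennreal_mult[symmetric] mult.assoc ennreal_leI)
    also have "\<dots> = (\<integral>\<^sup>+x. ennreal (indicator {0..r} u * B) * ennreal \<bar>indicator D x * G x\<bar> \<partial>lborel)"
      by (rule nn_integral_lborel_shift[of "\<lambda>x. ennreal (indicator {0..r} u * B) * ennreal \<bar>indicator D x * G x\<bar>"]) measurable
    also have "\<dots> = ennreal (indicator {0..r} u * B) * ?C"
      by (intro nn_integral_cmult) measurable
    finally show "(\<integral>\<^sup>+x. ennreal \<bar>K (u, x)\<bar> \<partial>lborel) \<le> ennreal (indicator {0..r} u * B) * ?C" .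
  qed
  also have "\<dots> = (\<integral>\<^sup>+u. ennreal B * indicator {0..r} u \<partial>lborel) * ?C"
    by (subst nn_integral_multc[symmetric]) (auto intro!: nn_integral_cong simp: indicator_def)
  also have "\<dots> < \<infinity>"
    using fin by (auto simp: nn_integral_cmult ennreal_mult_less_top emeasure_lborel_Icc_eq)
  finally show "(\<integral>\<^sup>+z. ennreal (norm (K z)) \<partial>(lborel \<Otimes>\<^sub>M lborel)) < \<infinity>" .
qed (rule K)

lemma partial_derivs_shift:
  fixes \<phi> :: "real^'n \<Rightarrow> real"
  assumes "smooth \<phi>"
  shows "partial_derivs I (\<lambda>x. \<phi> (x + b)) = (\<lambda>x. partial_derivs I \<phi> (x + b))"
proof (induction I)
  case (Cons i I)
  have "((\<lambda>x. partial_derivs I \<phi> (x + b)) has_derivative frechet_derivative (partial_derivs I \<phi>) (at (x + b))) (at x)" for x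
  proof -
    have "((\<lambda>x. x + b) has_derivative (\<lambda>h. h)) (at x)"
      by (auto intro!: derivative_eq_intros)
    from diff_chain_at[OF this, of "partial_derivs I \<phi>"] show ?thesis
      using assms unfolding smooth_def frechet_derivative_works o_def by blast
  qed
  show ?case
    unfolding partial_derivs.simps Cons.IH
    by (rule ext) (subst partial_deriv_eqI, fact, simp add: partial_deriv_def)
qed simp

lemma test_functions_shift:
  fixes \<phi> :: "real^'n \<Rightarrow> real"
  assumes \<phi>: "\<phi> \<in> test_functions"
  shows "(\<lambda>x. \<phi> (x + b)) \<in> test_functions"
proof -
  have s: "smooth \<phi>" "bounded {x. \<phi> x \<noteq> 0}" using \<phi> by (auto simp: test_functions_iff)
  have "smooth (\<lambda>x. \<phi> (x + b))"
    unfolding smooth_def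
  proof (intro allI)
    fix I x
    have "(\<lambda>x. partial_derivs I \<phi> (x + b)) differentiable (at x)"
      using s(1) differentiable_chain_at[of "\<lambda>x. x + b" x "partial_derivs I \<phi>"]
      unfolding smooth_def o_def by (simp add: differentiable_add)
    then show "partial_derivs I (\<lambda>x. \<phi> (x + b)) differentiable (at x)"
      by (simp add: partial_derivs_shift[OF s(1)])
  qed
  moreover have "{x. \<phi> (x + b) \<noteq> 0} = (+) (- b) ` {x. \<phi> x \<noteq> 0}"
    by (auto simp: image_iff algebra_simps)
  then have "bounded {x. \<phi> (x + b) \<noteq> 0}"
    using bounded_translation[OF s(2), of "- b"] by simp
  ultimately show ?thesis by (simp add: test_functions_iff)
qed


text \<open>The fundamental theorem of calculus on the segment from \<open>x\<close> to \<open>x - r e\<^sub>j\<close>.\<close>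
lemma test_function_increment:
  fixes \<phi> :: "real^'n \<Rightarrow> real"
  assumes \<phi>: "\<phi> \<in> test_functions" and r: "r > 0"
  shows "\<phi> (x - r *\<^sub>R axis j 1) - \<phi> x =
    - (LINT u|lborel. indicator {0..r} u * partial_deriv j \<phi> (x - u *\<^sub>R axis j 1))"
proof -
  let ?e = "axis j 1 :: real^'n"
  have d: "((\<lambda>u. - \<phi> (x - u *\<^sub>R ?e)) has_real_derivative partial_deriv j \<phi> (x - u *\<^sub>R ?e)) (at u)" for u
  proof -
    have D: "(\<phi> has_derivative frechet_derivative \<phi> (at (x - u *\<^sub>R ?e))) (at (x - u *\<^sub>R ?e))"
      using test_function_differentiable[OF \<phi>] by (simp add: frechet_derivative_works)
    then have lin: "linear (frechet_derivative \<phi> (at (x - u *\<^sub>R ?e)))"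
      by (rule has_derivative_linear)
    have "((\<lambda>u. x - u *\<^sub>R ?e) has_derivative (\<lambda>h. - (h *\<^sub>R ?e))) (at u)"
      by (auto intro!: derivative_eq_intros)
    from has_derivative_minus[OF diff_chain_at[OF this D]] show ?thesis
      unfolding has_field_derivative_def
      by (simp add: o_def partial_deriv_def linear_neg[OF lin] linear_scale[OF lin] mult_commute_abs)
  qed
  have c: "isCont (\<lambda>u. partial_deriv j \<phi> (x - u *\<^sub>R ?e)) u" for u
  proof -
    have "continuous_on UNIV (\<lambda>u. partial_deriv j \<phi> (x - u *\<^sub>R ?e))"
      by (intro continuous_on_compose2[OF test_function_continuous[OF test_functions_partial_deriv[OF \<phi>], of UNIV]]
          continuous_intros) auto
    then show ?thesis by (simp add: continuous_on_eq_continuous_at)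
  qed
  have "(LINT u|lborel. partial_deriv j \<phi> (x - u *\<^sub>R ?e) * indicator {0..r} u) =
      - \<phi> (x - r *\<^sub>R ?e) - - \<phi> (x - 0 *\<^sub>R ?e)"
    using r d c by (intro integral_FTC_Icc_real) auto
  then show ?thesis by (simp add: mult.commute)
qed

text \<open>Both sides have the same pairing with every test function \<open>\<phi>\<close>.  Moving the increment onto \<open>\<phi>\<close> and
writing it as an integral over \<open>u\<close> of the derivative of the translate of \<open>\<phi>\<close> by \<open>u e\<^sub>j\<close>, the
definition of the weak derivative can be applied for each fixed \<open>u\<close>, because translates of test
functions are test functions.  Fubini's theorem is used before and after that.\<close>
lemma weak_deriv_increment:
  fixes F G :: "real^'n \<Rightarrow> real"
  assumes [measurable]: "F \<in> borel_measurable borel" "G \<in> borel_measurable borel"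
    and F: "\<And>C. compact C \<Longrightarrow> integrable lborel (\<lambda>x. indicator C x * F x)"
    and G: "\<And>C. compact C \<Longrightarrow> integrable lborel (\<lambda>x. indicator C x * G x)"
    and weak: "\<And>\<phi>. \<phi> \<in> test_functions \<Longrightarrow>
      (LINT x|lborel. F x * partial_deriv j \<phi> x) = - (LINT x|lborel. G x * \<phi> x)"
    and r: "r > 0"
  shows "AE x in lborel. F (x + r *\<^sub>R axis j 1) - F x =
    (LINT u|lborel. indicator {0..r} u * G (x + u *\<^sub>R axis j 1))"
proof -
  let ?e = "axis j 1 :: real^'n"
  define H where "H = (\<lambda>x. LINT u|lborel. indicator {0..r} u * G (x + u *\<^sub>R ?e))"
  have [measurable]: "H \<in> borel_measurable borel"
    unfolding H_def by measurable
  have ne: "norm (u *\<^sub>R ?e) \<le> r" if "u \<in> {0..r}" for u using that by simp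
  have window_G: "integrable (lborel \<Otimes>\<^sub>M lborel) (\<lambda>(u, x). indicator {0..r} u * (G (x + u *\<^sub>R ?e) * w x))"
    if [measurable]: "w \<in> borel_measurable borel" and w: "\<And>x. \<bar>w x\<bar> \<le> M * indicator (cball 0 \<rho>) x"
    for w :: "real^'n \<Rightarrow> real" and M \<rho>
  proof (rule integrable_sliding_window[OF _ G[of "cball 0 (\<rho> + r)"]])
    fix u :: real and x :: "real^'n"
    show "\<bar>case (u, x) of (u, x) \<Rightarrow> indicator {0..r} u * (G (x + u *\<^sub>R ?e) * w x)\<bar> \<le>
      indicator {0..r} u * (\<bar>M\<bar> * \<bar>indicator (cball 0 (\<rho> + r)) (x + u *\<^sub>R ?e) * G (x + u *\<^sub>R ?e)\<bar>)"
    proof (cases "u \<in> {0..r} \<and> x \<in> cball 0 \<rho>")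
      case True
      then have "norm (x + u *\<^sub>R ?e) \<le> \<rho> + r"
        using ne[of u] by (intro norm_triangle_le) auto
      moreover have "\<bar>w x\<bar> \<le> \<bar>M\<bar>" using w[of x] True by auto
      ultimately show ?thesis
        using True by (simp add: abs_mult mult.commute mult_right_mono)
    next
      case False
      then have "indicator {0..r} u = (0::real) \<or> w x = 0" using w[of x] by auto
      then show ?thesis by auto
    qed
  qed auto
  have diffF: "integrable lborel (\<lambda>x. indicator C x * (F (x + r *\<^sub>R ?e) - F x))" if "compact C" for C
  proof -
    have "compact ((+) (r *\<^sub>R ?e) ` C)" by (rule compact_translation[OF that])
    from integrable_lborel_shift[OF F[OF this], of "r *\<^sub>R ?e"]
    have "integrable lborel (\<lambda>x. indicator C x * F (x + r *\<^sub>R ?e))"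
      by (rule back_subst[of "integrable lborel"]) (auto simp: indicator_def fun_eq_iff image_iff algebra_simps)
    then show ?thesis using F[OF that] by (simp add: right_diff_distrib)
  qed
  have intH: "integrable lborel (\<lambda>x. indicator C x * H x)" if C: "compact C" for C
  proof -
    obtain a where a: "\<And>x. x \<in> C \<Longrightarrow> norm x \<le> a" using compact_imp_bounded[OF C] by (auto simp: bounded_iff)
    have [measurable]: "C \<in> sets borel" using C by (rule borel_compact)
    have "integrable (lborel \<Otimes>\<^sub>M lborel) (\<lambda>(u, x). indicator {0..r} u * (G (x + u *\<^sub>R ?e) * indicator C x))"
      using a by (intro window_G[of _ 1 a]) (auto simp: indicator_def)
    from lborel_pair.integrable_snd[OF this]
    have "integrable lborel (\<lambda>x. LINT u|lborel. indicator {0..r} u * (G (x + u *\<^sub>R ?e) * indicator C x))" .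
    also have "(\<lambda>x. LINT u|lborel. indicator {0..r} u * (G (x + u *\<^sub>R ?e) * indicator C x)) = (\<lambda>x. indicator C x * H x)"
    proof
      fix x
      have "(\<lambda>u. indicator {0..r} u * (G (x + u *\<^sub>R ?e) * indicator C x)) =
        (\<lambda>u. indicator C x * (indicator {0..r} u * G (x + u *\<^sub>R ?e)))"
        by (simp add: fun_eq_iff)
      then show "(LINT u|lborel. indicator {0..r} u * (G (x + u *\<^sub>R ?e) * indicator C x)) = indicator C x * H x"
        by (simp only: H_def integral_mult_right_zero)
    qed
    finally show ?thesis .
  qed
  have "AE x in lborel. (F (x + r *\<^sub>R ?e) - F x) - H x = 0"
  proof (rule AE_zero_if_orthogonal_to_test_functions)
    show "integrable lborel (\<lambda>x. indicator (cbox a b) x * (F (x + r *\<^sub>R ?e) - F x - H x))" for a b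
      using Bochner_Integration.integrable_diff[OF diffF[of "cbox a b"] intH[of "cbox a b"]]
      by (simp add: right_diff_distrib)
    fix \<phi> :: "real^'n \<Rightarrow> real" assume \<phi>: "\<phi> \<in> test_functions"
    let ?d = "partial_deriv j \<phi>"
    have d: "?d \<in> test_functions" by (rule test_functions_partial_deriv[OF \<phi>])
    have [measurable]: "\<phi> \<in> borel_measurable borel" "?d \<in> borel_measurable borel"
      using test_function_borel \<phi> d by auto
    obtain \<rho> M where M: "\<rho> > 0" "\<And>x. \<bar>\<phi> x\<bar> \<le> M * indicator (cball 0 \<rho>) x"
      using test_function_bounded[OF \<phi>] by blast
    obtain \<rho>' M' where M': "\<rho>' > 0" "\<And>x. \<bar>?d x\<bar> \<le> M' * indicator (cball 0 \<rho>') x"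
      using test_function_bounded[OF d] by blast
    have int_test: "integrable lborel (\<lambda>x. f x * \<psi> x)"
      if f: "\<And>C. compact C \<Longrightarrow> integrable lborel (\<lambda>x. indicator C x * f x)"
        and \<psi>: "\<psi> \<in> test_functions" and [measurable]: "f \<in> borel_measurable borel" for f \<psi> :: "real^'n \<Rightarrow> real"
    proof -
      obtain \<rho> M where M: "\<rho> > 0" "\<And>x. \<bar>\<psi> x\<bar> \<le> M * indicator (cball 0 \<rho>) x"
        using test_function_bounded[OF \<psi>] by blast
      have [measurable]: "\<psi> \<in> borel_measurable borel" by (rule test_function_borel[OF \<psi>])
      have "integrable lborel (\<lambda>x. M * (indicator (cball 0 \<rho>) x * f x))"
        by (intro integrable_mult_right f compact_cball)
      then show ?thesis
      proof (rule Bochner_Integration.integrable_bound)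
        have "\<bar>f x\<bar> * \<bar>\<psi> x\<bar> \<le> \<bar>M\<bar> * (indicator (cball 0 \<rho>) x * \<bar>f x\<bar>)" for x
        proof -
          have "\<bar>\<psi> x\<bar> \<le> \<bar>M\<bar> * indicator (cball 0 \<rho>) x"
            using M(2)[of x] by (rule order_trans) (simp add: mult_right_mono)
          from mult_left_mono[OF this, of "\<bar>f x\<bar>"] show ?thesis by (simp add: mult_ac)
        qed
        then show "AE x in lborel. norm (f x * \<psi> x) \<le> norm (M * (indicator (cball 0 \<rho>) x * f x))"
          by (simp add: abs_mult)
      qed measurable
    qed
    have window_F: "integrable (lborel \<Otimes>\<^sub>M lborel) (\<lambda>(u, x). indicator {0..r} u * (F x * ?d (x - u *\<^sub>R ?e)))"
    proof (rule integrable_sliding_window[OF _ F[of "cball 0 (\<rho>' + r)"], where s="\<lambda>_. 0"])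
      fix u :: real and x :: "real^'n"
      show "\<bar>case (u, x) of (u, x) \<Rightarrow> indicator {0..r} u * (F x * ?d (x - u *\<^sub>R ?e))\<bar> \<le>
        indicator {0..r} u * (\<bar>M'\<bar> * \<bar>indicator (cball 0 (\<rho>' + r)) (x + 0) * F (x + 0)\<bar>)"
      proof (cases "u \<in> {0..r} \<and> x - u *\<^sub>R ?e \<in> cball 0 \<rho>'")
        case True
        then have "norm ((x - u *\<^sub>R ?e) + u *\<^sub>R ?e) \<le> \<rho>' + r"
          using ne[of u] by (intro norm_triangle_le) auto
        moreover have "\<bar>F x\<bar> * \<bar>?d (x - u *\<^sub>R ?e)\<bar> \<le> \<bar>F x\<bar> * \<bar>M'\<bar>"
          using M'(2)[of "x - u *\<^sub>R ?e"] True by (intro mult_left_mono) auto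
        ultimately show ?thesis
          using True by (simp add: abs_mult mult.commute)
      next
        case False
        then have "indicator {0..r} u = (0::real) \<or> ?d (x - u *\<^sub>R ?e) = 0" using M'(2)[of "x - u *\<^sub>R ?e"] by auto
        then show ?thesis by auto
      qed
    qed auto
    \<comment> \<open>the definition of the weak derivative, applied to the translate of \<open>\<phi>\<close> by \<open>u e\<^sub>j\<close>\<close>
    have slice: "(LINT x|lborel. F x * ?d (x - u *\<^sub>R ?e)) = - (LINT x|lborel. G (x + u *\<^sub>R ?e) * \<phi> x)" for u
    proof -
      have s: "(\<lambda>x. \<phi> (x + - (u *\<^sub>R ?e))) \<in> test_functions" by (rule test_functions_shift[OF \<phi>])
      have "partial_deriv j (\<lambda>x. \<phi> (x + - (u *\<^sub>R ?e))) = (\<lambda>x. ?d (x + - (u *\<^sub>R ?e)))"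
        using partial_derivs_shift[of \<phi> "[j]" "- (u *\<^sub>R ?e)"] \<phi>
        unfolding test_functions_iff partial_derivs.simps by blast
      then have "(LINT x|lborel. F x * ?d (x - u *\<^sub>R ?e)) = - (LINT x|lborel. G x * \<phi> (x - u *\<^sub>R ?e))"
        using weak[OF s] by simp
      also have "(LINT x|lborel. G x * \<phi> (x - u *\<^sub>R ?e)) = (LINT x|lborel. G (x + u *\<^sub>R ?e) * \<phi> (x + u *\<^sub>R ?e - u *\<^sub>R ?e))"
        by (rule integral_lborel_shift[symmetric]) measurable
      finally show ?thesis by simp
    qed
    have shifted: "(LINT x|lborel. F (x + r *\<^sub>R ?e) * \<phi> x) = (LINT x|lborel. F x * \<phi> (x - r *\<^sub>R ?e))"
      using integral_lborel_shift[of "\<lambda>x. F x * \<phi> (x - r *\<^sub>R ?e)" "r *\<^sub>R ?e"] by simp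
    have i1: "integrable lborel (\<lambda>x. F x * \<phi> (x - r *\<^sub>R ?e))"
      using int_test[OF F test_functions_shift[OF \<phi>, of "- (r *\<^sub>R ?e)"]] by simp
    have i1': "integrable lborel (\<lambda>x. F (x + r *\<^sub>R ?e) * \<phi> x)"
      using integrable_lborel_shift[OF i1, of "r *\<^sub>R ?e"] by simp
    have i2: "integrable lborel (\<lambda>x. F x * \<phi> x)" by (rule int_test[OF F \<phi>]) measurable
    have i3: "integrable lborel (\<lambda>x. H x * \<phi> x)" by (rule int_test[OF intH \<phi>]) measurable
    have "(LINT x|lborel. (F (x + r *\<^sub>R ?e) - F x) * \<phi> x) = (LINT x|lborel. F (x + r *\<^sub>R ?e) * \<phi> x) - (LINT x|lborel. F x * \<phi> x)"
      using i1' i2 by (simp add: left_diff_distrib)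
    also have "\<dots> = (LINT x|lborel. F x * \<phi> (x - r *\<^sub>R ?e) - F x * \<phi> x)"
      using i1 i2 by (simp add: shifted)
    also have "\<dots> = (LINT x|lborel. - (LINT u|lborel. indicator {0..r} u * (F x * ?d (x - u *\<^sub>R ?e))))"
    proof (intro Bochner_Integration.integral_cong refl)
      fix x
      have "F x * \<phi> (x - r *\<^sub>R ?e) - F x * \<phi> x = F x * (\<phi> (x - r *\<^sub>R ?e) - \<phi> x)"
        by (simp add: right_diff_distrib)
      also have "\<dots> = - (LINT u|lborel. F x * (indicator {0..r} u * ?d (x - u *\<^sub>R ?e)))"
        by (simp add: test_function_increment[OF \<phi> r])
      finally show "F x * \<phi> (x - r *\<^sub>R ?e) - F x * \<phi> x = - (LINT u|lborel. indicator {0..r} u * (F x * ?d (x - u *\<^sub>R ?e)))"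
        by (simp only: mult.left_commute)
    qed
    also have "\<dots> = - (LINT u|lborel. LINT x|lborel. indicator {0..r} u * (F x * ?d (x - u *\<^sub>R ?e)))"
      using lborel_pair.Fubini_integral[OF window_F] by simp
    also have "\<dots> = (LINT u|lborel. LINT x|lborel. indicator {0..r} u * (G (x + u *\<^sub>R ?e) * \<phi> x))"
      by (simp add: slice)
    also have "\<dots> = (LINT x|lborel. LINT u|lborel. indicator {0..r} u * (G (x + u *\<^sub>R ?e) * \<phi> x))"
      by (rule lborel_pair.Fubini_integral[OF window_G[OF _ M(2)], symmetric]) measurable
    also have "\<dots> = (LINT x|lborel. H x * \<phi> x)"
      by (simp add: H_def mult.assoc[symmetric])
    finally have "(LINT x|lborel. (F (x + r *\<^sub>R ?e) - F x) * \<phi> x) = (LINT x|lborel. H x * \<phi> x)" .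
    then show "(LINT x|lborel. (F (x + r *\<^sub>R ?e) - F x - H x) * \<phi> x) = 0"
      using i1' i2 i3 by (simp add: left_diff_distrib)
  qed measurable
  then show ?thesis
    unfolding H_def by eventually_elim simp
qed

section \<open>Iterated differences\<close>

lemma fdiff_funpow_eq:
  "(fdiff h ^^ m) f x = (\<Sum>i\<le>m. (-1) ^ (m + i) * real (m choose i) * f (x + real i *\<^sub>R h))"
proof (induction m arbitrary: x)
  case (Suc m)
  let ?g = "\<lambda>i. f (x + real i *\<^sub>R h)"
  have "(fdiff h ^^ Suc m) f x = (fdiff h ^^ m) f (x + h) - (fdiff h ^^ m) f x"
    by (simp add: fdiff_def)
  also have "(fdiff h ^^ m) f (x + h) = (\<Sum>i\<le>m. (-1) ^ (m + i) * real (m choose i) * ?g (Suc i))"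
    unfolding Suc.IH by (simp add: algebra_simps)
  also have "(fdiff h ^^ m) f x = (\<Sum>i\<le>Suc m. (-1) ^ (m + i) * real (m choose i) * ?g i)"
    unfolding Suc.IH by (simp add: binomial_eq_0)
  also have "\<dots> = (-1) ^ m * ?g 0 - (\<Sum>i\<le>m. (-1) ^ (m + i) * real (m choose Suc i) * ?g (Suc i))"
    by (subst sum.atMost_Suc_shift) (simp add: sum_negf)
  finally have "(fdiff h ^^ Suc m) f x = - ((-1) ^ m * ?g 0) +
     (\<Sum>i\<le>m. (-1) ^ (m + i) * real (Suc m choose Suc i) * ?g (Suc i))"
    by (simp add: sum.distrib ring_distribs)
  also have "\<dots> = (\<Sum>i\<le>Suc m. (-1) ^ (Suc m + i) * real (Suc m choose i) * ?g i)"
    by (subst sum.atMost_Suc_shift) simp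
  finally show ?case .
qed simp

text \<open>Both sides are the double sum of \<open>\<plusminus> (m choose i) (m choose j) f (x + i h + (i j / m) k)\<close>, once summed
over \<open>i\<close> first and once over \<open>j\<close> first.\<close>
lemma fdiff_exchange:
  assumes m: "m > 0"
  shows "(\<Sum>j\<le>m. (-1) ^ j * real (m choose j) * (fdiff (h + (real j / real m) *\<^sub>R k) ^^ m) f x) =
    (\<Sum>i\<le>m. (-1) ^ i * real (m choose i) * (fdiff ((real i / real m) *\<^sub>R k) ^^ m) f (x + real i *\<^sub>R h))"
proof -
  have "(\<Sum>j\<le>m. (-1) ^ j * real (m choose j) * (fdiff (h + (real j / real m) *\<^sub>R k) ^^ m) f x) =
    (\<Sum>j\<le>m. \<Sum>i\<le>m. (-1) ^ (m + i + j) * (real (m choose j) * real (m choose i)) *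
      f (x + real i *\<^sub>R h + (real i * real j / real m) *\<^sub>R k))"
    unfolding fdiff_funpow_eq sum_distrib_left by (simp add: algebra_simps power_add)
  also have "\<dots> = (\<Sum>i\<le>m. \<Sum>j\<le>m. (-1) ^ (m + i + j) * (real (m choose j) * real (m choose i)) *
      f (x + real i *\<^sub>R h + (real i * real j / real m) *\<^sub>R k))"
    by (rule sum.swap)
  also have "\<dots> = (\<Sum>i\<le>m. (-1) ^ i * real (m choose i) * (fdiff ((real i / real m) *\<^sub>R k) ^^ m) f (x + real i *\<^sub>R h))"
    unfolding fdiff_funpow_eq sum_distrib_left by (simp add: algebra_simps power_add)
  finally show ?thesis .
qed

text \<open>In fdiff_exchange the term \<open>j = 0\<close> is the difference with step \<open>h\<close>, and the term \<open>i = 0\<close> vanishes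
because its step is \<open>0\<close>.  So a difference of order \<open>m\<close> is controlled by differences of the same
order with steps that depend on a vector \<open>k\<close> of free choice.\<close>
lemma abs_fdiff_le:
  assumes m: "m > 0"
  shows "\<bar>(fdiff h ^^ m) f x\<bar> \<le> 2 ^ m * (\<Sum>i=1..m.
    \<bar>(fdiff (h + (real i / real m) *\<^sub>R k) ^^ m) f x\<bar> +
    \<bar>(fdiff ((real i / real m) *\<^sub>R k) ^^ m) f (x + real i *\<^sub>R h)\<bar>)"
proof -
  let ?A = "\<lambda>j. (fdiff (h + (real j / real m) *\<^sub>R k) ^^ m) f x"
  let ?B = "\<lambda>i. (fdiff ((real i / real m) *\<^sub>R k) ^^ m) f (x + real i *\<^sub>R h)"
  let ?c = "\<lambda>i. (-1) ^ i * real (m choose i)"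
  have split: "{..m} = insert 0 {1..m}" by auto
  have "?B 0 = 0"
    using m by (cases m) (auto simp: fdiff_def)
  then have eq: "(fdiff h ^^ m) f x = (\<Sum>i=1..m. ?c i * (?B i - ?A i))"
    using fdiff_exchange[OF m, of h k f x] unfolding split
    by (simp add: right_diff_distrib sum_subtractf)
  have "\<bar>(fdiff h ^^ m) f x\<bar> \<le> (\<Sum>i=1..m. \<bar>?c i * (?B i - ?A i)\<bar>)"
    unfolding eq by (rule sum_abs)
  also have "\<dots> \<le> (\<Sum>i=1..m. 2 ^ m * (\<bar>?A i\<bar> + \<bar>?B i\<bar>))"
  proof (rule sum_mono)
    fix i
    have "real (m choose i) \<le> real (2 ^ m)" by (rule of_nat_mono[OF binomial_le_pow2])
    then have "\<bar>?c i\<bar> \<le> 2 ^ m" unfolding abs_mult power_abs by simp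
    moreover have "\<bar>?B i - ?A i\<bar> \<le> \<bar>?A i\<bar> + \<bar>?B i\<bar>"
      using abs_triangle_ineq4[of "?B i" "?A i"] by linarith
    ultimately have "\<bar>?c i\<bar> * \<bar>?B i - ?A i\<bar> \<le> 2 ^ m * (\<bar>?A i\<bar> + \<bar>?B i\<bar>)"
      by (rule mult_mono) auto
    then show "\<bar>?c i * (?B i - ?A i)\<bar> \<le> 2 ^ m * (\<bar>?A i\<bar> + \<bar>?B i\<bar>)"
      by (simp only: abs_mult)
  qed
  finally show ?thesis by (simp add: sum_distrib_left)
qed

text \<open>A crude form of convexity, with the maximal summand in place of the mean.\<close>
lemma powr_sum_le:
  fixes a :: "'i \<Rightarrow> real"
  assumes "finite S" "\<And>i. i \<in> S \<Longrightarrow> a i \<ge> 0" "p \<ge> 1"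
  shows "(\<Sum>i\<in>S. a i) powr p \<le> real (card S) powr p * (\<Sum>i\<in>S. a i powr p)"
proof (cases "S = {}")
  case False
  define b where "b = Max (a ` S)"
  have b: "b \<in> a ` S" "\<And>i. i \<in> S \<Longrightarrow> a i \<le> b"
    using assms(1) False by (auto simp: b_def)
  then have b0: "0 \<le> b" using assms(2) by auto
  have "(\<Sum>i\<in>S. a i) \<le> real (card S) * b"
    using sum_bounded_above[of S a b] b by simp
  then have "(\<Sum>i\<in>S. a i) powr p \<le> (real (card S) * b) powr p"
    using assms by (intro powr_mono2) (auto intro: sum_nonneg)
  also have "\<dots> = real (card S) powr p * b powr p" using b0 by (simp add: powr_mult)
  also have "b powr p \<le> (\<Sum>i\<in>S. a i powr p)"
    using b(1) assms(1) by (auto intro: member_le_sum)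
  finally show ?thesis by (simp add: mult_left_mono)
qed simp

text \<open>The sum type indexes the \<open>2 m\<close> summands of abs_fdiff_le by one set.\<close>
lemma powr_abs_fdiff_le:
  assumes m: "m > 0" and p: "p \<ge> 1"
  shows "\<bar>(fdiff h ^^ m) f x\<bar> powr p \<le> (2 ^ m * (2 * real m)) powr p * (\<Sum>i=1..m.
    \<bar>(fdiff (h + (real i / real m) *\<^sub>R k) ^^ m) f x\<bar> powr p +
    \<bar>(fdiff ((real i / real m) *\<^sub>R k) ^^ m) f (x + real i *\<^sub>R h)\<bar> powr p)"
proof -
  let ?A = "\<lambda>i. \<bar>(fdiff (h + (real i / real m) *\<^sub>R k) ^^ m) f x\<bar>"
  let ?B = "\<lambda>i. \<bar>(fdiff ((real i / real m) *\<^sub>R k) ^^ m) f (x + real i *\<^sub>R h)\<bar>"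
  let ?S = "{1..m} <+> {1..m}"
  let ?a = "case_sum ?A ?B"
  have "\<bar>(fdiff h ^^ m) f x\<bar> powr p \<le> (2 ^ m * (\<Sum>i\<in>?S. ?a i)) powr p"
    using abs_fdiff_le[OF m, of h f x k] p by (intro powr_mono2) (auto simp: sum.Plus sum.distrib)
  also have "\<dots> = (2 ^ m) powr p * (\<Sum>i\<in>?S. ?a i) powr p"
    by (subst powr_mult) (auto intro!: sum_nonneg split: sum.splits)
  also have "\<dots> \<le> (2 ^ m) powr p * (real (card ?S) powr p * (\<Sum>i\<in>?S. ?a i powr p))"
    using p by (intro mult_left_mono powr_sum_le) (auto split: sum.splits)
  also have "\<dots> = (2 ^ m * (2 * real m)) powr p * (\<Sum>i=1..m. ?A i powr p + ?B i powr p)"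
    by (simp add: powr_mult sum.Plus sum.distrib card_Plus)
  finally show ?thesis .
qed

lemma borel_measurable_fdiff_funpow[measurable]:
  fixes g :: "real^'n \<Rightarrow> real"
  assumes [measurable]: "g \<in> borel_measurable borel"
  shows "(\<lambda>(h, x). (fdiff h ^^ m) g x) \<in> borel_measurable (borel \<Otimes>\<^sub>M borel)"
  unfolding fdiff_funpow_eq by measurable

lemma Lp_norm_pow_lborel: "Lp_norm_pow p f = (\<integral>\<^sup>+x. ennreal (\<bar>f x\<bar> powr p) \<partial>lborel)"
  by (simp add: Lp_norm_pow_def nn_integral_completion)

lemma nn_integral_lebesgue_shift: "(\<integral>\<^sup>+x. \<psi> (x + b) \<partial>lebesgue) = (\<integral>\<^sup>+x. \<psi> x \<partial>lebesgue)"
  for \<psi> :: "real^'n \<Rightarrow> ennreal"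
  using nn_integral_lebesgue_unimodular[of "mat 1" \<psi> b] by simp

lemma AE_lebesgue_shift: "AE x in lebesgue. P x \<Longrightarrow> AE x in lebesgue. P (x + b)"
  for P :: "real^'n \<Rightarrow> bool"
  using AE_lebesgue_unimodular[of "mat 1" P b] by simp

lemma Lp_norm_pow_shift: "Lp_norm_pow p (\<lambda>x. f (x + b)) = Lp_norm_pow p f"
  unfolding Lp_norm_pow_def by (rule nn_integral_lebesgue_shift)

lemma Lp_norm_pow_fdiff_subadditive:
  fixes f :: "real^'n \<Rightarrow> real"
  assumes m: "m > 0" and p: "p \<ge> 1" and [measurable]: "f \<in> borel_measurable borel"
  shows "Lp_norm_pow p ((fdiff h ^^ m) f) \<le> ennreal ((2 ^ m * (2 * real m)) powr p) * (\<Sum>i=1..m.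
    Lp_norm_pow p ((fdiff (h + (real i / real m) *\<^sub>R k) ^^ m) f) +
    Lp_norm_pow p ((fdiff ((real i / real m) *\<^sub>R k) ^^ m) f))"
proof -
  let ?A = "\<lambda>i x. \<bar>(fdiff (h + (real i / real m) *\<^sub>R k) ^^ m) f x\<bar> powr p"
  let ?B = "\<lambda>i x. \<bar>(fdiff ((real i / real m) *\<^sub>R k) ^^ m) f (x + real i *\<^sub>R h)\<bar> powr p"
  have "Lp_norm_pow p ((fdiff h ^^ m) f) \<le>
    (\<integral>\<^sup>+x. ennreal ((2 ^ m * (2 * real m)) powr p) * (\<Sum>i=1..m. ennreal (?A i x) + ennreal (?B i x)) \<partial>lborel)"
    unfolding Lp_norm_pow_lborel
  proof (rule nn_integral_mono)
    fix x
    have "(\<Sum>i=1..m. ennreal (?A i x) + ennreal (?B i x)) = (\<Sum>i=1..m. ennreal (?A i x + ?B i x))"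
      by (intro sum.cong refl ennreal_plus[symmetric]) simp_all
    also have "\<dots> = ennreal (\<Sum>i=1..m. ?A i x + ?B i x)"
      by (intro sum_ennreal) simp
    finally have "ennreal ((2 ^ m * (2 * real m)) powr p) * (\<Sum>i=1..m. ennreal (?A i x) + ennreal (?B i x)) =
      ennreal ((2 ^ m * (2 * real m)) powr p * (\<Sum>i=1..m. ?A i x + ?B i x))"
      by (simp only: ennreal_mult'[OF powr_ge_zero])
    then show "ennreal (\<bar>(fdiff h ^^ m) f x\<bar> powr p) \<le>
      ennreal ((2 ^ m * (2 * real m)) powr p) * (\<Sum>i=1..m. ennreal (?A i x) + ennreal (?B i x))"
      using powr_abs_fdiff_le[OF m p, of h f x k] by (simp add: ennreal_leI)
  qed
  also have "\<dots> = ennreal ((2 ^ m * (2 * real m)) powr p) * (\<Sum>i=1..m. (\<integral>\<^sup>+x. ennreal (?A i x) \<partial>lborel) + (\<integral>\<^sup>+x. ennreal (?B i x) \<partial>lborel))"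
    by (simp add: nn_integral_cmult nn_integral_sum nn_integral_add)
  also have "\<dots> = ennreal ((2 ^ m * (2 * real m)) powr p) * (\<Sum>i=1..m.
    Lp_norm_pow p ((fdiff (h + (real i / real m) *\<^sub>R k) ^^ m) f) +
    Lp_norm_pow p (\<lambda>x. (fdiff ((real i / real m) *\<^sub>R k) ^^ m) f (x + real i *\<^sub>R h)))"
    unfolding Lp_norm_pow_lborel ..
  finally show ?thesis unfolding Lp_norm_pow_shift .
qed

text \<open>A difference involves only finitely many translates, and translates of null sets are null.\<close>
lemma AE_fdiff_cong:
  fixes f g :: "real^'n \<Rightarrow> real"
  assumes "AE x in lebesgue. f x = g x"
  shows "AE x in lebesgue. (fdiff h ^^ m) f x = (fdiff h ^^ m) g x"
proof -
  have "AE x in lebesgue. \<forall>i. f (x + real i *\<^sub>R h) = g (x + real i *\<^sub>R h)"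
    unfolding AE_all_countable using AE_lebesgue_shift[OF assms] by blast
  then show ?thesis
    by eventually_elim (simp add: fdiff_funpow_eq)
qed

lemma Lp_norm_pow_cong:
  "AE x in lebesgue. f x = g x \<Longrightarrow> Lp_norm_pow p f = Lp_norm_pow p g"
  unfolding Lp_norm_pow_def by (intro nn_integral_cong_AE) auto

text \<open>At almost every point \<open>x\<close> of the ball the translates \<open>f (x + i h)\<close> with \<open>i \<ge> 1\<close> vanish, because
\<open>\<bar>x + i h\<bar> \<ge> \<bar>h\<bar> - \<bar>x\<bar> > R\<close>; so the difference is \<open>\<plusminus>f x\<close> there.\<close>
lemma Lp_norm_pow_le_fdiff:
  fixes f :: "real^'n \<Rightarrow> real"
  assumes supp: "supported_in_ball R f" and h: "norm h \<ge> 2 * R" and R: "R > 0" and p: "p \<ge> 1"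
  shows "Lp_norm_pow p f \<le> Lp_norm_pow p ((fdiff h ^^ m) f)"
  unfolding Lp_norm_pow_def
proof (rule nn_integral_mono_AE)
  have "AE x in lebesgue. \<forall>i. x + real i *\<^sub>R h \<notin> ball 0 R \<longrightarrow> f (x + real i *\<^sub>R h) = 0"
    unfolding AE_all_countable using AE_lebesgue_shift[OF supp[unfolded supported_in_ball_def]] by blast
  then show "AE x in lebesgue. ennreal (\<bar>f x\<bar> powr p) \<le> ennreal (\<bar>(fdiff h ^^ m) f x\<bar> powr p)"
  proof eventually_elim
    case (elim x)
    show ?case
    proof (cases "x \<in> ball 0 R")
      case True
      have "f (x + real i *\<^sub>R h) = 0" if "i > 0" for i
      proof -
        have "1 * (2 * R) \<le> real i * norm h"
          using that h R by (intro mult_mono) auto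
        then have "2 * R \<le> norm (real i *\<^sub>R h)" by simp
        also have "\<dots> \<le> norm (x + real i *\<^sub>R h) + norm x"
          using norm_triangle_ineq4[of "x + real i *\<^sub>R h" x] by simp
        finally have "x + real i *\<^sub>R h \<notin> ball 0 R" using True by simp
        then show ?thesis using elim by blast
      qed
      then have "(fdiff h ^^ m) f x = (\<Sum>i\<le>m. if i = 0 then (-1) ^ m * f x else 0)"
        unfolding fdiff_funpow_eq by (intro sum.cong) auto
      then show ?thesis by (simp add: abs_mult)
    next
      case False
      then have "f x = 0" using elim[rule_format, of 0] by simp
      then show ?thesis using p by simp
    qed
  qed
qed

section \<open>Seminorms of integer order\<close>

definition weak_partial :: "'n \<Rightarrow> (real^'n \<Rightarrow> real) \<Rightarrow> (real^'n \<Rightarrow> real) \<Rightarrow> bool" where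
  "weak_partial j F G \<longleftrightarrow> F \<in> L1_loc \<and> G \<in> L1_loc \<and>
    (\<forall>\<phi>\<in>test_functions. (LINT x|lebesgue. F x * partial_deriv j \<phi> x) = - (LINT x|lebesgue. G x * \<phi> x))"

lemma L1_loc_shift:
  fixes F :: "real^'n \<Rightarrow> real"
  shows "F \<in> L1_loc \<Longrightarrow> (\<lambda>x. F (x + b)) \<in> L1_loc"
  using L1_loc_unimodular[of F "mat 1" b] by simp

lemma L1_loc_fdiff:
  fixes F :: "real^'n \<Rightarrow> real"
  shows "F \<in> L1_loc \<Longrightarrow> fdiff h F \<in> L1_loc"
  unfolding fdiff_def by (intro L1_loc_diff L1_loc_shift)

lemma integral_fdiff_test:
  fixes F :: "real^'n \<Rightarrow> real"
  assumes F: "F \<in> L1_loc" and \<phi>: "\<phi> \<in> test_functions"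
  shows "(LINT x|lebesgue. fdiff h F x * \<phi> x) =
    (LINT x|lebesgue. F x * \<phi> (x + - h)) - (LINT x|lebesgue. F x * \<phi> x)"
proof -
  have i: "integrable lebesgue (\<lambda>x. F x * \<phi> (x + - h))"
    by (rule integrable_L1_loc_test[OF F test_functions_shift[OF \<phi>]])
  have "(LINT x|lebesgue. fdiff h F x * \<phi> x) = (LINT x|lebesgue. F (x + h) * \<phi> x - F x * \<phi> x)"
    by (simp add: fdiff_def left_diff_distrib)
  also have "\<dots> = (LINT x|lebesgue. F (x + h) * \<phi> x) - (LINT x|lebesgue. F x * \<phi> x)"
    by (intro Bochner_Integration.integral_diff integrable_L1_loc_test F L1_loc_shift \<phi>)
  also have "(LINT x|lebesgue. F (x + h) * \<phi> x) = (LINT x|lebesgue. F x * \<phi> (x + - h))"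
    using integral_lebesgue_unimodular[OF _ borel_measurable_integrable[OF i], of "mat 1" h] by simp
  finally show ?thesis .
qed

lemma weak_partial_fdiff:
  assumes "weak_partial j F G"
  shows "weak_partial j (fdiff h F) (fdiff h G)"
  unfolding weak_partial_def
proof (intro conjI ballI)
  have FG: "F \<in> L1_loc" "G \<in> L1_loc"
    and w: "\<And>\<phi>. \<phi> \<in> test_functions \<Longrightarrow> (LINT x|lebesgue. F x * partial_deriv j \<phi> x) = - (LINT x|lebesgue. G x * \<phi> x)"
    using assms by (auto simp: weak_partial_def)
  show "fdiff h F \<in> L1_loc" "fdiff h G \<in> L1_loc" using FG by (auto intro: L1_loc_fdiff)
  fix \<phi> :: "real^'a \<Rightarrow> real" assume \<phi>: "\<phi> \<in> test_functions"
  have sh: "partial_deriv j (\<lambda>x. \<phi> (x + - h)) = (\<lambda>x. partial_deriv j \<phi> (x + - h))"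
    using partial_derivs_shift[of \<phi> "[j]" "- h"] \<phi>
    unfolding test_functions_iff partial_derivs.simps by blast
  have s: "(\<lambda>x. \<phi> (x + - h)) \<in> test_functions" by (rule test_functions_shift[OF \<phi>])
  have "(LINT x|lebesgue. fdiff h F x * partial_deriv j \<phi> x) =
    (LINT x|lebesgue. F x * partial_deriv j \<phi> (x + - h)) - (LINT x|lebesgue. F x * partial_deriv j \<phi> x)"
    by (rule integral_fdiff_test[OF FG(1) test_functions_partial_deriv[OF \<phi>]])
  also have "\<dots> = - (LINT x|lebesgue. G x * \<phi> (x + - h)) + (LINT x|lebesgue. G x * \<phi> x)"
    using w[OF s] w[OF \<phi>] unfolding sh by linarith
  also have "\<dots> = - (LINT x|lebesgue. fdiff h G x * \<phi> x)"
    unfolding integral_fdiff_test[OF FG(2) \<phi>] by linarith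
  finally show "(LINT x|lebesgue. fdiff h F x * partial_deriv j \<phi> x) = - (LINT x|lebesgue. fdiff h G x * \<phi> x)" .
qed

text \<open>The increment is an integral of \<open>G\<close> over a segment of length \<open>r\<close>.  Jensen's inequality bounds its
\<open>p\<close>-th power by \<open>r powr (p - 1)\<close> times an integral over \<open>u\<close> of translates of \<open>\<bar>G\<bar> powr p\<close>, and these
all have the same integral over \<open>x\<close>.\<close>
lemma Lp_norm_pow_fdiff_le:
  fixes F G :: "real^'n \<Rightarrow> real"
  assumes FG: "weak_partial j F G" and r: "r > 0" and p: "p \<ge> 1"
  shows "Lp_norm_pow p (fdiff (r *\<^sub>R axis j 1) F) \<le> ennreal (r powr p) * Lp_norm_pow p G"
proof -
  let ?e = "axis j 1 :: real^'n"
  have L: "F \<in> L1_loc" "G \<in> L1_loc"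
    and w: "\<And>\<phi>. \<phi> \<in> test_functions \<Longrightarrow> (LINT x|lebesgue. F x * partial_deriv j \<phi> x) = - (LINT x|lebesgue. G x * \<phi> x)"
    using FG by (auto simp: weak_partial_def)
  obtain F' where F': "F' \<in> borel_measurable borel" "AE x in lebesgue. F x = F' x"
    "F' \<in> L1_loc" "\<And>C. compact C \<Longrightarrow> integrable lborel (\<lambda>x. indicator C x * F' x)"
    using L1_loc_borel_representative[OF L(1)] by blast
  obtain G' where G': "G' \<in> borel_measurable borel" "AE x in lebesgue. G x = G' x"
    "G' \<in> L1_loc" "\<And>C. compact C \<Longrightarrow> integrable lborel (\<lambda>x. indicator C x * G' x)"
    using L1_loc_borel_representative[OF L(2)] by blast
  note [measurable] = F'(1) G'(1)
  have transfer: "(LINT x|lborel. f' x * \<psi> x) = (LINT x|lebesgue. f x * \<psi> x)"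
    if "f \<in> L1_loc" "f' \<in> L1_loc" "AE x in lebesgue. f x = f' x" "f' \<in> borel_measurable borel" "\<psi> \<in> test_functions"
    for f f' \<psi> :: "real^'n \<Rightarrow> real"
  proof -
    have "(LINT x|lborel. f' x * \<psi> x) = (LINT x|lebesgue. f' x * \<psi> x)"
      using that(4) test_function_borel[OF that(5)] by (intro integral_completion[symmetric]) simp
    also have "\<dots> = (LINT x|lebesgue. f x * \<psi> x)"
      by (rule integral_cong_AE[OF borel_measurable_integrable[OF integrable_L1_loc_test[OF that(2,5)]]
            borel_measurable_integrable[OF integrable_L1_loc_test[OF that(1,5)]]])
        (use that(3) in auto)
    finally show ?thesis .
  qed
  have weak': "(LINT x|lborel. F' x * partial_deriv j \<phi> x) = - (LINT x|lborel. G' x * \<phi> x)"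
    if \<phi>: "\<phi> \<in> test_functions" for \<phi>
    using w[OF \<phi>] transfer[OF L(1) F'(3,2,1) test_functions_partial_deriv[OF \<phi>]] transfer[OF L(2) G'(3,2,1) \<phi>]
    by simp
  let ?H = "\<lambda>x. LINT u|lborel. indicator {0..r} u * G' (x + u *\<^sub>R ?e)"
  have "AE x in lebesgue. F' (x + r *\<^sub>R ?e) - F' x = ?H x"
    by (rule AE_completion[OF weak_deriv_increment[OF F'(1) G'(1) F'(4) G'(4) weak' r]])
  then have "AE x in lebesgue. fdiff (r *\<^sub>R ?e) F x = ?H x"
    using F'(2) AE_lebesgue_shift[OF F'(2), of "r *\<^sub>R ?e"]
    by eventually_elim (simp add: fdiff_def)
  then have "Lp_norm_pow p (fdiff (r *\<^sub>R ?e) F) = Lp_norm_pow p ?H" by (rule Lp_norm_pow_cong)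
  also have "\<dots> \<le> (\<integral>\<^sup>+x. ennreal (r powr (p - 1)) * (\<integral>\<^sup>+u. ennreal (indicator {0..r} u * \<bar>G' (x + u *\<^sub>R ?e)\<bar> powr p) \<partial>lborel) \<partial>lborel)"
    unfolding Lp_norm_pow_lborel by (intro nn_integral_mono powr_average_le r p) measurable
  also have "\<dots> = ennreal (r powr (p - 1)) * (\<integral>\<^sup>+x. \<integral>\<^sup>+u. ennreal (indicator {0..r} u * \<bar>G' (x + u *\<^sub>R ?e)\<bar> powr p) \<partial>lborel \<partial>lborel)"
    by (rule nn_integral_cmult) measurable
  also have "(\<integral>\<^sup>+x. \<integral>\<^sup>+u. ennreal (indicator {0..r} u * \<bar>G' (x + u *\<^sub>R ?e)\<bar> powr p) \<partial>lborel \<partial>lborel) =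
    (\<integral>\<^sup>+u. \<integral>\<^sup>+x. ennreal (indicator {0..r} u * \<bar>G' (x + u *\<^sub>R ?e)\<bar> powr p) \<partial>lborel \<partial>lborel)"
    by (rule lborel_pair.Fubini') measurable
  also have "\<dots> = (\<integral>\<^sup>+u. indicator {0..r} u * Lp_norm_pow p G' \<partial>lborel)"
  proof (rule nn_integral_cong)
    fix u :: real
    have "(\<integral>\<^sup>+x. ennreal (indicator {0..r} u * \<bar>G' (x + u *\<^sub>R ?e)\<bar> powr p) \<partial>lborel) =
      (\<integral>\<^sup>+x. indicator {0..r} u * ennreal (\<bar>G' (x + u *\<^sub>R ?e)\<bar> powr p) \<partial>lborel)"
      by (intro nn_integral_cong) (simp add: indicator_def)
    also have "\<dots> = indicator {0..r} u * (\<integral>\<^sup>+x. ennreal (\<bar>G' (x + u *\<^sub>R ?e)\<bar> powr p) \<partial>lborel)"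
      by (rule nn_integral_cmult) measurable
    also have "(\<integral>\<^sup>+x. ennreal (\<bar>G' (x + u *\<^sub>R ?e)\<bar> powr p) \<partial>lborel) = Lp_norm_pow p G'"
      using Lp_norm_pow_shift[of p G' "u *\<^sub>R ?e"] by (simp add: Lp_norm_pow_lborel)
    finally show "(\<integral>\<^sup>+x. ennreal (indicator {0..r} u * \<bar>G' (x + u *\<^sub>R ?e)\<bar> powr p) \<partial>lborel) = indicator {0..r} u * Lp_norm_pow p G'" .
  qed
  also have "\<dots> = ennreal r * Lp_norm_pow p G'"
    using r by (simp add: nn_integral_multc emeasure_lborel_Icc_eq)
  also have "Lp_norm_pow p G' = Lp_norm_pow p G"
    using G'(2) by (intro Lp_norm_pow_cong) auto
  also have "ennreal (r powr (p - 1)) * (ennreal r * Lp_norm_pow p G) = ennreal (r powr p) * Lp_norm_pow p G"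
    using r by (simp add: mult.assoc[symmetric] ennreal_mult[symmetric] powr_mult_base[symmetric] powr_diff)
  finally show ?thesis .
qed

text \<open>Differences commute with weak derivatives, so the order of differences can be traded one by one
for the order of derivatives.\<close>
lemma Lp_norm_pow_fdiff_funpow_le:
  fixes F :: "nat \<Rightarrow> real^'n \<Rightarrow> real"
  assumes r: "r > 0" and p: "p \<ge> 1" and "\<And>i. i < k \<Longrightarrow> weak_partial j (F i) (F (Suc i))"
  shows "Lp_norm_pow p ((fdiff (r *\<^sub>R axis j 1) ^^ k) (F 0)) \<le> ennreal ((r ^ k) powr p) * Lp_norm_pow p (F k)"
  using assms(3)
proof (induction k arbitrary: F)
  case (Suc k)
  let ?\<Delta> = "fdiff (r *\<^sub>R axis j 1) :: (real^'n \<Rightarrow> real) \<Rightarrow> _"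
  have "Lp_norm_pow p ((?\<Delta> ^^ k) (?\<Delta> (F 0))) \<le> ennreal ((r ^ k) powr p) * Lp_norm_pow p (?\<Delta> (F k))"
    by (rule Suc.IH) (use Suc.prems in \<open>auto intro: weak_partial_fdiff\<close>)
  also have "\<dots> \<le> ennreal ((r ^ k) powr p) * (ennreal (r powr p) * Lp_norm_pow p (F (Suc k)))"
    using Suc.prems by (intro mult_left_mono Lp_norm_pow_fdiff_le[where j=j] r p) auto
  also have "\<dots> = ennreal ((r ^ Suc k) powr p) * Lp_norm_pow p (F (Suc k))"
    using r by (simp add: mult.assoc[symmetric] ennreal_mult[symmetric] powr_mult mult.commute)
  finally show ?case by (simp add: funpow_Suc_right del: funpow.simps)
qed simp

text \<open>The pure derivative of order \<open>k\<close> along \<open>e\<^sub>j\<close> is the value of the derivative form at \<open>(e\<^sub>j, \<dots>, e\<^sub>j)\<close>, hence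
bounded by its norm.\<close>
lemma Lp_norm_pow_fdiff_le_form_norm:
  fixes F :: "real^'n \<Rightarrow> real"
  assumes F: "F \<in> W1_loc k" and r: "r > 0" and p: "p \<ge> 1"
  shows "Lp_norm_pow p ((fdiff (r *\<^sub>R axis j 1) ^^ k) F) \<le>
    ennreal ((r ^ k) powr p) * (\<integral>\<^sup>+x. ennreal (form_norm k (deriv_form k F x) powr p) \<partial>lebesgue)"
proof -
  have FL: "F \<in> L1_loc" using F by (simp add: W1_loc_def)
  \<comment> \<open>for \<open>i = 0\<close> the chosen weak derivative agrees with \<open>F\<close> only almost everywhere, so \<open>F\<close> itself is taken\<close>
  define G where "G i = (if i = 0 then F else weak_deriv (replicate i j) F)" for i
  have G: "has_weak_deriv (replicate i j) F (G i)" if "i \<le> k" for i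
  proof (cases "i = 0")
    case True
    then show ?thesis using FL by (simp add: G_def has_weak_deriv_def)
  next
    case False
    have "\<exists>g. has_weak_deriv (replicate i j) F g"
      using F that by (simp add: W1_loc_def)
    then show ?thesis using False has_weak_deriv_weak_deriv by (auto simp: G_def)
  qed
  have "weak_partial j (G i) (G (Suc i))" if "i < k" for i
    unfolding weak_partial_def
  proof (intro conjI ballI)
    have Gi: "has_weak_deriv (replicate i j) F (G i)" "has_weak_deriv (replicate (Suc i) j) F (G (Suc i))"
      using G[of i] G[of "Suc i"] that by auto
    then show "G i \<in> L1_loc" "G (Suc i) \<in> L1_loc" by (auto simp: has_weak_deriv_def)
    fix \<phi> :: "real^'n \<Rightarrow> real" assume \<phi>: "\<phi> \<in> test_functions"
    have "partial_derivs (replicate i j) (partial_deriv j \<phi>) = partial_derivs (replicate (Suc i) j) \<phi>"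
      using partial_derivs_append[of "replicate i j" "[j]" \<phi>] by (simp add: replicate_append_same)
    moreover have "(LINT x|lebesgue. F x * partial_derivs (replicate i j) (partial_deriv j \<phi>) x) =
       (-1) ^ i * (LINT x|lebesgue. G i x * partial_deriv j \<phi> x)"
      using Gi(1) test_functions_partial_deriv[OF \<phi>, of j] unfolding has_weak_deriv_def by fastforce
    moreover have "(LINT x|lebesgue. F x * partial_derivs (replicate (Suc i) j) \<phi> x) =
       (-1) ^ Suc i * (LINT x|lebesgue. G (Suc i) x * \<phi> x)"
      using Gi(2) \<phi> unfolding has_weak_deriv_def by fastforce
    ultimately have "(-1) ^ i * (LINT x|lebesgue. G i x * partial_deriv j \<phi> x) = (-1) ^ i * - (LINT x|lebesgue. G (Suc i) x * \<phi> x)"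
      by simp
    then show "(LINT x|lebesgue. G i x * partial_deriv j \<phi> x) = - (LINT x|lebesgue. G (Suc i) x * \<phi> x)"
      unfolding mult_cancel_left by simp
  qed
  then have "Lp_norm_pow p ((fdiff (r *\<^sub>R axis j 1) ^^ k) (G 0)) \<le> ennreal ((r ^ k) powr p) * Lp_norm_pow p (G k)"
    by (intro Lp_norm_pow_fdiff_funpow_le r p)
  also have "Lp_norm_pow p (G k) = Lp_norm_pow p (weak_deriv (replicate k j) F)"
  proof (rule Lp_norm_pow_cong)
    show "AE x in lebesgue. G k x = weak_deriv (replicate k j) F x"
      by (rule weak_deriv_unique[OF G[OF order_refl] has_weak_deriv_weak_deriv[OF G[OF order_refl]]])
  qed
  also have "\<dots> \<le> (\<integral>\<^sup>+x. ennreal (form_norm k (deriv_form k F x) powr p) \<partial>lebesgue)"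
    unfolding Lp_norm_pow_def
  proof (intro nn_integral_mono ennreal_leI powr_mono2)
    fix x
    show "\<bar>weak_deriv (replicate k j) F x\<bar> \<le> form_norm k (deriv_form k F x)"
      using multiform_le_form_norm[of k "\<lambda>_. axis j 1" "\<lambda>I. weak_deriv I F x"]
      by (simp add: deriv_form_eq_multiform multiform_axis)
  qed (use p in auto)
  finally show ?thesis by (simp add: G_def mult_left_mono)
qed

lemma W1_loc_has_weak_deriv:
  assumes "f \<in> W1_loc k" "length J \<le> k"
  shows "has_weak_deriv J f (weak_deriv J f)"
proof -
  obtain g where "has_weak_deriv J f g" using assms unfolding W1_loc_def by blast
  then show ?thesis by (rule has_weak_deriv_weak_deriv)
qed

lemma W1_loc_SL:
  fixes f :: "real^'n \<Rightarrow> real"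
  assumes f: "f \<in> W1_loc k" and T: "det T = 1"
  shows "(\<lambda>x. f (T *v x)) \<in> W1_loc k"
proof -
  have L: "f \<in> L1_loc" using f by (simp add: W1_loc_def)
  have "has_weak_deriv I (\<lambda>x. f (T *v x)) (\<lambda>x. \<Sum>J | length J = length I. deriv_coeff T J I * weak_deriv J f (T *v x))"
    if "length I \<le> k" for I
    using f that by (intro has_weak_deriv_SL L T W1_loc_has_weak_deriv) auto
  then show ?thesis
    using L1_loc_unimodular[OF L, of T 0] T unfolding W1_loc_def by auto
qed

text \<open>The chosen weak derivatives of \<open>f \<circ> T\<close> agree almost everywhere with those produced by the chain
rule; summing over all \<open>I\<close> collects the coefficients of \<open>T\<close> into the vectors \<open>T (v j)\<close>.\<close>
lemma deriv_form_SL: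
  fixes f :: "real^'n \<Rightarrow> real"
  assumes f: "f \<in> W1_loc k" and T: "det T = 1"
  shows "AE x in lebesgue. \<forall>v. deriv_form k (\<lambda>x. f (T *v x)) x v = deriv_form k f (T *v x) (\<lambda>j. T *v v j)"
proof -
  have L: "f \<in> L1_loc" using f by (simp add: W1_loc_def)
  let ?G = "\<lambda>I x. \<Sum>J | length J = length I. deriv_coeff T J I * weak_deriv J f (T *v x)"
  have "has_weak_deriv I (\<lambda>x. f (T *v x)) (?G I)" if "length I = k" for I
    using f that by (intro has_weak_deriv_SL L T W1_loc_has_weak_deriv) auto
  then have "AE x in lebesgue. weak_deriv I (\<lambda>x. f (T *v x)) x = ?G I x" if "length I = k" for I
    using that weak_deriv_unique has_weak_deriv_weak_deriv by blast
  then have "AE x in lebesgue. \<forall>I\<in>{I. length I = k}. weak_deriv I (\<lambda>x. f (T *v x)) x = ?G I x"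
    by (intro AE_finite_allI finite_lists_of_length) auto
  then show ?thesis
  proof eventually_elim
    case (elim x)
    show ?case
    proof
      fix v :: "nat \<Rightarrow> real^'n"
      have "deriv_form k (\<lambda>x. f (T *v x)) x v =
        (\<Sum>I | length I = k. (\<Sum>J | length J = k. deriv_coeff T J I * weak_deriv J f (T *v x)) * (\<Prod>j<k. v j $ (I ! j)))"
        unfolding deriv_form_def using elim by (intro sum.cong) auto
      also have "\<dots> = (\<Sum>I | length I = k. \<Sum>J | length J = k. weak_deriv J f (T *v x) * (\<Prod>j<k. T $ (J ! j) $ (I ! j) * v j $ (I ! j)))"
        by (intro sum.cong refl) (auto simp: sum_distrib_left deriv_coeff_def prod.distrib mult_ac)
      also have "\<dots> = (\<Sum>J | length J = k. weak_deriv J f (T *v x) * (\<Sum>I | length I = k. \<Prod>j<k. T $ (J ! j) $ (I ! j) * v j $ (I ! j)))"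
        by (subst sum.swap) (simp add: sum_distrib_left)
      also have "\<dots> = (\<Sum>J | length J = k. weak_deriv J f (T *v x) * (\<Prod>j<k. (T *v v j) $ (J ! j)))"
        using sum_lists_prod[of "\<lambda>j i. T $ (J ! j) $ i * v j $ i" k for J]
        by (simp add: matrix_vector_mult_def)
      finally show "deriv_form k (\<lambda>x. f (T *v x)) x v = deriv_form k f (T *v x) (\<lambda>j. T *v v j)"
        by (simp add: deriv_form_def)
    qed
  qed
qed

text \<open>Substitute \<open>x \<mapsto> T x\<close> on the left and use the chain rule at almost every \<open>x\<close>, read backwards: the
form of \<open>f\<close> at \<open>T x\<close> is that of \<open>f \<circ> T\<close> at \<open>x\<close> with \<open>T\<^sup>-\<^sup>1\<close> in each argument.\<close>
lemma nn_integral_form_norm_SL_le: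
  fixes f :: "real^'n \<Rightarrow> real"
  assumes f: "f \<in> W1_loc k" and T: "det T = 1" and p: "p \<ge> 1"
    and a: "a > 0" "\<And>x. norm x \<le> a * norm (T *v x)"
  shows "(\<integral>\<^sup>+x. ennreal (form_norm k (deriv_form k f x) powr p) \<partial>lebesgue) \<le>
    ennreal ((a ^ k) powr p) * (\<integral>\<^sup>+x. ennreal (form_norm k (deriv_form k (\<lambda>x. f (T *v x)) x) powr p) \<partial>lebesgue)"
proof -
  have "det T \<noteq> 0" using T by simp
  then obtain B where B: "T ** B = mat 1" "B ** T = mat 1"
    unfolding invertible_det_nz[symmetric] invertible_def by blast
  have Bn: "norm (B *v u) \<le> a * norm u" for u
    using a(2)[of "B *v u"] B by (simp add: matrix_vector_mul_assoc)
  have "(\<integral>\<^sup>+x. ennreal (form_norm k (deriv_form k f x) powr p) \<partial>lebesgue) =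
    (\<integral>\<^sup>+x. ennreal (form_norm k (deriv_form k f (T *v x)) powr p) \<partial>lebesgue)"
    using nn_integral_lebesgue_unimodular[of T "\<lambda>x. ennreal (form_norm k (deriv_form k f x) powr p)" 0] T by simp
  also have "\<dots> \<le> (\<integral>\<^sup>+x. ennreal ((a ^ k) powr p) * ennreal (form_norm k (deriv_form k (\<lambda>x. f (T *v x)) x) powr p) \<partial>lebesgue)"
  proof (rule nn_integral_mono_AE)
    show "AE x in lebesgue. ennreal (form_norm k (deriv_form k f (T *v x)) powr p) \<le>
      ennreal ((a ^ k) powr p) * ennreal (form_norm k (deriv_form k (\<lambda>x. f (T *v x)) x) powr p)"
      using deriv_form_SL[OF f T]
    proof eventually_elim
      case (elim x)
      have "deriv_form k f (T *v x) v = deriv_form k (\<lambda>x. f (T *v x)) x (\<lambda>j. B *v v j)" for v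
        using elim B by (simp add: matrix_vector_mul_assoc)
      then have "form_norm k (deriv_form k f (T *v x)) \<le> a ^ k * form_norm k (deriv_form k (\<lambda>x. f (T *v x)) x)"
        unfolding deriv_form_eq_multiform by (intro form_norm_le_of_substitution[OF a(1) Bn])
      then have "form_norm k (deriv_form k f (T *v x)) powr p \<le> (a ^ k * form_norm k (deriv_form k (\<lambda>x. f (T *v x)) x)) powr p"
        using p by (intro powr_mono2) (auto simp: deriv_form_eq_multiform form_norm_nonneg)
      also have "\<dots> = (a ^ k) powr p * form_norm k (deriv_form k (\<lambda>x. f (T *v x)) x) powr p"
        by (rule powr_mult)
      finally show ?case by (simp add: ennreal_mult[symmetric] ennreal_leI)
    qed
  qed
  also have "\<dots> \<le> ennreal ((a ^ k) powr p) * (\<integral>\<^sup>+x. ennreal (form_norm k (deriv_form k (\<lambda>x. f (T *v x)) x) powr p) \<partial>lebesgue)"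
    by (rule nn_integral_cmult_le) (use a(1) in auto)
  finally show ?thesis .
qed

section \<open>Seminorms of fractional order\<close>

lemma sets_borel_cball[measurable]: "cball (a::'a::{real_normed_vector,second_countable_topology}) r \<in> sets borel"
  by (intro borel_closed closed_cball)

lemma powr_realpow_two: "(2::real) ^ n = 2 powr real n"
  by (simp add: powr_realpow)

text \<open>Dyadic decomposition: on the shell between the radii \<open>2 ^ n \<rho>\<close> and \<open>2 ^ Suc n \<rho>\<close> the integrand is at
most its value on the inner sphere, and the contributions of the shells form a geometric series
with ratio \<open>2 powr (N - \<beta>)\<close>.\<close>
lemma nn_integral_outside_ball_le:
  fixes \<beta> :: real
  assumes "\<beta> > real CARD('n::finite)"
  obtains c where "c > 0" "\<And>\<rho>. \<rho> > 0 \<Longrightarrow>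
    (\<integral>\<^sup>+h. indicator {h::real^'n. norm h \<ge> \<rho>} h * ennreal (norm h powr (- \<beta>)) \<partial>lborel)
      \<le> ennreal (c * \<rho> powr (real CARD('n) - \<beta>))"
proof -
  let ?N = "real CARD('n)"
  define \<omega> where "\<omega> = unit_ball_vol ?N"
  have \<omega>: "\<omega> > 0" by (simp add: \<omega>_def)
  define q where "q = 2 powr (?N - \<beta>)"
  have q: "0 < q" "q < 1" using assms by (auto simp: q_def powr_less_one)
  define c where "c = \<omega> * 2 powr ?N / (1 - q)"
  have "c > 0" using \<omega> q by (simp add: c_def)
  moreover have "(\<integral>\<^sup>+h. indicator {h::real^'n. norm h \<ge> \<rho>} h * ennreal (norm h powr (- \<beta>)) \<partial>lborel)
      \<le> ennreal (c * \<rho> powr (?N - \<beta>))" if \<rho>: "\<rho> > 0" for \<rho>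
  proof -
    let ?t = "\<lambda>n::nat. (2 ^ n * \<rho>) powr (- \<beta>)"
    have "(\<integral>\<^sup>+h. indicator {h::real^'n. norm h \<ge> \<rho>} h * ennreal (norm h powr (- \<beta>)) \<partial>lborel)
      \<le> (\<integral>\<^sup>+h. (\<Sum>n. ennreal (?t n) * indicator (cball (0::real^'n) (2 ^ Suc n * \<rho>)) h) \<partial>lborel)"
    proof (rule nn_integral_mono)
      fix h :: "real^'n"
      show "indicator {h. norm h \<ge> \<rho>} h * ennreal (norm h powr (- \<beta>)) \<le>
        (\<Sum>n. ennreal (?t n) * indicator (cball 0 (2 ^ Suc n * \<rho>)) h)"
      proof (cases "norm h \<ge> \<rho>")
        case True
        \<comment> \<open>the number of the dyadic shell that contains \<open>h\<close>\<close>
        define n where "n = nat \<lfloor>log 2 (norm h / \<rho>)\<rfloor>"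
        have pos: "norm h / \<rho> \<ge> 1" using True \<rho> by simp
        then have l0: "log 2 (norm h / \<rho>) \<ge> 0" by simp
        have n: "real n \<le> log 2 (norm h / \<rho>)" "log 2 (norm h / \<rho>) \<le> real (Suc n)"
          using l0 unfolding n_def by linarith+
        have "2 ^ n \<le> norm h / \<rho>" "norm h / \<rho> \<le> 2 ^ Suc n"
          using n pos unfolding powr_realpow_two by (auto simp: le_log_iff log_le_iff simp del: of_nat_Suc)
        then have *: "2 ^ n * \<rho> \<le> norm h" "norm h \<le> 2 ^ Suc n * \<rho>"
          using \<rho> by (simp_all add: field_simps)
        have "norm h powr (- \<beta>) \<le> ?t n"
          using * \<rho> assms by (intro powr_mono2') auto
        then have "indicator {h. norm h \<ge> \<rho>} h * ennreal (norm h powr (- \<beta>)) \<le> ennreal (?t n) * indicator (cball 0 (2 ^ Suc n * \<rho>)) h"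
          using True *(2) by (simp add: ennreal_leI)
        also have "\<dots> = (\<Sum>m\<in>{n}. ennreal (?t m) * indicator (cball 0 (2 ^ Suc m * \<rho>)) h)"
          by (subst sum.insert) (rule finite.emptyI, simp, simp only: sum.empty add_0_right)
        also have "\<dots> \<le> (\<Sum>n. ennreal (?t n) * indicator (cball 0 (2 ^ Suc n * \<rho>)) h)"
          by (rule sum_le_suminf) auto
        finally show ?thesis .
      qed simp
    qed
    also have "\<dots> = (\<Sum>n. \<integral>\<^sup>+h. ennreal (?t n) * indicator (cball (0::real^'n) (2 ^ Suc n * \<rho>)) h \<partial>lborel)"
    proof (rule nn_integral_suminf)
      fix n
      show "(\<lambda>h. ennreal (?t n) * indicator (cball (0::real^'n) (2 ^ Suc n * \<rho>)) h) \<in> borel_measurable lborel"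
        by (intro borel_measurable_times_ennreal borel_measurable_const borel_measurable_indicator) simp
    qed
    also have "\<dots> = (\<Sum>n. ennreal (\<omega> * 2 powr ?N * \<rho> powr (?N - \<beta>) * q ^ n))"
    proof (rule suminf_cong)
      fix n
      have "(\<integral>\<^sup>+h. ennreal (?t n) * indicator (cball (0::real^'n) (2 ^ Suc n * \<rho>)) h \<partial>lborel) =
        ennreal (?t n * (\<omega> * (2 ^ Suc n * \<rho>) ^ CARD('n)))"
        using \<rho> \<omega> by (simp add: nn_integral_cmult_indicator emeasure_cball \<omega>_def ennreal_mult)
      also have "?t n * (\<omega> * (2 ^ Suc n * \<rho>) ^ CARD('n)) = \<omega> * 2 powr ?N * \<rho> powr (?N - \<beta>) * q ^ n"
      proof -
        have "(2 ^ Suc n * \<rho>) ^ CARD('n) = (2 * (2 ^ n * \<rho>)) powr ?N"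
          using \<rho> by (simp add: powr_realpow mult.assoc)
        also have "\<dots> = 2 powr ?N * (2 ^ n * \<rho>) powr ?N"
          using \<rho> by (subst powr_mult) auto
        finally have "?t n * (\<omega> * (2 ^ Suc n * \<rho>) ^ CARD('n)) = \<omega> * 2 powr ?N * ((2 ^ n * \<rho>) powr (- \<beta>) * (2 ^ n * \<rho>) powr ?N)"
          by (simp add: mult_ac)
        also have "(2 ^ n * \<rho>) powr (- \<beta>) * (2 ^ n * \<rho>) powr ?N = (2 ^ n * \<rho>) powr (?N - \<beta>)"
          by (simp add: powr_add[symmetric])
        also have "\<dots> = q ^ n * \<rho> powr (?N - \<beta>)"
          using \<rho> by (simp add: powr_mult q_def powr_realpow_two powr_powr mult.commute flip: powr_realpow)
        finally show ?thesis by (simp add: mult_ac)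
      qed
      finally show "(\<integral>\<^sup>+h. ennreal (?t n) * indicator (cball (0::real^'n) (2 ^ Suc n * \<rho>)) h \<partial>lborel) =
        ennreal (\<omega> * 2 powr ?N * \<rho> powr (?N - \<beta>) * q ^ n)" .
    qed
    also have "\<dots> = ennreal (\<omega> * 2 powr ?N * \<rho> powr (?N - \<beta>) * (1 / (1 - q)))"
      using \<omega> q by (intro suminf_ennreal_eq sums_mult geometric_sums) auto
    also have "\<omega> * 2 powr ?N * \<rho> powr (?N - \<beta>) * (1 / (1 - q)) = c * \<rho> powr (?N - \<beta>)"
      by (simp add: c_def)
    finally show ?thesis .
  qed
  ultimately show ?thesis using that by blast
qed

lemma nn_integral_lborel_affine:
  fixes g :: "real^'n \<Rightarrow> ennreal"
  assumes "g \<in> borel_measurable borel" and c: "c > 0"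
  shows "(\<integral>\<^sup>+x. g (b + c *\<^sub>R x) \<partial>lborel) = ennreal ((1 / c) ^ CARD('n)) * (\<integral>\<^sup>+x. g x \<partial>lborel)"
proof -
  note [measurable] = assms(1)
  have "(\<integral>\<^sup>+x. g x \<partial>lborel) = (\<integral>\<^sup>+x. g x \<partial>density (distr lborel borel (\<lambda>x. b + c *\<^sub>R x)) (\<lambda>_. \<bar>c\<bar>^DIM(real^'n)))"
    using lborel_affine[of c b] c by simp
  also have "\<dots> = ennreal (c ^ CARD('n)) * (\<integral>\<^sup>+x. g (b + c *\<^sub>R x) \<partial>lborel)"
    using c by (simp add: nn_integral_density nn_integral_distr nn_integral_cmult)
  finally have "ennreal ((1 / c) ^ CARD('n)) * (\<integral>\<^sup>+x. g x \<partial>lborel) =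
      ennreal ((1 / c) ^ CARD('n) * c ^ CARD('n)) * (\<integral>\<^sup>+x. g (b + c *\<^sub>R x) \<partial>lborel)"
    using c by (simp add: ennreal_mult mult.assoc)
  then show ?thesis using c by (simp add: power_mult_distrib[symmetric])
qed

text \<open>The almost subadditivity of \<open>D\<close>, with \<open>T h'\<close> and \<open>T k\<close> as the two vectors, integrated over \<open>k\<close> in the
ball of radius \<open>\<rho>\<close>.  The points \<open>(i/m) k\<close> and \<open>h' + (i/m) k\<close> stay in the ball of twice the radius, and
undoing the dilation by \<open>i/m\<close> costs at most the factor \<open>m ^ N\<close>.\<close>
lemma ball_average_le:
  fixes D :: "real^'n \<Rightarrow> ennreal" and T :: "real^'n^'n"
  assumes [measurable]: "D \<in> borel_measurable borel"
    and sub: "\<And>h k. D h \<le> ennreal C * (\<Sum>i=1..m. D (h + (real i / real m) *\<^sub>R k) + D ((real i / real m) *\<^sub>R k))"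
    and \<rho>: "\<rho> > 0" and h': "norm h' \<le> \<rho>"
  shows "emeasure lborel (cball (0::real^'n) \<rho>) * D (T *v h') \<le>
    ennreal C * ennreal (2 * real m * real m ^ CARD('n)) *
      (\<integral>\<^sup>+k. indicator (cball 0 (2 * \<rho>)) k * D (T *v k) \<partial>lborel)"
proof -
  let ?E = "\<lambda>k. D (T *v k)"
  let ?M = "\<integral>\<^sup>+k. indicator (cball 0 (2 * \<rho>)) k * ?E k \<partial>lborel"
  have dil: "(\<integral>\<^sup>+k. indicator (cball 0 \<rho>) k * ?E (b + (real i / real m) *\<^sub>R k) \<partial>lborel) \<le>
      ennreal (real m ^ CARD('n)) * ?M"
    if i: "i \<in> {1..m}" and b: "norm b \<le> \<rho>" for i and b :: "real^'n"
  proof -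
    let ?c = "real i / real m"
    have c: "0 < ?c" "?c \<le> 1" "1 / ?c \<le> real m" using i by (auto simp: field_simps)
    have "(\<integral>\<^sup>+k. indicator (cball 0 \<rho>) k * ?E (b + ?c *\<^sub>R k) \<partial>lborel) \<le>
      (\<integral>\<^sup>+k. indicator (cball 0 (2 * \<rho>)) (b + ?c *\<^sub>R k) * ?E (b + ?c *\<^sub>R k) \<partial>lborel)"
    proof (intro nn_integral_mono mult_right_mono)
      fix k :: "real^'n"
      have "norm (b + ?c *\<^sub>R k) \<le> 2 * \<rho>" if "norm k \<le> \<rho>"
      proof -
        have "norm (?c *\<^sub>R k) \<le> 1 * \<rho>"
          unfolding norm_scaleR using c that by (intro mult_mono) auto
        then show ?thesis using norm_triangle_ineq[of b "?c *\<^sub>R k"] b by linarith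
      qed
      then show "indicator (cball 0 \<rho>) k \<le> (indicator (cball 0 (2 * \<rho>)) (b + ?c *\<^sub>R k) :: ennreal)"
        by (simp add: indicator_def)
    qed simp
    also have "\<dots> = ennreal ((1 / ?c) ^ CARD('n)) * ?M"
    proof (rule nn_integral_lborel_affine[of "\<lambda>k. indicator (cball 0 (2 * \<rho>)) k * ?E k"])
      show "(\<lambda>k. indicator (cball 0 (2 * \<rho>)) k * ?E k) \<in> borel_measurable borel" by measurable
    qed (rule c(1))
    also have "\<dots> \<le> ennreal (real m ^ CARD('n)) * ?M"
      using c by (intro mult_right_mono ennreal_leI power_mono) auto
    finally show ?thesis .
  qed
  have "emeasure lborel (cball (0::real^'n) \<rho>) * D (T *v h') = (\<integral>\<^sup>+k. indicator (cball (0::real^'n) \<rho>) k * D (T *v h') \<partial>lborel)"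
    by (simp add: nn_integral_multc)
  also have "\<dots> \<le> (\<integral>\<^sup>+k. ennreal C * (\<Sum>i=1..m. indicator (cball 0 \<rho>) k * ?E (h' + (real i / real m) *\<^sub>R k) +
      indicator (cball 0 \<rho>) k * ?E (0 + (real i / real m) *\<^sub>R k)) \<partial>lborel)"
  proof (rule nn_integral_mono)
    fix k :: "real^'n"
    have "D (T *v h') \<le> ennreal C * (\<Sum>i=1..m. ?E (h' + (real i / real m) *\<^sub>R k) + ?E (0 + (real i / real m) *\<^sub>R k))"
      using sub[of "T *v h'" "T *v k"] by (simp add: matrix_vector_right_distrib matrix_vector_mult_scaleR)
    then show "indicator (cball 0 \<rho>) k * D (T *v h') \<le> ennreal C * (\<Sum>i=1..m. indicator (cball 0 \<rho>) k * ?E (h' + (real i / real m) *\<^sub>R k) +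
      indicator (cball 0 \<rho>) k * ?E (0 + (real i / real m) *\<^sub>R k))"
      by (cases "k \<in> cball 0 \<rho>") auto
  qed
  also have "\<dots> = ennreal C * (\<Sum>i=1..m. (\<integral>\<^sup>+k. indicator (cball 0 \<rho>) k * ?E (h' + (real i / real m) *\<^sub>R k) \<partial>lborel) +
      (\<integral>\<^sup>+k. indicator (cball 0 \<rho>) k * ?E (0 + (real i / real m) *\<^sub>R k) \<partial>lborel))"
    by (simp add: nn_integral_cmult nn_integral_sum nn_integral_add)
  also have "\<dots> \<le> ennreal C * (\<Sum>i=1..m. ennreal (real m ^ CARD('n)) * ?M + ennreal (real m ^ CARD('n)) * ?M)"
    using h' \<rho> by (intro mult_left_mono sum_mono add_mono dil) auto
  also have "\<dots> = ennreal C * ennreal (2 * real m * real m ^ CARD('n)) * ?M"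
  proof -
    let ?W = "ennreal (real m ^ CARD('n)) * ?M"
    have "(\<Sum>i=1..m. ?W + ?W) = of_nat m * (?W + ?W)" by simp
    also have "\<dots> = ennreal (real m) * (ennreal 2 * ?W)"
      by (simp only: ennreal_of_nat_eq_real_of_nat mult_2 ennreal_numeral)
    also have "\<dots> = (ennreal 2 * ennreal (real m) * ennreal (real m ^ CARD('n))) * ?M"
      by (simp only: mult_ac)
    also have "ennreal 2 * ennreal (real m) * ennreal (real m ^ CARD('n)) = ennreal (2 * real m * real m ^ CARD('n))"
      by (subst ennreal_mult[symmetric], simp, simp)+ (rule refl)
    finally have "(\<Sum>i=1..m. ?W + ?W) = ennreal (2 * real m * real m ^ CARD('n)) * ?M" .
    then show ?thesis by (simp only: mult.assoc)
  qed
  finally show ?thesis .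
qed

text \<open>Let \<open>T h' = h\<close>, so \<open>\<bar>h'\<bar> \<le> a \<bar>h\<bar>\<close>, and average over the ball of radius \<open>\<rho> = a \<bar>h\<bar>\<close>: up to constants \<open>D h\<close> is at
most \<open>\<rho>\<^sup>-\<^sup>N\<close> times the integral of \<open>D (T k)\<close> over \<open>\<bar>k\<bar> \<le> 2 \<rho>\<close>.  After Tonelli, the integral over \<open>h\<close> is that of
\<open>\<bar>h\<bar> powr (- q - N)\<close> over \<open>\<bar>h\<bar> \<ge> \<bar>k\<bar> / (2 a)\<close>, a multiple of \<open>(\<bar>k\<bar> / a) powr (- q)\<close>.  Altogether \<open>a\<close> appears
with the power \<open>q - N = \<alpha>\<close>.  The constant depends only on \<open>C\<close>, \<open>m\<close>, \<open>\<alpha>\<close> and the dimension, hence the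
quantification over \<open>D\<close>, \<open>T\<close> and \<open>a\<close> inside.\<close>
lemma fractional_upper:
  fixes \<alpha> C :: real and m :: nat
  assumes \<alpha>: "\<alpha> > 0" and C: "C \<ge> 0"
  defines "q \<equiv> \<alpha> + real CARD('n::finite)"
  obtains K where "K \<ge> 0" "\<And>(D :: real^'n \<Rightarrow> ennreal) (T :: real^'n^'n) a.
    D \<in> borel_measurable borel \<Longrightarrow>
    (\<And>h k. D h \<le> ennreal C * (\<Sum>i=1..m. D (h + (real i / real m) *\<^sub>R k) + D ((real i / real m) *\<^sub>R k))) \<Longrightarrow>
    det T = 1 \<Longrightarrow> a > 0 \<Longrightarrow> (\<And>x. norm x \<le> a * norm (T *v x)) \<Longrightarrow>
    (\<integral>\<^sup>+h. D h * ennreal (norm h powr (- q)) \<partial>lborel) \<le>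
      ennreal (K * a powr \<alpha>) * (\<integral>\<^sup>+k. D (T *v k) * ennreal (norm k powr (- q)) \<partial>lborel)"
proof -
  let ?N = "real CARD('n)"
  define \<omega> where "\<omega> = unit_ball_vol ?N"
  have \<omega>: "\<omega> > 0" by (simp add: \<omega>_def)
  define \<beta> where "\<beta> = q + ?N"
  have "\<beta> > ?N" using \<alpha> by (simp add: \<beta>_def q_def)
  then obtain c where c: "c > 0" "\<And>\<rho>. \<rho> > 0 \<Longrightarrow>
    (\<integral>\<^sup>+h. indicator {h::real^'n. norm h \<ge> \<rho>} h * ennreal (norm h powr (- \<beta>)) \<partial>lborel)
      \<le> ennreal (c * \<rho> powr (?N - \<beta>))"
    by (rule nn_integral_outside_ball_le[where 'n='n]) blast
  define C2 where "C2 = C * (2 * real m * real m ^ CARD('n))"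
  have C2: "C2 \<ge> 0" using C by (simp add: C2_def)
  define K where "K = C2 / \<omega> * c * 2 powr q"
  have K0: "K \<ge> 0" using C2 \<omega> c by (simp add: K_def)
  have main: "(\<integral>\<^sup>+h. D h * ennreal (norm h powr (- q)) \<partial>lborel) \<le>
      ennreal (K * a powr \<alpha>) * (\<integral>\<^sup>+k. D (T *v k) * ennreal (norm k powr (- q)) \<partial>lborel)"
    if D[measurable]: "D \<in> borel_measurable borel"
      and sub: "\<And>h k. D h \<le> ennreal C * (\<Sum>i=1..m. D (h + (real i / real m) *\<^sub>R k) + D ((real i / real m) *\<^sub>R k))"
      and T: "det T = 1" and a: "a > 0" "\<And>x. norm x \<le> a * norm (T *v x)"
    for D :: "real^'n \<Rightarrow> ennreal" and T :: "real^'n^'n" and a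
  proof -
    define B where "B = C2 / (\<omega> * a powr ?N)"
    have B: "B \<ge> 0" using C2 \<omega> by (simp add: B_def)
    let ?E = "\<lambda>k. D (T *v k)"
    let ?I = "\<lambda>(h::real^'n) k. if norm k \<le> 2 * a * norm h then ennreal (B * norm h powr (- \<beta>)) * ?E k else 0"
    have point: "D h * ennreal (norm h powr (- q)) \<le> (\<integral>\<^sup>+k. ?I h k \<partial>lborel)" for h
    proof (cases "h = 0")
      case False
      have "det T \<noteq> 0" using T by simp
      then obtain A where A: "T ** A = mat 1" unfolding invertible_det_nz[symmetric] invertible_def by blast
      define h' where "h' = A *v h"
      have Th': "T *v h' = h" using A by (simp add: h'_def matrix_vector_mul_assoc)
      define \<rho> where "\<rho> = a * norm h"
      have \<rho>: "\<rho> > 0" using a False by (simp add: \<rho>_def)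
      let ?M = "\<integral>\<^sup>+k. indicator (cball 0 (2 * \<rho>)) k * ?E k \<partial>lborel"
      have "emeasure lborel (cball (0::real^'n) \<rho>) * D (T *v h') \<le> ennreal C * ennreal (2 * real m * real m ^ CARD('n)) * ?M"
        using a(2)[of h'] by (intro ball_average_le D sub \<rho>) (simp add: \<rho>_def Th')
      moreover have "emeasure lborel (cball (0::real^'n) \<rho>) = ennreal (\<omega> * \<rho> powr ?N)"
        using \<rho> by (simp add: emeasure_cball \<omega>_def powr_realpow)
      ultimately have "ennreal (\<omega> * \<rho> powr ?N) * D h \<le> ennreal C2 * ?M"
        using C unfolding Th' by (simp add: C2_def ennreal_mult)
      then have "ennreal (norm h powr (- q) / (\<omega> * \<rho> powr ?N)) * (ennreal (\<omega> * \<rho> powr ?N) * D h) \<le>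
        ennreal (norm h powr (- q) / (\<omega> * \<rho> powr ?N)) * (ennreal C2 * ?M)"
        by (rule mult_left_mono) simp
      moreover have "ennreal (norm h powr (- q) / (\<omega> * \<rho> powr ?N)) * (ennreal (\<omega> * \<rho> powr ?N) * D h) = D h * ennreal (norm h powr (- q))"
        using \<omega> \<rho> by (simp add: mult.assoc[symmetric] ennreal_mult[symmetric]) (simp add: mult.commute)
      moreover have "ennreal (norm h powr (- q) / (\<omega> * \<rho> powr ?N)) * (ennreal C2 * ?M) = ennreal (B * norm h powr (- \<beta>)) * ?M"
      proof -
        have "norm h powr (- q) / (\<omega> * \<rho> powr ?N) * C2 = B * norm h powr (- \<beta>)"
        proof -
          have "norm h powr (- \<beta>) = norm h powr (- q) / norm h powr ?N"
            unfolding \<beta>_def powr_diff[symmetric] by (simp add: algebra_simps)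
          then show ?thesis using a by (simp add: \<rho>_def B_def powr_mult mult_ac)
        qed
        then show ?thesis
          using \<omega> C2 by (simp add: mult.assoc[symmetric] ennreal_mult[symmetric])
      qed
      moreover have "ennreal (B * norm h powr (- \<beta>)) * ?M = (\<integral>\<^sup>+k. ?I h k \<partial>lborel)"
        by (subst nn_integral_cmult[symmetric]) (auto intro!: nn_integral_cong simp: \<rho>_def indicator_def)
      ultimately show ?thesis by simp
    qed simp
    have "(\<integral>\<^sup>+h. D h * ennreal (norm h powr (- q)) \<partial>lborel) \<le> (\<integral>\<^sup>+h. \<integral>\<^sup>+k. ?I h k \<partial>lborel \<partial>lborel)"
      by (rule nn_integral_mono) (rule point)
    also have "\<dots> = (\<integral>\<^sup>+k. \<integral>\<^sup>+h. ?I h k \<partial>lborel \<partial>lborel)"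
      by (rule lborel_pair.Fubini'[symmetric]) measurable
    also have "\<dots> \<le> (\<integral>\<^sup>+k. ennreal (K * a powr \<alpha>) * (?E k * ennreal (norm k powr (- q))) \<partial>lborel)"
    proof (rule nn_integral_mono_AE)
      have "AE k in lborel. k \<noteq> (0::real^'n)" by (rule AE_lborel_singleton)
      then show "AE k in lborel. (\<integral>\<^sup>+h. ?I h k \<partial>lborel) \<le> ennreal (K * a powr \<alpha>) * (?E k * ennreal (norm k powr (- q)))"
      proof eventually_elim
        case (elim k)
        let ?\<rho> = "norm k / (2 * a)"
        have \<rho>: "?\<rho> > 0" using elim a by simp
        have "(\<integral>\<^sup>+h. ?I h k \<partial>lborel) = (\<integral>\<^sup>+h. (ennreal B * ?E k) * (indicator {h::real^'n. norm h \<ge> ?\<rho>} h * ennreal (norm h powr (- \<beta>))) \<partial>lborel)"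
          using a B by (intro nn_integral_cong) (auto simp: indicator_def ennreal_mult field_simps)
        also have "\<dots> = (ennreal B * ?E k) * (\<integral>\<^sup>+h. indicator {h::real^'n. norm h \<ge> ?\<rho>} h * ennreal (norm h powr (- \<beta>)) \<partial>lborel)"
          by (rule nn_integral_cmult) measurable
        also have "\<dots> \<le> (ennreal B * ?E k) * ennreal (c * ?\<rho> powr (?N - \<beta>))"
          by (intro mult_left_mono c(2) \<rho>) simp
        also have "\<dots> = ennreal (B * (c * ?\<rho> powr (?N - \<beta>))) * ?E k"
          using B c by (simp add: ennreal_mult mult_ac)
        also have "B * (c * ?\<rho> powr (?N - \<beta>)) = K * a powr \<alpha> * norm k powr (- q)"
        proof -
          have "?\<rho> powr (?N - \<beta>) = norm k powr (- q) * (2 powr q * a powr q)"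
            using a elim by (simp add: \<beta>_def powr_divide powr_mult powr_minus field_simps)
          moreover have "a powr q = a powr \<alpha> * a powr ?N" by (simp add: q_def powr_add)
          ultimately show ?thesis
            using a \<omega> by (simp add: B_def K_def)
        qed
        also have "ennreal (K * a powr \<alpha> * norm k powr (- q)) * ?E k = ennreal (K * a powr \<alpha>) * (?E k * ennreal (norm k powr (- q)))"
          using \<open>K \<ge> 0\<close> by (simp add: ennreal_mult mult_ac)
        finally show ?case .
      qed
    qed
    also have "\<dots> = ennreal (K * a powr \<alpha>) * (\<integral>\<^sup>+k. ?E k * ennreal (norm k powr (- q)) \<partial>lborel)"
      by (rule nn_integral_cmult) measurable
    finally show ?thesis .
  qed
  show ?thesis by (rule that[OF K0]) (rule main; assumption)
qed

text \<open>Let \<open>\<rho> = \<bar>z\<bar>\<close>.  If \<open>\<bar>k\<bar> \<le> \<rho>\<close>, then \<open>T k\<close> or \<open>T (k + z)\<close> has length at least \<open>2 R\<close>, since they differ by \<open>T z\<close>.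
So the points \<open>k\<close> with \<open>\<bar>k\<bar> \<le> 2 \<rho>\<close> and \<open>\<bar>T k\<bar> \<ge> 2 R\<close> have at least half the volume of the ball of
radius \<open>\<rho>\<close>, and there the integrand is at least \<open>X (2 \<rho>) powr (- q)\<close>.\<close>
lemma fractional_lower:
  fixes \<alpha> :: real
  defines "q \<equiv> \<alpha> + real CARD('n::finite)"
  assumes \<alpha>: "\<alpha> > 0"
  obtains K where "K \<ge> 0" "\<And>(D :: real^'n \<Rightarrow> ennreal) (T :: real^'n^'n) z R X.
    D \<in> borel_measurable borel \<Longrightarrow> (\<And>h. norm h \<ge> 2 * R \<Longrightarrow> X \<le> D h) \<Longrightarrow> R > 0 \<Longrightarrow>
    norm (T *v z) \<ge> 4 * R \<Longrightarrow>
    X \<le> ennreal (K * norm z powr \<alpha>) * (\<integral>\<^sup>+k. D (T *v k) * ennreal (norm k powr (- q)) \<partial>lborel)"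
proof -
  let ?N = "real CARD('n)"
  define \<omega> where "\<omega> = unit_ball_vol ?N"
  have \<omega>: "\<omega> > 0" by (simp add: \<omega>_def)
  define K where "K = 2 * 2 powr q / \<omega>"
  have K0: "K \<ge> 0" using \<omega> by (simp add: K_def)
  have main: "X \<le> ennreal (K * norm z powr \<alpha>) * (\<integral>\<^sup>+k. D (T *v k) * ennreal (norm k powr (- q)) \<partial>lborel)"
    if [measurable]: "D \<in> borel_measurable borel" and X: "\<And>h. norm h \<ge> 2 * R \<Longrightarrow> X \<le> D h" and R: "R > 0"
      and z: "norm (T *v z) \<ge> 4 * R"
    for D :: "real^'n \<Rightarrow> ennreal" and T :: "real^'n^'n" and z R X
  proof -
    let ?\<rho> = "norm z"
    have \<rho>: "?\<rho> > 0" using z R by auto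
    define S where "S = {k. norm k \<le> 2 * ?\<rho> \<and> norm (T *v k) \<ge> 2 * R}"
    have [measurable]: "S \<in> sets borel" unfolding S_def by measurable
    let ?Z = "\<integral>\<^sup>+k. D (T *v k) * ennreal (norm k powr (- q)) \<partial>lborel"
    \<comment> \<open>for \<open>k\<close> in the ball, \<open>k\<close> or its translate by \<open>z\<close> lies in \<open>S\<close>\<close>
    have cover: "indicator (cball 0 ?\<rho>) k \<le> indicator S k + (indicator S (k + z) :: ennreal)" for k
    proof (cases "k \<in> cball 0 ?\<rho>")
      case True
      then have "norm k \<le> ?\<rho>" by simp
      then have n: "norm k \<le> 2 * ?\<rho>" "norm (k + z) \<le> 2 * ?\<rho>"
        using norm_triangle_ineq[of k z] norm_ge_zero[of z] by linarith+
      have "norm (T *v z) \<le> norm (T *v (k + z)) + norm (T *v k)"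
        using norm_triangle_ineq4[of "T *v (k + z)" "T *v k"] by (simp add: matrix_vector_right_distrib)
      then have "norm (T *v k) \<ge> 2 * R \<or> norm (T *v (k + z)) \<ge> 2 * R" using z by linarith
      then show ?thesis using n by (auto simp: S_def indicator_def)
    qed simp
    have "ennreal (\<omega> * ?\<rho> powr ?N) = emeasure lborel (cball (0::real^'n) ?\<rho>)"
      using \<rho> by (simp add: emeasure_cball \<omega>_def powr_realpow)
    also have "\<dots> = (\<integral>\<^sup>+k. indicator (cball 0 ?\<rho>) k \<partial>(lborel :: (real^'n) measure))" by simp
    also have "\<dots> \<le> (\<integral>\<^sup>+k. indicator S k + indicator S (k + z) \<partial>lborel)"
      by (intro nn_integral_mono cover)
    also have "\<dots> = (\<integral>\<^sup>+k. indicator S k \<partial>lborel) + (\<integral>\<^sup>+k. indicator S (k + z) \<partial>lborel)"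
      by (rule nn_integral_add) measurable
    also have "(\<integral>\<^sup>+k. indicator S (k + z) \<partial>lborel) = (\<integral>\<^sup>+k. indicator S k \<partial>(lborel :: (real^'n) measure))"
      by (rule nn_integral_lborel_shift) measurable
    finally have vol: "ennreal (\<omega> * ?\<rho> powr ?N) \<le> 2 * emeasure lborel S"
      by (simp add: mult_2)
    have "X * ennreal ((2 * ?\<rho>) powr (- q)) * emeasure lborel S = (\<integral>\<^sup>+k. X * ennreal ((2 * ?\<rho>) powr (- q)) * indicator S k \<partial>lborel)"
      by (subst nn_integral_cmult_indicator) simp_all
    also have "\<dots> \<le> ?Z"
    proof (rule nn_integral_mono)
      fix k :: "real^'n"
      show "X * ennreal ((2 * ?\<rho>) powr (- q)) * indicator S k \<le> D (T *v k) * ennreal (norm k powr (- q))"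
      proof (cases "k \<in> S")
        case True
        then have k: "norm k \<le> 2 * ?\<rho>" "norm (T *v k) \<ge> 2 * R" by (auto simp: S_def)
        then have "norm k > 0" using R by auto
        then have "(2 * ?\<rho>) powr (- q) \<le> norm k powr (- q)"
          using k \<alpha> by (intro powr_mono2') (auto simp: q_def)
        then show ?thesis
          using True X[OF k(2)] by (simp add: mult_mono ennreal_leI)
      qed simp
    qed
    finally have low: "X * ennreal ((2 * ?\<rho>) powr (- q)) * emeasure lborel S \<le> ?Z" .
    have "X * ennreal ((2 * ?\<rho>) powr (- q)) * ennreal (\<omega> * ?\<rho> powr ?N) \<le> X * ennreal ((2 * ?\<rho>) powr (- q)) * (2 * emeasure lborel S)"
      using vol by (intro mult_left_mono) auto
    also have "\<dots> = 2 * (X * ennreal ((2 * ?\<rho>) powr (- q)) * emeasure lborel S)" by (simp add: mult_ac)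
    also have "\<dots> \<le> 2 * ?Z" using low by (intro mult_left_mono) auto
    finally have *: "X * ennreal ((2 * ?\<rho>) powr (- q)) * ennreal (\<omega> * ?\<rho> powr ?N) \<le> 2 * ?Z" .
    let ?L = "(2 * ?\<rho>) powr (- q) * (\<omega> * ?\<rho> powr ?N)"
    have L: "?L > 0" using \<rho> \<omega> by simp
    have "?L * (1 / ?L) = 1" if "?L > 0" using that by (metis less_irrefl nonzero_eq_divide_eq mult.commute)
    with L have "X = X * ennreal (?L * (1 / ?L))" by (simp only: ennreal_1 mult_1_right)
    also have "\<dots> = X * ennreal ((2 * ?\<rho>) powr (- q)) * ennreal (\<omega> * ?\<rho> powr ?N) * ennreal (1 / ?L)"
    proof -
      have gen: "ennreal (u * w * v) = ennreal u * ennreal w * ennreal v"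
        if "u \<ge> 0" "w \<ge> 0" "v \<ge> 0" for u w v :: real
        using that by (simp add: ennreal_mult)
      have "ennreal (?L * (1 / ?L)) = ennreal ((2 * ?\<rho>) powr (- q)) * ennreal (\<omega> * ?\<rho> powr ?N) * ennreal (1 / ?L)"
        by (rule gen) (use \<omega> in simp_all)
      then show ?thesis by (simp only: mult.assoc)
    qed
    also have "\<dots> \<le> 2 * ?Z * ennreal (1 / ?L)"
      using * by (intro mult_right_mono) auto
    also have "\<dots> = ennreal (2 * (1 / ?L)) * ?Z"
    proof -
      have "ennreal (2 * v) = 2 * ennreal v" if "v \<ge> 0" for v :: real
        using that by (simp add: ennreal_mult)
      from this[of "1 / ?L"] have "ennreal (2 * (1 / ?L)) = 2 * ennreal (1 / ?L)" using L by simp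
      then show ?thesis by (simp only: mult_ac)
    qed
    also have "2 * (1 / ?L) = K * ?\<rho> powr \<alpha>"
    proof -
      have "(2 * ?\<rho>) powr (- q) = 1 / (2 powr q * ?\<rho> powr q)"
        by (simp add: powr_minus_divide powr_mult)
      moreover have "?\<rho> powr q = ?\<rho> powr \<alpha> * ?\<rho> powr ?N" by (simp add: q_def powr_add)
      ultimately have "(2 * ?\<rho>) powr (- q) = 1 / (2 powr q * (?\<rho> powr \<alpha> * ?\<rho> powr ?N))" by simp
      then show ?thesis using \<rho> \<omega> by (simp add: K_def field_simps)
    qed
    finally show ?thesis .
  qed
  show ?thesis by (rule that[OF K0]) (rule main; assumption)
qed

section \<open>The two bounds and their combination\<close>

lemma fdiff_funpow_linear:
  "(fdiff h ^^ m) (\<lambda>x. f (T *v x)) x = (fdiff (T *v h) ^^ m) f (T *v x)"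
  by (simp add: fdiff_funpow_eq matrix_vector_right_distrib matrix_vector_mult_scaleR)

lemma Lp_norm_pow_fdiff_SL:
  fixes f :: "real^'n \<Rightarrow> real"
  assumes "det T = 1"
  shows "Lp_norm_pow p ((fdiff h ^^ m) (\<lambda>x. f (T *v x))) = Lp_norm_pow p ((fdiff (T *v h) ^^ m) f)"
  using nn_integral_lebesgue_unimodular[of T "\<lambda>x. ennreal (\<bar>(fdiff (T *v h) ^^ m) f x\<bar> powr p)" 0] assms
  by (simp add: Lp_norm_pow_def fdiff_funpow_linear)

lemma borel_measurable_Lp_norm_pow_fdiff:
  fixes f :: "real^'n \<Rightarrow> real"
  assumes f: "f \<in> borel_measurable lebesgue"
  obtains g where "g \<in> borel_measurable borel"
    "\<And>h m p. Lp_norm_pow p ((fdiff h ^^ m) f) = Lp_norm_pow p ((fdiff h ^^ m) g)"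
    "\<And>m p. (\<lambda>h. Lp_norm_pow p ((fdiff h ^^ m) g)) \<in> borel_measurable borel"
proof -
  obtain g where g: "g \<in> borel_measurable lborel" "AE x in lborel. f x = g x"
    using completion_ex_borel_measurable_real[OF f] by blast
  then have [measurable]: "g \<in> borel_measurable borel" by simp
  have ae: "AE x in lebesgue. f x = g x" using g(2) by (rule AE_completion)
  have "Lp_norm_pow p ((fdiff h ^^ m) f) = Lp_norm_pow p ((fdiff h ^^ m) g)" for h m p
    by (rule Lp_norm_pow_cong[OF AE_fdiff_cong[OF ae]])
  moreover have "(\<lambda>h. Lp_norm_pow p ((fdiff h ^^ m) g)) \<in> borel_measurable borel" for m p
    unfolding Lp_norm_pow_lborel fdiff_funpow_eq by measurable
  ultimately show ?thesis using that \<open>g \<in> borel_measurable borel\<close> by blast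
qed

lemma W_seminorm_pow_nonint:
  fixes f :: "real^'n \<Rightarrow> real"
  assumes "s \<notin> \<int>"
  shows "W_seminorm_pow s p f = (\<integral>\<^sup>+h. Lp_norm_pow p ((fdiff h ^^ (nat \<lfloor>s\<rfloor> + 1)) f) *
    ennreal (norm h powr (- (s * p + real CARD('n)))) \<partial>lborel)"
proof -
  have ae: "AE h in lborel. h \<noteq> (0::real^'n)" by (rule AE_lborel_singleton)
  have "W_seminorm_pow s p f = (\<integral>\<^sup>+h. Lp_norm_pow p ((fdiff h ^^ (nat \<lfloor>s\<rfloor> + 1)) f) /
                  ennreal (norm h powr (s * p + real CARD('n))) \<partial>lborel)"
    unfolding W_seminorm_pow_def using assms by (simp only: if_False nn_integral_completion)
  also have "\<dots> = (\<integral>\<^sup>+h. Lp_norm_pow p ((fdiff h ^^ (nat \<lfloor>s\<rfloor> + 1)) f) *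
    ennreal (norm h powr (- (s * p + real CARD('n)))) \<partial>lborel)"
  proof (rule nn_integral_cong_AE)
    show "AE h in lborel. Lp_norm_pow p ((fdiff h ^^ (nat \<lfloor>s\<rfloor> + 1)) f) /
                  ennreal (norm h powr (s * p + real CARD('n))) =
       Lp_norm_pow p ((fdiff h ^^ (nat \<lfloor>s\<rfloor> + 1)) f) * ennreal (norm h powr (- (s * p + real CARD('n))))"
      using ae
    proof eventually_elim
      case (elim h)
      then have "inverse (ennreal (norm h powr (s * p + real CARD('n)))) = ennreal (inverse (norm h powr (s * p + real CARD('n))))"
        by (intro inverse_ennreal) simp
      then show ?case by (simp only: divide_ennreal_def powr_minus)
    qed
  qed
  finally show ?thesis .
qed

text \<open>The vector \<open>z\<close> of fractional_lower is \<open>(4 R / t) e\<^sub>j\<close> with \<open>t = \<bar>T e\<^sub>j\<bar>\<close>, so that \<open>\<bar>T z\<bar> = 4 R\<close>.\<close>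
lemma nonint_two_sided:
  fixes s p R :: real
  assumes s: "s > 0" "s \<notin> \<int>" and p: "p \<ge> 1" and R: "R > 0"
  shows "\<exists>C1 C2. C1 \<ge> 0 \<and> C2 \<ge> 0 \<and> (\<forall>(T::real^'n::finite^'n) (f::real^'n \<Rightarrow> real) j a.
    det T = 1 \<longrightarrow> f \<in> W s p \<longrightarrow> supported_in_ball R f \<longrightarrow> norm (T *v axis j 1) > 0 \<longrightarrow>
    a > 0 \<longrightarrow> (\<forall>x. norm x \<le> a * norm (T *v x)) \<longrightarrow>
    Lp_norm_pow p f \<le> ennreal (C1 * norm (T *v axis j 1) powr (- (s * p))) * W_seminorm_pow s p (\<lambda>x. f (T *v x)) \<and>
    W_seminorm_pow s p f \<le> ennreal (C2 * a powr (s * p)) * W_seminorm_pow s p (\<lambda>x. f (T *v x)))"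
proof -
  define \<alpha> where "\<alpha> = s * p"
  define m where "m = nat \<lfloor>s\<rfloor> + 1"
  have \<alpha>: "\<alpha> > 0" using s p by (simp add: \<alpha>_def)
  let ?q = "\<alpha> + real CARD('n)"
  define C where "C = (2 ^ m * (2 * real m)) powr p"
  have C: "C \<ge> 0" by (simp add: C_def)
  obtain K1 where K1: "K1 \<ge> 0" "\<And>(D :: real^'n \<Rightarrow> ennreal) (T :: real^'n^'n) z R X.
    D \<in> borel_measurable borel \<Longrightarrow> (\<And>h. norm h \<ge> 2 * R \<Longrightarrow> X \<le> D h) \<Longrightarrow> R > 0 \<Longrightarrow>
    norm (T *v z) \<ge> 4 * R \<Longrightarrow>
    X \<le> ennreal (K1 * norm z powr \<alpha>) * (\<integral>\<^sup>+k. D (T *v k) * ennreal (norm k powr (- ?q)) \<partial>lborel)"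
    by (rule fractional_lower[OF \<alpha>, where 'n='n]) blast
  obtain K2 where K2: "K2 \<ge> 0" "\<And>(D :: real^'n \<Rightarrow> ennreal) (T :: real^'n^'n) a.
    D \<in> borel_measurable borel \<Longrightarrow>
    (\<And>h k. D h \<le> ennreal C * (\<Sum>i=1..m. D (h + (real i / real m) *\<^sub>R k) + D ((real i / real m) *\<^sub>R k))) \<Longrightarrow>
    det T = 1 \<Longrightarrow> a > 0 \<Longrightarrow> (\<And>x. norm x \<le> a * norm (T *v x)) \<Longrightarrow>
    (\<integral>\<^sup>+h. D h * ennreal (norm h powr (- ?q)) \<partial>lborel) \<le>
      ennreal (K2 * a powr \<alpha>) * (\<integral>\<^sup>+k. D (T *v k) * ennreal (norm k powr (- ?q)) \<partial>lborel)"
    by (rule fractional_upper[OF \<alpha> C, where 'n='n and m=m]) blast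
  define C1 where "C1 = K1 * (4 * R) powr \<alpha>"
  have C1: "C1 \<ge> 0" using K1 by (simp add: C1_def)
  show ?thesis
  proof (rule exI[of _ C1], rule exI[of _ K2], intro conjI allI impI)
    fix T :: "real^'n^'n" and f :: "real^'n \<Rightarrow> real" and j a
    assume T: "det T = 1" and f: "f \<in> W s p" and supp: "supported_in_ball R f"
      and t: "norm (T *v axis j 1) > 0" and a: "a > 0" "\<forall>x. norm x \<le> a * norm (T *v x)"
    let ?t = "norm (T *v axis j 1)"
    have "f \<in> borel_measurable lebesgue" using f by (simp add: W_def Lp_def)
    then obtain g where g: "g \<in> borel_measurable borel"
      "\<And>h m p. Lp_norm_pow p ((fdiff h ^^ m) f) = Lp_norm_pow p ((fdiff h ^^ m) g)"
      "\<And>m p. (\<lambda>h. Lp_norm_pow p ((fdiff h ^^ m) g)) \<in> borel_measurable borel"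
      by (rule borel_measurable_Lp_norm_pow_fdiff) blast
    define D where "D h = Lp_norm_pow p ((fdiff h ^^ m) g)" for h
    have D[measurable]: "D \<in> borel_measurable borel" unfolding D_def[abs_def] by (rule g(3))
    have Df: "Lp_norm_pow p ((fdiff h ^^ m) f) = D h" for h by (simp add: D_def g(2))
    have Y: "W_seminorm_pow s p f = (\<integral>\<^sup>+h. D h * ennreal (norm h powr (- ?q)) \<partial>lborel)"
      unfolding W_seminorm_pow_nonint[OF s(2)] m_def[symmetric] Df \<alpha>_def ..
    have Z: "W_seminorm_pow s p (\<lambda>x. f (T *v x)) = (\<integral>\<^sup>+k. D (T *v k) * ennreal (norm k powr (- ?q)) \<partial>lborel)"
      unfolding W_seminorm_pow_nonint[OF s(2)] m_def[symmetric] Lp_norm_pow_fdiff_SL[OF T] Df \<alpha>_def ..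
    have sub: "D h \<le> ennreal C * (\<Sum>i=1..m. D (h + (real i / real m) *\<^sub>R k) + D ((real i / real m) *\<^sub>R k))" for h k
      unfolding D_def C_def by (rule Lp_norm_pow_fdiff_subadditive) (use p g(1) in \<open>auto simp: m_def\<close>)
    show "W_seminorm_pow s p f \<le> ennreal (K2 * a powr (s * p)) * W_seminorm_pow s p (\<lambda>x. f (T *v x))"
      unfolding Y Z \<alpha>_def[symmetric] by (rule K2(2)[OF D sub T a(1)]) (use a(2) in blast)
    have far: "Lp_norm_pow p f \<le> D h" if "norm h \<ge> 2 * R" for h
      unfolding Df[symmetric] by (rule Lp_norm_pow_le_fdiff[OF supp that R p])
    let ?z = "(4 * R / ?t) *\<^sub>R axis j 1 :: real^'n"
    have z: "norm (T *v ?z) \<ge> 4 * R" "norm ?z = 4 * R / ?t"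
      using R t by (simp_all add: matrix_vector_mult_scaleR)
    have "Lp_norm_pow p f \<le> ennreal (K1 * norm ?z powr \<alpha>) * (\<integral>\<^sup>+k. D (T *v k) * ennreal (norm k powr (- ?q)) \<partial>lborel)"
      by (rule K1(2)[OF D far R z(1)])
    also have "K1 * norm ?z powr \<alpha> = C1 * ?t powr (- (s * p))"
      unfolding z(2) using R by (simp add: C1_def \<alpha>_def powr_divide powr_minus_divide)
    finally show "Lp_norm_pow p f \<le> ennreal (C1 * ?t powr (- (s * p))) * W_seminorm_pow s p (\<lambda>x. f (T *v x))"
      unfolding Z .
  qed (use C1 K2 in auto)
qed

text \<open>The step \<open>r = 2 R / t\<close> along \<open>e\<^sub>j\<close>, with \<open>t = \<bar>T e\<^sub>j\<bar>\<close>, makes \<open>T (r e\<^sub>j)\<close> just long enough to separate \<open>f\<close>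
from its translates.\<close>
lemma int_two_sided:
  fixes s p R :: real
  assumes s: "s > 0" "s \<in> \<int>" and p: "p \<ge> 1" and R: "R > 0"
  shows "\<exists>C1 C2. C1 \<ge> 0 \<and> C2 \<ge> 0 \<and> (\<forall>(T::real^'n::finite^'n) (f::real^'n \<Rightarrow> real) j a.
    det T = 1 \<longrightarrow> f \<in> W s p \<longrightarrow> supported_in_ball R f \<longrightarrow> norm (T *v axis j 1) > 0 \<longrightarrow>
    a > 0 \<longrightarrow> (\<forall>x. norm x \<le> a * norm (T *v x)) \<longrightarrow>
    Lp_norm_pow p f \<le> ennreal (C1 * norm (T *v axis j 1) powr (- (s * p))) * W_seminorm_pow s p (\<lambda>x. f (T *v x)) \<and>
    W_seminorm_pow s p f \<le> ennreal (C2 * a powr (s * p)) * W_seminorm_pow s p (\<lambda>x. f (T *v x)))"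
proof -
  define k where "k = nat \<lfloor>s\<rfloor>"
  have k: "real k = s" using s by (auto simp: k_def elim!: Ints_cases)
  have pw: "(r ^ k) powr p = r powr (s * p)" if "r > 0" for r :: real
    using that by (simp add: k[symmetric] powr_powr flip: powr_realpow)
  have S: "W_seminorm_pow s p f = (\<integral>\<^sup>+x. ennreal (form_norm k (deriv_form k f x) powr p) \<partial>lebesgue)"
    for f :: "real^'n \<Rightarrow> real"
    using s(2) by (simp add: W_seminorm_pow_def k_def)
  show ?thesis
  proof (rule exI[of _ "(2 * R) powr (s * p)"], rule exI[of _ "1::real"], intro conjI allI impI)
    fix T :: "real^'n^'n" and f :: "real^'n \<Rightarrow> real" and j a
    assume T: "det T = 1" and f: "f \<in> W s p" and supp: "supported_in_ball R f"
      and t: "norm (T *v axis j 1) > 0" and a: "a > 0" "\<forall>x. norm x \<le> a * norm (T *v x)"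
    let ?t = "norm (T *v axis j 1)"
    have fW: "f \<in> W1_loc k" using f s(2) by (simp add: W_def W_dot_def k_def)
    have "W_seminorm_pow s p f \<le> ennreal ((a ^ k) powr p) * W_seminorm_pow s p (\<lambda>x. f (T *v x))"
      unfolding S using a(2) by (intro nn_integral_form_norm_SL_le[OF fW T p a(1)]) blast
    then show "W_seminorm_pow s p f \<le> ennreal (1 * a powr (s * p)) * W_seminorm_pow s p (\<lambda>x. f (T *v x))"
      using pw[OF a(1)] by simp
    define r where "r = 2 * R / ?t"
    have r: "r > 0" using R t by (simp add: r_def)
    have "Lp_norm_pow p f \<le> Lp_norm_pow p ((fdiff (T *v (r *\<^sub>R axis j 1)) ^^ k) f)"
      using R t by (intro Lp_norm_pow_le_fdiff[OF supp _ R p]) (simp add: matrix_vector_mult_scaleR r_def)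
    also have "\<dots> = Lp_norm_pow p ((fdiff (r *\<^sub>R axis j 1) ^^ k) (\<lambda>x. f (T *v x)))"
      by (rule Lp_norm_pow_fdiff_SL[OF T, symmetric])
    also have "\<dots> \<le> ennreal ((r ^ k) powr p) * W_seminorm_pow s p (\<lambda>x. f (T *v x))"
      unfolding S by (rule Lp_norm_pow_fdiff_le_form_norm[OF W1_loc_SL[OF fW T] r p])
    also have "(r ^ k) powr p = (2 * R) powr (s * p) * ?t powr (- (s * p))"
      unfolding pw[OF r] using R by (simp add: r_def powr_divide powr_minus_divide)
    finally show "Lp_norm_pow p f \<le> ennreal ((2 * R) powr (s * p) * ?t powr (- (s * p))) * W_seminorm_pow s p (\<lambda>x. f (T *v x))" .
  qed auto
qed

lemma ennreal_powr_ennreal: "x \<ge> 0 \<Longrightarrow> ennreal_powr (ennreal x) a = ennreal (x powr a)"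
  by (simp add: ennreal_powr_def)

text \<open>With \<open>u = (1 - 1/N) / p\<close> and \<open>v = 1 / (p N)\<close> one has \<open>u + v = 1/p\<close> and \<open>(N - 1) v = u\<close>: the powers of \<open>Z\<close>
add up to the required one and those of \<open>t\<close> cancel.  The summand \<open>1\<close> in the constant keeps it
positive, so that the right-hand side is infinite whenever \<open>Z\<close> is.\<close>
lemma combine_powers:
  fixes X Y Z :: ennreal and p N \<alpha> t C1 C2 :: real
  assumes N: "N \<ge> 2" and p: "p \<ge> 1" and t: "t > 0" and C: "C1 \<ge> 0" "C2 \<ge> 0"
    and X: "X \<le> ennreal (C1 * t powr (- \<alpha>)) * Z"
    and Y: "Y \<le> ennreal (C2 * t powr ((N - 1) * \<alpha>)) * Z"
  shows "ennreal_powr (ennreal_powr X (1 / p)) (1 - 1 / N) * ennreal_powr (ennreal_powr Y (1 / p)) (1 / N) \<le>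
    ennreal (C1 powr ((1 - 1 / N) / p) * C2 powr (1 / (p * N)) + 1) * ennreal_powr Z (1 / p)"
proof (cases "Z = \<infinity>")
  case True
  have "ennreal (C1 powr ((1 - 1 / N) / p) * C2 powr (1 / (p * N)) + 1) \<noteq> 0"
    by (simp add: add_nonneg_pos ennreal_eq_0_iff not_le)
  then show ?thesis using True by (simp add: ennreal_powr_def ennreal_mult_top)
next
  case False
  then obtain z where z: "z \<ge> 0" "Z = ennreal z" by (cases Z) auto
  have "X < \<infinity>" "Y < \<infinity>" using X Y z by (auto simp: ennreal_mult[symmetric] C intro: le_less_trans)
  then obtain x y where x: "x \<ge> 0" "X = ennreal x" and y: "y \<ge> 0" "Y = ennreal y"
    by (cases X; cases Y) auto
  have x': "x \<le> C1 * t powr (- \<alpha>) * z" using X C z x by (simp add: ennreal_mult[symmetric])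
  have y': "y \<le> C2 * t powr ((N - 1) * \<alpha>) * z" using Y C z y by (simp add: ennreal_mult[symmetric])
  define u where "u = (1 - 1 / N) / p"
  define v where "v = 1 / (p * N)"
  have uv: "u \<ge> 0" "v \<ge> 0" "u + v = 1 / p" "(N - 1) * v = u"
    using N p by (simp_all add: u_def v_def field_simps)
  have "x powr u * y powr v \<le> (C1 * t powr (- \<alpha>) * z) powr u * (C2 * t powr ((N - 1) * \<alpha>) * z) powr v"
    using x y x' y' uv by (intro mult_mono powr_mono2) auto
  also have "\<dots> = C1 powr u * C2 powr v * (t powr (- \<alpha> * u) * t powr ((N - 1) * \<alpha> * v)) * (z powr u * z powr v)"
    by (simp add: powr_mult powr_powr mult_ac)
  also have "t powr (- \<alpha> * u) * t powr ((N - 1) * \<alpha> * v) = 1"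
  proof -
    have "- \<alpha> * u + (N - 1) * \<alpha> * v = \<alpha> * ((N - 1) * v - u)" by (simp add: algebra_simps)
    then have "- \<alpha> * u + (N - 1) * \<alpha> * v = 0" using uv(4) by simp
    then show ?thesis using t by (simp only: powr_add[symmetric]) simp
  qed
  also have "z powr u * z powr v = z powr (1 / p)" using uv(3) by (simp add: powr_add[symmetric])
  finally have "x powr u * y powr v \<le> C1 powr u * C2 powr v * z powr (1 / p)" by simp
  also have "\<dots> \<le> (C1 powr u * C2 powr v + 1) * z powr (1 / p)"
    by (intro mult_right_mono) auto
  finally have "ennreal (x powr u * y powr v) \<le> ennreal ((C1 powr u * C2 powr v + 1) * z powr (1 / p))"
    by (rule ennreal_leI)
  then show ?thesis
    using x y z C by (simp add: ennreal_powr_ennreal powr_powr ennreal_mult u_def v_def)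
qed

theorem theorem1p7:
  fixes s p R :: real
  assumes "CARD('n::finite) \<ge> 2"
    and "s > 0" and "p \<ge> 1" and "R > 0"
    and "\<not> (p = 1 \<and> s \<in> \<int> \<and> s \<ge> 2)"
  shows "\<exists>K::ennreal. K < \<infinity> \<and>
    (\<forall>T\<in>SL. \<forall>f::real^'n \<Rightarrow> real. f \<in> W s p \<longrightarrow> supported_in_ball R f \<longrightarrow>
       ennreal_powr (Lp_norm p f) (1 - 1 / real CARD('n)) *
       ennreal_powr (W_seminorm s p f) (1 / real CARD('n))
       \<le> K * W_seminorm s p (f \<circ> (\<lambda>x. T *v x)))"
proof -
  let ?N = "real CARD('n)"
  obtain C1 C2 where C: "C1 \<ge> 0" "C2 \<ge> 0" and two_sided: "\<forall>(T::real^'n^'n) (f::real^'n \<Rightarrow> real) j a.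
    det T = 1 \<longrightarrow> f \<in> W s p \<longrightarrow> supported_in_ball R f \<longrightarrow> norm (T *v axis j 1) > 0 \<longrightarrow>
    a > 0 \<longrightarrow> (\<forall>x. norm x \<le> a * norm (T *v x)) \<longrightarrow>
    Lp_norm_pow p f \<le> ennreal (C1 * norm (T *v axis j 1) powr (- (s * p))) * W_seminorm_pow s p (\<lambda>x. f (T *v x)) \<and>
    W_seminorm_pow s p f \<le> ennreal (C2 * a powr (s * p)) * W_seminorm_pow s p (\<lambda>x. f (T *v x))"
    using int_two_sided[of s p R, where 'n='n] nonint_two_sided[of s p R, where 'n='n] assms by metis
  define c0 where "c0 = ?N * fact CARD('n)"
  have c0: "c0 > 0" by (simp add: c0_def)
  define C2' where "C2' = C2 * c0 powr (s * p)"
  have C2': "C2' \<ge> 0" using C by (simp add: C2'_def)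
  let ?K = "ennreal (C1 powr ((1 - 1 / ?N) / p) * C2' powr (1 / (p * ?N)) + 1)"
  show ?thesis
  proof (intro exI[of _ ?K] conjI ballI allI impI)
    fix T :: "real^'n^'n" and f :: "real^'n \<Rightarrow> real"
    assume "T \<in> SL" and f: "f \<in> W s p" "supported_in_ball R f"
    then have T: "det T = 1" by (simp add: SL_def)
    obtain j where j: "\<And>i. norm (T *v axis i 1) \<le> norm (T *v axis j 1)"
    proof -
      let ?S = "range (\<lambda>i. norm (T *v axis i 1))"
      have "Max ?S \<in> ?S" by (rule Max_in) auto
      then obtain j where j: "Max ?S = norm (T *v axis j 1)" by blast
      have "norm (T *v axis i 1) \<le> Max ?S" for i by (rule Max_ge) auto
      then show ?thesis using that[of j] unfolding j by blast
    qed
    let ?t = "norm (T *v axis j 1)"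
    define a where "a = c0 * ?t ^ (CARD('n) - 1)"
    have a: "norm x \<le> a * norm (T *v x)" for x
      unfolding a_def c0_def by (rule norm_preimage_SL_le[OF T j])
    have t: "?t > 0"
    proof -
      have "norm (axis j 1 :: real^'n) \<le> a * ?t" by (rule a)
      then have "?t \<noteq> 0" by auto
      then show ?thesis by simp
    qed
    have a0: "a > 0" using c0 t by (simp add: a_def)
    let ?Z = "W_seminorm_pow s p (\<lambda>x. f (T *v x))"
    have XY: "Lp_norm_pow p f \<le> ennreal (C1 * ?t powr (- (s * p))) * ?Z"
      "W_seminorm_pow s p f \<le> ennreal (C2 * a powr (s * p)) * ?Z"
      using two_sided T f t a0 a by blast+
    have "C2 * a powr (s * p) = C2' * ?t powr ((?N - 1) * (s * p))"
    proof -
      have "?t ^ (CARD('n) - 1) = ?t powr (?N - 1)"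
        using t assms(1) by (simp add: powr_realpow[symmetric] of_nat_diff)
      then show ?thesis by (simp add: C2'_def a_def powr_mult powr_powr)
    qed
    with XY(2) have Y: "W_seminorm_pow s p f \<le> ennreal (C2' * ?t powr ((?N - 1) * (s * p))) * ?Z" by simp
    have "ennreal_powr (ennreal_powr (Lp_norm_pow p f) (1 / p)) (1 - 1 / ?N) *
        ennreal_powr (ennreal_powr (W_seminorm_pow s p f) (1 / p)) (1 / ?N) \<le> ?K * ennreal_powr ?Z (1 / p)"
      using assms(1) by (intro combine_powers[OF _ assms(3) t C(1) C2' XY(1) Y]) simp
    then show "ennreal_powr (Lp_norm p f) (1 - 1 / ?N) * ennreal_powr (W_seminorm s p f) (1 / ?N)
       \<le> ?K * W_seminorm s p (f \<circ> (\<lambda>x. T *v x))"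
      by (simp only: Lp_norm_def W_seminorm_def o_def)
  qed simp
qed

end
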